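(* Let $N\ge1$ be an integer. Then $$\frac{|F(x)-F_N(x)|}{|F(x)|}\le\frac{\eta_N(x)}{|F(x)|}\le\begin{cases}c_N^*\,e^{-\pi N}, & \text{for } x\ge0,\\[1mm] 2c_N\,\dfrac{e^{-\pi N}}{\sqrt{N+1/2}}, & \text{for } x\le0,\end{cases}$$ where $$c_N^*=\frac{10\sqrt2\left(4+5\sqrt{2\pi}A_N\right)\left(1+2\sqrt\pi e^{-\beta A_N^2}\right)}{9\sqrt\pi\,e^{\pi/2}A_N\left(1-e^{-2A_N^2}\right)}+\frac{2\pi+1}{\pi e^{\pi/2}A_N}\left(\frac{1}{\sqrt2A_N}+\sqrt\pi\right).$$ Moreover $c_N^*$ decreases as $N$ increases, with $c_1^*\approx10.4$ and $\lim_{N\to\infty}c_N^*=100e^{-\pi/2}/9\approx2.3$.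
   Context: The Fresnel integral is $F(x):=\frac{e^{-i\pi/4}}{\sqrt\pi}\int_x^\infty e^{it^2}\,dt$ for $x\in\mathbb{R}$ (improper integral). For an integer $N\ge1$ put $A_N:=\sqrt{(N+1/2)\pi}$ and $t_k:=\frac{(k-1/2)\pi}{\sqrt{(N+1/2)\pi}}$, and define $$F_N(x):=\frac{1}{\exp\left(2A_Nxe^{-i\pi/4}\right)+1}+\frac{x}{A_N}e^{i(x^2+\pi/4)}\sum_{k=1}^N\frac{e^{-t_k^2}}{x^2+it_k^2}.$$ Let $\beta:=1-\frac{\sqrt2}{2}-\frac{2\sqrt2+1}{16}\approx 0.0536$. For $x\ge0$ define $$\Delta(x):=\begin{cases}\dfrac{x\,e^{-A_N^2}}{\sqrt\pi\,(A_N^2-x^2/2)\,(1-e^{-2A_N^2})}, & 0\le \frac{x}{\sqrt2}\le\frac34A_N,\\[2mm] \dfrac{4x\,e^{-A_N^2}\left(1+2\sqrt\pi\,e^{-\beta A_N^2}\right)}{\sqrt\pi\,A_N(A_N+x/\sqrt2)\,(1-e^{-2A_N^2})}, & \frac34A_N<\frac{x}{\sqrt2}<\frac54A_N,\\[2mm] \dfrac{x\,e^{-A_N^2}}{\sqrt\pi\,(x^2/2-A_N^2)\,(1-e^{-2A_N^2})}+\dfrac{e^{-\sqrt2A_Nx}}{1-e^{-\sqrt2A_Nx}}, & \frac{x}{\sqrt2}\ge\frac54A_N,\end{cases}$$ and for $x\in\mathbb{R}$ define $$\eta_N(x):=\Delta(|x|)+\frac{(2\pi+1)|x|}{2\pi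 A_N\sqrt{x^4+A_N^4}}\,e^{-A_N^2}.$$ Finally, $$c_N:=\frac{20\sqrt2\,e^{-\pi/2}}{9\pi\left(1-e^{-2A_N^2}\right)}\left(1+2\sqrt\pi\,e^{-\beta A_N^2}\right)+\frac{(2\pi+1)e^{-\pi/2}}{2\sqrt2\,\pi^{3/2}A_N}.$$ *)

theory Defs
  imports "HOL-Analysis.Analysis"
begin

text \<open>The integral over the half-line is the improper one: a limit of integrals over
  compact intervals (the integrand is not absolutely integrable).\<close>

definition fresnel :: "real \<Rightarrow> complex" where
  "fresnel x = exp (- (\<i> * of_real pi / 4)) / of_real (sqrt pi) *
     Lim at_top (\<lambda>R. integral {x..R} (\<lambda>t::real. exp (\<i> * of_real (t\<^sup>2))))"

definition A_N :: "nat \<Rightarrow> real" where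
  "A_N N = sqrt ((real N + 1/2) * pi)"

definition node :: "nat \<Rightarrow> nat \<Rightarrow> real" where
  "node N k = (real k - 1/2) * pi / sqrt ((real N + 1/2) * pi)"

definition fresnel_approx :: "nat \<Rightarrow> real \<Rightarrow> complex" where
  "fresnel_approx N x =
     1 / (exp (2 * of_real (A_N N) * of_real x * exp (- (\<i> * of_real pi / 4))) + 1)
     + of_real (x / A_N N) * exp (\<i> * of_real (x\<^sup>2 + pi / 4)) *
       (\<Sum>k=1..N. of_real (exp (- (node N k)\<^sup>2)) /
                   (of_real (x\<^sup>2) + \<i> * of_real ((node N k)\<^sup>2)))"

definition beta :: real where
  "beta = 1 - sqrt 2 / 2 - (2 * sqrt 2 + 1) / 16"

text \<open>Only the values at \<open>x \<ge> 0\<close> are meaningful.\<close>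

definition Delta :: "nat \<Rightarrow> real \<Rightarrow> real" where
  "Delta N x =
    (if x / sqrt 2 \<le> 3/4 * A_N N then
       x * exp (- (A_N N)\<^sup>2) /
         (sqrt pi * ((A_N N)\<^sup>2 - x\<^sup>2 / 2) * (1 - exp (- 2 * (A_N N)\<^sup>2)))
     else if x / sqrt 2 < 5/4 * A_N N then
       4 * x * exp (- (A_N N)\<^sup>2) * (1 + 2 * sqrt pi * exp (- beta * (A_N N)\<^sup>2)) /
         (sqrt pi * A_N N * (A_N N + x / sqrt 2) * (1 - exp (- 2 * (A_N N)\<^sup>2)))
     else
       x * exp (- (A_N N)\<^sup>2) /
         (sqrt pi * (x\<^sup>2 / 2 - (A_N N)\<^sup>2) * (1 - exp (- 2 * (A_N N)\<^sup>2)))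
       + exp (- sqrt 2 * A_N N * x) / (1 - exp (- sqrt 2 * A_N N * x)))"

definition eta :: "nat \<Rightarrow> real \<Rightarrow> real" where
  "eta N x = Delta N \<bar>x\<bar>
     + (2 * pi + 1) * \<bar>x\<bar> / (2 * pi * A_N N * sqrt (x^4 + (A_N N)^4)) * exp (- (A_N N)\<^sup>2)"

definition c_N :: "nat \<Rightarrow> real" where
  "c_N N = 20 * sqrt 2 * exp (- pi / 2) / (9 * pi * (1 - exp (- 2 * (A_N N)\<^sup>2)))
           * (1 + 2 * sqrt pi * exp (- beta * (A_N N)\<^sup>2))
         + (2 * pi + 1) * exp (- pi / 2) / (2 * sqrt 2 * pi powr (3/2) * A_N N)"

definition c_star :: "nat \<Rightarrow> real" where
  "c_star N =
     10 * sqrt 2 * (4 + 5 * sqrt (2 * pi) * A_N N) * (1 + 2 * sqrt pi * exp (- beta * (A_N N)\<^sup>2)) /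
       (9 * sqrt pi * exp (pi / 2) * A_N N * (1 - exp (- 2 * (A_N N)\<^sup>2)))
     + (2 * pi + 1) / (pi * exp (pi / 2) * A_N N) * (1 / (sqrt 2 * A_N N) + sqrt pi)"

end

theory Submission
  imports Defs "HOL-Probability.Characteristic_Functions" "HOL-Complex_Analysis.Cauchy_Integral_Theorem"
begin

text \<open>
  Let \<open>w = exp (- \<i> * pi / 4) * x\<close>, so that \<open>w\<^sup>2 = - \<i> * x\<^sup>2\<close>, and let \<open>A = A_N N\<close> and
  \<open>t k = (k + 1/2) * pi / A\<close>.  For \<open>x > 0\<close>, everything is written as an integral over \<open>[0, 1]\<close>.

  The Fresnel integral is \<open>1/2 - w / sqrt pi * (integral of exp (- v\<^sup>2 * w\<^sup>2))\<close>, by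
  \<open>fresnel_eq_integral_unit_interval\<close>.  The exponential term of the approximation has the partial
  fraction expansion \<open>1/2 - w / A * (\<Sum>k. 1 / (w\<^sup>2 + (t k)\<^sup>2))\<close>, by \<open>logistic_partial_fractions\<close>.
  Together with the untruncated sum it is therefore \<open>1/2 - w / A\<close> times the sum of
  \<open>(1 - exp (- w\<^sup>2 - (t k)\<^sup>2)) / (w\<^sup>2 + (t k)\<^sup>2)\<close>, and each of these summands is the integral of
  \<open>2 * v * exp (- v\<^sup>2 * (w\<^sup>2 + (t k)\<^sup>2))\<close> over \<open>[0, 1]\<close>.  The theta identity
  \<open>gaussian_midpoint_theta\<close> evaluates
  \[ \sum_k 2 v e^{-v^2 t_k^2} = \frac{A}{\sqrt\pi}
     \Bigl(1 + 2 \sum_{n \ge 1} (-1)^n e^{-(A n / v)^2}\Bigr). \]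
  The constant one reproduces the Fresnel integral, and the error of the untruncated formula is exactly
  \[ \frac{w}{\sqrt\pi} \sum_{n \ge 1} (-1)^n \int_0^1 2 e^{i v^2 x^2} e^{-(A n / v)^2}\,dv. \]
  The integrals are at most \<open>exp (- (A * n)\<^sup>2)\<close> times \<open>1 / (A * n)\<^sup>2\<close>, by size, and times
  \<open>2 / x\<^sup>2\<close>, by parts.  This
  representation is regular at \<open>x = sqrt 2 * A\<close>, where a contour argument meets a pole, and
  it yields a bound below all three branches of \<open>Delta\<close> (\<open>midpoint_rule_error\<close>, \<open>Delta_ge\<close>).
  The omitted summands are dominated by a geometric series and give the second term of \<open>eta\<close>.
  Negative \<open>x\<close> are reduced to positive ones by the symmetry \<open>1 - F\<close> of both functions.

  For the relative error, the Fresnel integral is computed along a horizontal ray on which the integrand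
  decays.  This gives modulus at least \<open>1/2\<close> for \<open>x \<le> 0\<close>, and at least
  \<open>1 / (sqrt pi * (x + sqrt (x\<^sup>2 + 4)))\<close> for \<open>x \<ge> 0\<close> (\<open>norm_fresnel_ge\<close>, from a Mills ratio
  inequality).  The latter is at least \<open>1 / (2 + 2 * sqrt pi * x)\<close> when \<open>x \<ge> 2\<close>.  The product of \<open>Delta\<close> and
  \<open>2 + 2 * sqrt pi * x\<close> is controlled by its value at the end \<open>x = 5 * sqrt 2 / 4 * A\<close> of the middle
  range, which is where the constants come from.  Finally \<open>c_star\<close> is a combination of decreasing functions of
  \<open>A\<close>, and its first value and its limit are found by rational bounds for \<open>pi\<close>, square roots and exponentials.
\<close>

section \<open>The theta identity at midpoints\<close>

text \<open>The real part of the characteristic function of the standard normal distribution,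
  rescaled by \<open>sqrt (2 * a)\<close>.\<close>

lemma has_bochner_integral_gaussian_cos:
  fixes a b :: real
  assumes a: "a > 0"
  shows "has_bochner_integral lborel (\<lambda>t. exp (- a * t\<^sup>2) * cos (b * t))
           (sqrt (pi / a) * exp (- b\<^sup>2 / (4 * a)))"
proof -
  define s where "s = sqrt (2 * a)"
  have s: "s > 0" "s\<^sup>2 = 2 * a" using a by (auto simp: s_def)
  interpret prob_space std_normal_distribution
    by (rule prob_space_normal_density) simp
  have int: "integrable std_normal_distribution (\<lambda>x. iexp (b / s * x))"
    by (rule integrable_iexp) auto
  have "has_bochner_integral std_normal_distribution (\<lambda>x. iexp (b / s * x))
      (complex_of_real (exp (- (b / s)\<^sup>2 / 2)))"
    using int char_std_normal_distribution unfolding char_def has_bochner_integral_iff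
    by metis
  then have "has_bochner_integral lborel (\<lambda>x. std_normal_density x *\<^sub>R iexp (b / s * x))
      (complex_of_real (exp (- (b / s)\<^sup>2 / 2)))"
    unfolding has_bochner_integral_iff
    by (subst (asm) integrable_density, simp, simp, simp, subst (asm) integral_density) auto
  then have "has_bochner_integral lborel (\<lambda>x. std_normal_density (0 + s * x) *\<^sub>R iexp (b / s * (0 + s * x)))
      (complex_of_real (exp (- (b / s)\<^sup>2 / 2)) /\<^sub>R \<bar>s\<bar>)"
    using s by (subst (asm) lborel_has_bochner_integral_real_affine_iff[of s _ _ 0]) auto
  then have "has_bochner_integral lborel
      (\<lambda>x. Re (std_normal_density (0 + s * x) *\<^sub>R iexp (b / s * (0 + s * x))))
      (Re (complex_of_real (exp (- (b / s)\<^sup>2 / 2)) /\<^sub>R \<bar>s\<bar>))"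
    by (rule has_bochner_integral_bounded_linear[OF bounded_linear_Re])
  also have "(\<lambda>x. Re (std_normal_density (0 + s * x) *\<^sub>R iexp (b / s * (0 + s * x))))
      = (\<lambda>t. exp (- a * t\<^sup>2) * cos (b * t) / sqrt (2 * pi))"
    using s by (simp add: std_normal_density_def Re_exp power_mult_distrib)
  also have "Re (complex_of_real (exp (- (b / s)\<^sup>2 / 2)) /\<^sub>R \<bar>s\<bar>) = exp (- b\<^sup>2 / (4 * a)) / s"
    using s by (simp add: power_divide divide_simps)
  finally have "has_bochner_integral lborel
      (\<lambda>t. exp (- a * t\<^sup>2) * cos (b * t) / sqrt (2 * pi) * sqrt (2 * pi))
      (exp (- b\<^sup>2 / (4 * a)) / s * sqrt (2 * pi))"
    by (rule has_bochner_integral_mult_left)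
  then show ?thesis
    by (simp add: s_def real_sqrt_mult real_sqrt_divide mult_ac)
qed

text \<open>The usual Dirichlet kernel translated by half a period, so that its mass concentrates at
  the midpoints \<open>k + 1/2\<close> instead of the integers.\<close>

definition alternating_dirichlet_kernel :: "nat \<Rightarrow> real \<Rightarrow> real" where
  "alternating_dirichlet_kernel m t = 1 + 2 * (\<Sum>n=1..m. (-1) ^ n * cos (2 * pi * real n * t))"

text \<open>Multiplication by \<open>cos (pi * t)\<close> telescopes the kernel, and a second factor telescopes its
  Fejer sums.  Hence those sums, multiplied by \<open>(cos (pi * t))\<^sup>2\<close>, stay in \<open>[0, 1]\<close>: they can only
  be large where the cosine vanishes.\<close>

lemma alternating_dirichlet_kernel_mult_cos:
  "alternating_dirichlet_kernel m t * cos (pi * t) = (-1) ^ m * cos ((2 * real m + 1) * pi * t)"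
proof (induction m)
  case 0
  then show ?case by (simp add: alternating_dirichlet_kernel_def)
next
  case (Suc m)
  have "2 * (cos (2 * pi * real (Suc m) * t) * cos (pi * t))
      = cos (2 * pi * real (Suc m) * t - pi * t) + cos (2 * pi * real (Suc m) * t + pi * t)"
    by (simp add: cos_times_cos)
  also have "2 * pi * real (Suc m) * t - pi * t = (2 * real m + 1) * pi * t"
    by (simp add: algebra_simps)
  finally have "2 * (cos (2 * pi * real (Suc m) * t) * cos (pi * t))
      = cos ((2 * real m + 1) * pi * t) + cos ((2 * real (Suc m) + 1) * pi * t)"
    by (simp add: algebra_simps)
  moreover have "alternating_dirichlet_kernel (Suc m) t
     = alternating_dirichlet_kernel m t - (-1) ^ m * (2 * cos (2 * pi * real (Suc m) * t))"
    by (simp add: alternating_dirichlet_kernel_def algebra_simps)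
  ultimately have "alternating_dirichlet_kernel (Suc m) t * cos (pi * t)
     = alternating_dirichlet_kernel m t * cos (pi * t) - (-1) ^ m *
       (cos ((2 * real m + 1) * pi * t) + cos ((2 * real (Suc m) + 1) * pi * t))"
    by (simp only: left_diff_distrib mult.assoc)
  then show ?case
    unfolding Suc.IH by (simp only: distrib_left power_Suc)
qed

lemma sum_alternating_dirichlet_kernel_mult_cos_squared:
  "(\<Sum>m<M. alternating_dirichlet_kernel m t) * (cos (pi * t))\<^sup>2
     = (1 - (-1) ^ M * cos (2 * real M * pi * t)) / 2"
proof (induction M)
  case 0
  then show ?case by simp
next
  case (Suc M)
  have "alternating_dirichlet_kernel M t * (cos (pi * t))\<^sup>2
      = (-1) ^ M * (cos ((2 * real M + 1) * pi * t) * cos (pi * t))"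
    using alternating_dirichlet_kernel_mult_cos[of M t] by (simp add: power2_eq_square)
  also have "cos ((2 * real M + 1) * pi * t) * cos (pi * t)
      = (cos (2 * real M * pi * t) + cos (2 * real (Suc M) * pi * t)) / 2"
    unfolding cos_times_cos by (simp add: algebra_simps)
  finally show ?case
    using Suc.IH by (simp add: field_simps)
qed

text \<open>Jordan's inequality, from concavity of the sine.\<close>

lemma sin_pi_mult_ge:
  assumes "0 \<le> s" "s \<le> 1/2"
  shows "2 * s \<le> sin (pi * s)"
proof -
  have "concave_on {0..pi/2} sin"
  proof (rule f''_le0_imp_concave)
    show "(sin has_real_derivative cos x) (at x)" "(cos has_real_derivative - sin x) (at x)" for x :: real
      by (auto intro!: derivative_eq_intros)
    show "- sin x \<le> 0" if "x \<in> {0..pi/2}" for x using that by (auto intro!: sin_ge_zero)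
  qed auto
  from concave_onD_Icc'[OF this, of "pi * s"] assms
  show ?thesis by (simp add: field_simps)
qed

lemma square_le_cos_squared:
  assumes "\<bar>t - (real k + 1/2)\<bar> \<le> 1/2"
  shows "4 * (t - (real k + 1/2))\<^sup>2 \<le> (cos (pi * t))\<^sup>2"
proof -
  define s where "s = t - (real k + 1/2)"
  have "cos (pi * t) = cos (pi * s + pi / 2 + real k * pi)"
    by (rule arg_cong[of _ _ cos]) (simp add: s_def field_simps)
  then have "\<bar>cos (pi * t)\<bar> = \<bar>sin (pi * s)\<bar>"
    by (simp add: cos_add sin_add abs_mult)
  also have "\<dots> \<ge> 2 * \<bar>s\<bar>"
    using sin_pi_mult_ge[of "\<bar>s\<bar>"] assms unfolding s_def[symmetric]
    by (cases "s \<ge> 0") auto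
  finally have "(2 * \<bar>s\<bar>)\<^sup>2 \<le> \<bar>cos (pi * t)\<bar>\<^sup>2" by (intro power_mono) auto
  then show ?thesis by (simp add: s_def power_mult_distrib)
qed

text \<open>The Fejer sum may grow like \<open>M\<^sup>2\<close> at a midpoint, but a factor vanishing there to second order
  makes it bounded uniformly in \<open>M\<close>.\<close>

lemma fejer_concentration:
  assumes "\<bar>t - (real k + 1/2)\<bar> \<le> 1/2"
  shows "(t - (real k + 1/2))\<^sup>2 * \<bar>\<Sum>m<M. alternating_dirichlet_kernel m t\<bar> \<le> 1/4"
proof -
  let ?S = "\<Sum>m<M. alternating_dirichlet_kernel m t"
  have "4 * (t - (real k + 1/2))\<^sup>2 * \<bar>?S\<bar> \<le> (cos (pi * t))\<^sup>2 * \<bar>?S\<bar>"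
    by (intro mult_right_mono square_le_cos_squared assms) auto
  also have "\<dots> = \<bar>?S * (cos (pi * t))\<^sup>2\<bar>" by (simp add: abs_mult)
  also have "\<dots> \<le> 1"
  proof -
    have "\<bar>(-1) ^ M * cos (2 * real M * pi * t)\<bar> \<le> 1" by (simp add: abs_mult)
    then have "-1 \<le> (-1) ^ M * cos (2 * real M * pi * t)" "(-1) ^ M * cos (2 * real M * pi * t) \<le> 1"
      by linarith+
    then show ?thesis
      unfolding sum_alternating_dirichlet_kernel_mult_cos_squared by (simp add: field_simps)
  qed
  finally show ?thesis by simp
qed

lemma has_integral_alternating_dirichlet_kernel:
  "(alternating_dirichlet_kernel m has_integral 1) {real k..real k + 1}"
proof -
  have "((\<lambda>t. cos (2 * pi * real n * t)) has_integral 0) {real k..real k + 1}" if "n \<ge> 1" for n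
  proof -
    have "((\<lambda>t. cos (2 * pi * real n * t)) has_integral
        sin (2 * pi * real n * (real k + 1)) / (2 * pi * real n) - sin (2 * pi * real n * real k) / (2 * pi * real n))
        {real k..real k + 1}"
      using that by (intro fundamental_theorem_of_calculus)
        (auto intro!: derivative_eq_intros simp flip: has_real_derivative_iff_has_vector_derivative)
    moreover have "sin (2 * pi * real n * (real k + 1)) = 0" "sin (2 * pi * real n * real k) = 0"
      using sin_npi[of "2 * n * (k+1)"] sin_npi[of "2 * n * k"] by (simp_all add: algebra_simps)
    ultimately show ?thesis by simp
  qed
  then have "((\<lambda>t. \<Sum>n=1..m. (-1) ^ n * cos (2 * pi * real n * t)) has_integral (\<Sum>n=1..m. (-1) ^ n * 0))
      {real k..real k + 1}"
    by (intro has_integral_sum has_integral_mult_right) auto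
  from has_integral_add[OF has_integral_const_real[of 1 "real k" "real k + 1"] has_integral_mult_right[OF this, of 2]]
  show ?thesis by (simp add: alternating_dirichlet_kernel_def[abs_def])
qed

lemma has_integral_centred_alternating_dirichlet_kernel:
  "((\<lambda>t. (t - (real k + 1/2)) * alternating_dirichlet_kernel m t) has_integral 0) {real k..real k + 1}"
proof -
  define c where "c = real k + 1/2"
  have "((\<lambda>t. (t - c) * cos (2 * pi * real n * t)) has_integral 0) {real k..real k + 1}" if "n \<ge> 1" for n
  proof -
    define b where "b = 2 * pi * real n"
    have b: "b \<noteq> 0" using that by (simp add: b_def)
    have "((\<lambda>t. (t - c) * cos (b * t)) has_integral
        ((real k + 1 - c) * sin (b * (real k + 1)) / b + cos (b * (real k + 1)) / b\<^sup>2)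
         - ((real k - c) * sin (b * real k) / b + cos (b * real k) / b\<^sup>2))
        {real k..real k + 1}"
      using b by (intro fundamental_theorem_of_calculus)
        (auto intro!: derivative_eq_intros simp: power2_eq_square field_simps simp flip: has_real_derivative_iff_has_vector_derivative)
    moreover have "sin (b * (real k + 1)) = 0" "sin (b * real k) = 0"
      using sin_npi[of "2 * n * (k+1)"] sin_npi[of "2 * n * k"] by (simp_all add: algebra_simps b_def)
    moreover have "cos (b * (real k + 1)) = 1" "cos (b * real k) = 1"
      using cos_npi[of "2 * n * (k+1)"] cos_npi[of "2 * n * k"] by (simp_all add: algebra_simps b_def)
    ultimately show ?thesis by (simp add: b_def)
  qed
  then have "((\<lambda>t. \<Sum>n=1..m. (-1) ^ n * ((t - c) * cos (2 * pi * real n * t))) has_integral (\<Sum>n=1..m. (-1) ^ n * 0))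
      {real k..real k + 1}"
    by (intro has_integral_sum has_integral_mult_right) auto
  moreover have "((\<lambda>t. t - c) has_integral ((real k + 1 - c)\<^sup>2 / 2 - (real k - c)\<^sup>2 / 2)) {real k..real k + 1}"
    by (intro fundamental_theorem_of_calculus)
        (auto intro!: derivative_eq_intros simp flip: has_real_derivative_iff_has_vector_derivative)
  ultimately have "((\<lambda>t. (t - c) + 2 * (\<Sum>n=1..m. (-1) ^ n * ((t - c) * cos (2 * pi * real n * t)))) has_integral
      ((real k + 1 - c)\<^sup>2 / 2 - (real k - c)\<^sup>2 / 2) + 2 * (\<Sum>n=1..m. (-1) ^ n * 0)) {real k..real k + 1}"
    by (intro has_integral_add has_integral_mult_right)
  then show ?thesis
    unfolding alternating_dirichlet_kernel_def c_def[symmetric]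
    by (simp add: c_def power2_eq_square algebra_simps sum_distrib_left)
qed


text \<open>The Gaussian minus its tangent at a midpoint vanishes to second order there.  The constant
  is summable over \<open>k\<close>.\<close>

lemma gaussian_second_order_taylor:
  fixes a t :: real
  assumes a: "a > 0" and t: "real k \<le> t" "t \<le> real k + 1"
  defines "c \<equiv> real k + 1/2"
  shows "\<bar>exp (- a * t\<^sup>2) - (exp (- a * c\<^sup>2) - 2 * a * c * exp (- a * c\<^sup>2) * (t - c))\<bar>
           \<le> (2 * a\<^sup>2 * (real k + 1)\<^sup>2 + a) * exp (- a * (real k)\<^sup>2) * (t - c)\<^sup>2"
proof (cases "t = c")
  case False
  define d where "d = (\<lambda>m::nat. if m = 0 then (\<lambda>t. exp (- a * t\<^sup>2)) else
     if m = 1 then (\<lambda>t. - 2 * a * t * exp (- a * t\<^sup>2)) else (\<lambda>t. (4 * a\<^sup>2 * t\<^sup>2 - 2 * a) * exp (- a * t\<^sup>2)))"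
  have "\<exists>s. (if t < c then t < s \<and> s < c else c < s \<and> s < t) \<and>
     exp (- a * t\<^sup>2) = (\<Sum>m<2. d m c / fact m * (t - c) ^ m) + d 2 s / fact 2 * (t - c)\<^sup>2"
  proof (rule Taylor[of 2 d _ "real k" "real k + 1"])
    show "\<forall>m t. m < 2 \<and> real k \<le> t \<and> t \<le> real k + 1 \<longrightarrow> (d m has_real_derivative d (Suc m) t) (at t)"
      by (auto simp: d_def less_2_cases_iff power2_eq_square algebra_simps intro!: derivative_eq_intros)
  qed (use False t in \<open>auto simp: d_def c_def\<close>)
  then obtain s where s: "if t < c then t < s \<and> s < c else c < s \<and> s < t"
    and eq: "exp (- a * t\<^sup>2) = (\<Sum>m<2. d m c / fact m * (t - c) ^ m) + d 2 s / fact 2 * (t - c)\<^sup>2"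
    by blast
  have s': "real k \<le> s" "s \<le> real k + 1"
    using s t by (auto simp: c_def split: if_splits)
  have "d 2 s / fact 2 = (2 * a\<^sup>2 * s\<^sup>2 - a) * exp (- a * s\<^sup>2)"
    by (simp add: d_def field_simps)
  then have "\<bar>d 2 s / fact 2\<bar> = \<bar>2 * a\<^sup>2 * s\<^sup>2 - a\<bar> * exp (- a * s\<^sup>2)"
    by (simp add: abs_mult)
  also have "\<dots> \<le> (2 * a\<^sup>2 * (real k + 1)\<^sup>2 + a) * exp (- a * (real k)\<^sup>2)"
  proof (rule mult_mono)
    have "s\<^sup>2 \<le> (real k + 1)\<^sup>2" using s' by (intro power_mono) auto
    then have "2 * a\<^sup>2 * s\<^sup>2 \<le> 2 * a\<^sup>2 * (real k + 1)\<^sup>2" by (intro mult_left_mono) auto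
    then show "\<bar>2 * a\<^sup>2 * s\<^sup>2 - a\<bar> \<le> 2 * a\<^sup>2 * (real k + 1)\<^sup>2 + a"
      using a mult_nonneg_nonneg[OF zero_le_power2[of a] zero_le_power2[of s]]
        mult_nonneg_nonneg[OF zero_le_power2[of a] zero_le_power2[of "real k + 1"]]
      unfolding abs_le_iff by linarith
    show "exp (- a * s\<^sup>2) \<le> exp (- a * (real k)\<^sup>2)"
      using s' a by (simp add: power_mono)
  qed (use a in auto)
  finally have "\<bar>d 2 s / fact 2\<bar> * (t - c)\<^sup>2
      \<le> (2 * a\<^sup>2 * (real k + 1)\<^sup>2 + a) * exp (- a * (real k)\<^sup>2) * (t - c)\<^sup>2"
    by (rule mult_right_mono) auto
  moreover have "exp (- a * t\<^sup>2) - (exp (- a * c\<^sup>2) - 2 * a * c * exp (- a * c\<^sup>2) * (t - c))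
     = d 2 s / fact 2 * (t - c)\<^sup>2"
    by (subst eq) (simp add: d_def numeral_2_eq_2)
  ultimately show ?thesis by (simp only: abs_mult abs_power2)
qed (use a in auto)

lemma continuous_alternating_dirichlet_kernel [continuous_intros]:
  "continuous_on S (alternating_dirichlet_kernel m)"
  unfolding alternating_dirichlet_kernel_def[abs_def] by (intro continuous_intros)

text \<open>The kernels are symmetric about the midpoint and have mass one on the unit interval, so
  the tangent contributes exactly \<open>M\<close> times the midpoint value.  The remainder is of second order
  and is absorbed by \<open>fejer_concentration\<close>, with a bound that does not depend on \<open>M\<close>.\<close>

lemma gaussian_fejer_localisation:
  fixes a :: real
  assumes a: "a > 0"
  shows "\<bar>integral {real k..real k + 1} (\<lambda>t. exp (- a * t\<^sup>2) * (\<Sum>m<M. alternating_dirichlet_kernel m t))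
           - real M * exp (- a * (real k + 1/2)\<^sup>2)\<bar>
         \<le> (2 * a\<^sup>2 * (real k + 1)\<^sup>2 + a) * exp (- a * (real k)\<^sup>2) / 4"
proof -
  define c where "c = real k + 1/2"
  define S where "S = (\<lambda>t. \<Sum>m<M. alternating_dirichlet_kernel m t)"
  define p where "p = (\<lambda>t. exp (- a * t\<^sup>2) - (exp (- a * c\<^sup>2) - 2 * a * c * exp (- a * c\<^sup>2) * (t - c)))"
  define B where "B = (2 * a\<^sup>2 * (real k + 1)\<^sup>2 + a) * exp (- a * (real k)\<^sup>2)"
  let ?I = "{real k..real k + 1}"
  have S1: "(S has_integral (\<Sum>m<M. 1)) ?I"
    unfolding S_def by (intro has_integral_sum has_integral_alternating_dirichlet_kernel) auto
  have "((\<lambda>t. \<Sum>m<M. (t - c) * alternating_dirichlet_kernel m t) has_integral (\<Sum>m<M. 0)) ?I"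
    unfolding c_def
    by (intro has_integral_sum has_integral_centred_alternating_dirichlet_kernel) auto
  then have S2: "((\<lambda>t. (t - c) * S t) has_integral 0) ?I"
    by (simp add: S_def sum_distrib_left)
  have contS: "continuous_on ?I S"
    unfolding S_def by (intro continuous_intros)
  have intp: "(\<lambda>t. p t * S t) integrable_on ?I"
    unfolding p_def by (intro integrable_continuous_real continuous_intros contS)
  have "((\<lambda>t. p t * S t + (exp (- a * c\<^sup>2) * S t - 2 * a * c * exp (- a * c\<^sup>2) * ((t - c) * S t)))
      has_integral (integral ?I (\<lambda>t. p t * S t) + (exp (- a * c\<^sup>2) * (\<Sum>m<M. 1) - 2 * a * c * exp (- a * c\<^sup>2) * 0))) ?I"
    by (intro has_integral_add has_integral_diff has_integral_mult_right S1 S2 integrable_integral intp)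
  also have "(\<lambda>t. p t * S t + (exp (- a * c\<^sup>2) * S t - 2 * a * c * exp (- a * c\<^sup>2) * ((t - c) * S t)))
      = (\<lambda>t. exp (- a * t\<^sup>2) * S t)"
    by (auto simp: p_def algebra_simps)
  finally have "integral ?I (\<lambda>t. exp (- a * t\<^sup>2) * S t) - real M * exp (- a * c\<^sup>2)
     = integral ?I (\<lambda>t. p t * S t)"
    by (simp add: integral_unique)
  also have "\<bar>\<dots>\<bar> \<le> integral ?I (\<lambda>t. B / 4)"
  proof -
    have "norm (p t * S t) \<le> B / 4" if "t \<in> ?I" for t
    proof -
      have "\<bar>p t\<bar> * \<bar>S t\<bar> \<le> (B * (t - c)\<^sup>2) * \<bar>S t\<bar>"
        using gaussian_second_order_taylor[OF a, of k t] that
        unfolding p_def c_def B_def by (intro mult_right_mono) auto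
      also have "\<dots> = B * ((t - c)\<^sup>2 * \<bar>S t\<bar>)" by simp
      also have "\<dots> \<le> B * (1 / 4)"
      proof (rule mult_left_mono)
        have "\<bar>t - c\<bar> \<le> 1/2" using that unfolding c_def abs_le_iff by auto
        then show "(t - c)\<^sup>2 * \<bar>S t\<bar> \<le> 1 / 4"
          using fejer_concentration[of t k M] by (simp add: c_def S_def)
      qed (use a in \<open>auto simp: B_def\<close>)
      finally show ?thesis by (simp add: abs_mult)
    qed
    from integral_norm_bound_integral[OF intp integrable_const_ivl this] show ?thesis by simp
  qed
  finally show ?thesis by (simp add: c_def S_def B_def)
qed

lemma integral_symmetric_intervals_tendsto:
  fixes f :: "real \<Rightarrow> real"
  assumes f: "integrable lborel f"
  shows "(\<lambda>K. integral {- real K..real K} f) \<longlonglongrightarrow> (\<integral>x. f x \<partial>lborel)"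
proof -
  have [measurable]: "f \<in> borel_measurable borel" using f by auto
  have "(\<lambda>K. \<integral>x. indicator {- real K..real K} x *\<^sub>R f x \<partial>lborel) \<longlonglongrightarrow> (\<integral>x. f x \<partial>lborel)"
  proof (rule integral_dominated_convergence[where w = "\<lambda>x. \<bar>f x\<bar>"])
    show "AE x in lborel. (\<lambda>K. indicator {- real K..real K} x *\<^sub>R f x) \<longlonglongrightarrow> f x"
    proof (rule AE_I2, rule tendsto_eventually)
      fix x :: real
      obtain n where "\<bar>x\<bar> \<le> real n" using real_arch_simple by blast
      then show "\<forall>\<^sub>F K in sequentially. indicator {- real K..real K} x *\<^sub>R f x = f x"
        by (intro eventually_sequentiallyI[of n]) (auto simp: indicator_def)
    qed
  qed (use f in \<open>auto simp: indicator_def\<close>)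
  moreover have "(\<integral>x. indicator {- real K..real K} x *\<^sub>R f x \<partial>lborel) = integral {- real K..real K} f" for K
    using set_borel_integral_eq_integral(2)[of "{- real K..real K}" f]
      integrable_mult_indicator[OF _ f, of "{- real K..real K}"]
    by (simp add: set_integrable_def set_lebesgue_integral_def)
  ultimately show ?thesis by simp
qed

lemma integral_unit_intervals:
  fixes f :: "real \<Rightarrow> real"
  assumes "continuous_on UNIV f"
  shows "integral {0..real K} f = (\<Sum>k<K. integral {real k..real k + 1} f)"
proof (induction K)
  case (Suc K)
  have "f integrable_on {0..real K + 1}"
    using assms by (intro integrable_continuous_real) (auto intro: continuous_on_subset)
  from Henstock_Kurzweil_Integration.integral_combine[OF _ _ this, of "real K"] Suc.IH
  show ?case by (simp add: add.commute)
qed auto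

text \<open>Plays the role of Cesaro summation: the Fejer estimate bounds sums of errors, and a nonzero limit of
  the errors would make such sums grow linearly.\<close>

lemma bounded_partial_sums_limit_zero:
  fixes d :: "nat \<Rightarrow> real"
  assumes lim: "d \<longlonglongrightarrow> l" and bdd: "\<And>M. \<bar>\<Sum>m<M. d m\<bar> \<le> C"
  shows "l = 0"
proof -
  have "\<not> l > 0" if lim: "d \<longlonglongrightarrow> l" and bdd: "\<And>M. \<bar>\<Sum>m<M. d m\<bar> \<le> C" for d :: "nat \<Rightarrow> real" and l
  proof
    assume l: "l > 0"
    with order_tendstoD(1)[OF lim, of "l/2"] obtain m0 where m0: "\<And>m. m \<ge> m0 \<Longrightarrow> d m > l/2"
      by (auto simp: eventually_sequentially)
    obtain n :: nat where n: "real n * (l / 2) > 2 * C"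
      using l reals_Archimedean3[of "l/2"] by (meson half_gt_zero)
    have "real n * (l/2) \<le> (\<Sum>m=m0..<m0+n. d m)"
      using sum_bounded_below[of "{m0..<m0+n}" "l/2" d] m0 by (auto simp: less_imp_le)
    also have "\<dots> = (\<Sum>m<m0+n. d m) - (\<Sum>m<m0. d m)"
      by (simp add: sum_diff_nat_ivl[of 0 m0 "m0+n" d, symmetric] atLeast0LessThan[symmetric])
    also have "\<dots> \<le> 2 * C"
      using bdd[of "m0+n"] bdd[of m0] by linarith
    finally show False using n by simp
  qed
  from this[OF lim bdd] this[of "\<lambda>m. - d m" "-l"] lim bdd show ?thesis
    by (force simp: sum_negf tendsto_minus_cancel_left[symmetric])
qed

text \<open>Jacobi's inversion formula at the midpoints, i.e. Poisson summation for a Gaussian.  Let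
  \<open>s m\<close> be the right-hand side truncated after \<open>m\<close> terms; it is the integral of the Gaussian
  against the \<open>m\<close>-th kernel.  Localisation on unit intervals shows that \<open>\<Sum>m<M. s m\<close> differs from
  \<open>M\<close> times the left-hand side by a bounded amount, so \<open>s m\<close> converges to the left-hand side.\<close>

theorem gaussian_midpoint_theta:
  fixes a :: real
  assumes a: "a > 0"
  shows "summable (\<lambda>k. exp (- a * (real k + 1/2)\<^sup>2))" (is ?sum1)
    and "summable (\<lambda>n. (-1) ^ Suc n * exp (- (pi * real (Suc n))\<^sup>2 / a))" (is ?sum2)
    and "2 * (\<Sum>k. exp (- a * (real k + 1/2)\<^sup>2))
       = sqrt (pi / a) * (1 + 2 * (\<Sum>n. (-1) ^ Suc n * exp (- (pi * real (Suc n))\<^sup>2 / a)))" (is ?id)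
proof -
  define B where "B = (\<lambda>k. (2 * a\<^sup>2 * (real k + 1)\<^sup>2 + a) * exp (- a * (real k)\<^sup>2) / 4)"
  define S where "S = (\<lambda>M t. \<Sum>m<M. alternating_dirichlet_kernel m t)"
  define g where "g = (\<lambda>M t. exp (- a * t\<^sup>2) * S M t)"
  define h where "h = (\<lambda>n. (-1) ^ Suc n * exp (- (pi * real (Suc n))\<^sup>2 / a))"
  define s where "s = (\<lambda>m. sqrt (pi / a) * (1 + 2 * (\<Sum>n<m. h n)))"
  have sq: "summable (\<lambda>k. norm (1 / (real k)\<^sup>2))"
    using inverse_power_summable[of 2, where ?'a = real] by (simp add: field_simps)
  have "B \<in> O(\<lambda>k. 1 / (real k)\<^sup>2)" unfolding B_def using a by real_asymp
  with sq have sumB: "summable B" by (rule summable_comparison_test_bigo)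
  have "(\<lambda>k. exp (- a * (real k + 1/2)\<^sup>2)) \<in> O(\<lambda>k. 1 / (real k)\<^sup>2)" using a by real_asymp
  with sq show sum1: ?sum1
    by (rule summable_comparison_test_bigo)
  have "(\<lambda>n. exp (- (pi * real (Suc n))\<^sup>2 / a)) \<in> O(\<lambda>k. 1 / (real k)\<^sup>2)" using a by real_asymp
  with sq have "summable (\<lambda>n. exp (- (pi * real (Suc n))\<^sup>2 / a))"
    by (rule summable_comparison_test_bigo)
  then have "summable (\<lambda>n. norm (h n))" by (simp add: h_def abs_mult)
  then have sum2: "summable h" by (rule summable_norm_cancel)
  then show ?sum2 by (simp add: h_def)
  have contg: "continuous_on A (g M)" for A M
    unfolding g_def S_def by (intro continuous_intros)
  have D: "has_bochner_integral lborel (\<lambda>t. exp (- a * t\<^sup>2) * alternating_dirichlet_kernel m t) (s m)" for m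
  proof -
    have "has_bochner_integral lborel
        (\<lambda>t. exp (- a * t\<^sup>2) * cos (0 * t) + (\<Sum>n=1..m. (2 * (-1) ^ n) * (exp (- a * t\<^sup>2) * cos (2 * pi * real n * t))))
        (sqrt (pi / a) * exp (- 0\<^sup>2 / (4 * a)) + (\<Sum>n=1..m. (2 * (-1) ^ n) * (sqrt (pi / a) * exp (- (2 * pi * real n)\<^sup>2 / (4 * a)))))"
      by (intro has_bochner_integral_add has_bochner_integral_sum has_bochner_integral_mult_right
           has_bochner_integral_gaussian_cos a)
    moreover have "(\<Sum>n=1..m. (2 * (-1) ^ n) * (sqrt (pi / a) * exp (- (2 * pi * real n)\<^sup>2 / (4 * a))))
       = sqrt (pi / a) * (2 * (\<Sum>n<m. h n))"
      unfolding h_def sum_distrib_left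
      by (rule sum.reindex_bij_witness[of _ Suc "\<lambda>n. n - 1"]) (auto simp: power_mult_distrib)
    moreover have "exp (- a * t\<^sup>2) * cos (0 * t) + (\<Sum>n=1..m. (2 * (-1) ^ n) * (exp (- a * t\<^sup>2) * cos (2 * pi * real n * t)))
       = exp (- a * t\<^sup>2) * alternating_dirichlet_kernel m t" for t
      by (simp add: alternating_dirichlet_kernel_def distrib_left sum_distrib_left mult_ac)
    ultimately show ?thesis by (simp add: s_def distrib_left)
  qed
  have "has_bochner_integral lborel (\<lambda>t. \<Sum>m<M. exp (- a * t\<^sup>2) * alternating_dirichlet_kernel m t) (\<Sum>m<M. s m)" for M
    by (intro has_bochner_integral_sum D)
  then have G: "has_bochner_integral lborel (g M) (\<Sum>m<M. s m)" for M
    by (simp add: g_def[abs_def] S_def sum_distrib_left)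
  have even: "integral {- real K..real K} (g M) = 2 * integral {0..real K} (g M)" for K M
  proof -
    have "g M (- t) = g M t" for t
      by (simp add: g_def S_def alternating_dirichlet_kernel_def)
    then have "integral {- real K..0} (g M) = integral {0..real K} (g M)"
      using Henstock_Kurzweil_Integration.integral_reflect_real[of "real K" 0 "g M"] by simp
    moreover have "integral {- real K..real K} (g M) = integral {- real K..0} (g M) + integral {0..real K} (g M)"
      by (intro Henstock_Kurzweil_Integration.integral_combine[symmetric] integrable_continuous_real contg) auto
    ultimately show ?thesis by simp
  qed
  define \<Theta> where "\<Theta> = (\<Sum>k. exp (- a * (real k + 1/2)\<^sup>2))"
  have bdd: "\<bar>\<Sum>m<M. s m - 2 * \<Theta>\<bar> \<le> 2 * (\<Sum>k. B k)" for M
  proof -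
    have "\<bar>integral {- real K..real K} (g M) - 2 * real M * (\<Sum>k<K. exp (- a * (real k + 1/2)\<^sup>2))\<bar> \<le> 2 * (\<Sum>k. B k)" for K
    proof -
      have "integral {0..real K} (g M) - real M * (\<Sum>k<K. exp (- a * (real k + 1/2)\<^sup>2))
         = (\<Sum>k<K. integral {real k..real k + 1} (g M) - real M * exp (- a * (real k + 1/2)\<^sup>2))"
        by (simp add: integral_unit_intervals[OF contg] sum_subtractf sum_distrib_left)
      also have "\<bar>\<dots>\<bar> \<le> (\<Sum>k<K. B k)"
        using gaussian_fejer_localisation[OF a, of _ M]
        by (intro order.trans[OF sum_abs] sum_mono) (simp add: g_def[abs_def] S_def B_def)
      also have "\<dots> \<le> (\<Sum>k. B k)"
        using a by (intro sum_le_suminf sumB) (auto simp: B_def)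
      finally show ?thesis unfolding even by linarith
    qed
    moreover have "(\<lambda>K. \<bar>integral {- real K..real K} (g M) - 2 * real M * (\<Sum>k<K. exp (- a * (real k + 1/2)\<^sup>2))\<bar>)
       \<longlonglongrightarrow> \<bar>(\<integral>x. g M x \<partial>lborel) - 2 * real M * \<Theta>\<bar>"
      unfolding \<Theta>_def
      using G by (intro tendsto_intros integral_symmetric_intervals_tendsto summable_LIMSEQ sum1)
         (auto simp: has_bochner_integral_iff)
    ultimately have "\<bar>(\<integral>x. g M x \<partial>lborel) - 2 * real M * \<Theta>\<bar> \<le> 2 * (\<Sum>k. B k)"
      by (intro LIMSEQ_le_const2) auto
    then show ?thesis
      using G[of M] by (simp add: has_bochner_integral_iff sum_subtractf)
  qed
  have "(\<lambda>m. s m - 2 * \<Theta>) \<longlonglongrightarrow> sqrt (pi / a) * (1 + 2 * suminf h) - 2 * \<Theta>"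
    unfolding s_def by (intro tendsto_intros summable_LIMSEQ sum2)
  from bounded_partial_sums_limit_zero[OF this bdd] show ?id
    by (simp add: \<Theta>_def h_def)
qed

section \<open>Partial fractions of the logistic function\<close>

text \<open>The derivative of the reflection formula, taken for the reciprocal Gamma function because it
  is entire and the formula then has \<open>sin (pi * z) / pi\<close> on its right-hand side.\<close>

lemma Digamma_reflection:
  fixes z :: complex
  assumes z: "z \<notin> \<int>"
  shows "(Digamma (1 - z) - Digamma z) * sin (of_real pi * z) = of_real pi * cos (of_real pi * z)"
proof -
  have z1: "z \<notin> \<int>\<^sub>\<le>\<^sub>0" "1 - z \<notin> \<int>\<^sub>\<le>\<^sub>0"
    using z nonpos_Ints_Int Ints_diff[of 1 "1 - z"] by auto
  have "((\<lambda>z. rGamma z * rGamma (1 - z)) has_field_derivative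
      rGamma z * rGamma (1 - z) * (Digamma (1 - z) - Digamma z)) (at z)"
    using z1 by (auto intro!: derivative_eq_intros simp: algebra_simps)
  moreover have "((\<lambda>z. rGamma z * rGamma (1 - z)) has_field_derivative cos (of_real pi * z)) (at z)"
    unfolding rGamma_reflection_complex by (auto intro!: derivative_eq_intros)
  ultimately have "rGamma z * rGamma (1 - z) * (Digamma (1 - z) - Digamma z) = cos (of_real pi * z)"
    by (rule DERIV_unique)
  then show ?thesis
    unfolding rGamma_reflection_complex by (simp add: field_simps)
qed

text \<open>Reflection at \<open>1/2 + y\<close>: the two Digamma series differ termwise by these fractions.\<close>

lemma tan_partial_fractions:
  fixes y :: complex
  assumes y: "Im y \<noteq> 0"
  shows "(\<lambda>k. 2 * y / ((of_nat k + 1/2)\<^sup>2 - y\<^sup>2)) sums (of_real pi * tan (of_real pi * y))"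
proof -
  define z where "z = 1/2 + y"
  have Im: "Im z \<noteq> 0" "Im (1 - z) \<noteq> 0" using y by (auto simp: z_def)
  then have zZ: "z \<notin> \<int>" and z0: "z \<noteq> 0" "1 - z \<noteq> 0" by (auto elim!: Ints_cases)
  have "(\<lambda>k. (inverse (of_nat (Suc k)) - inverse (z + of_nat k)) -
             (inverse (of_nat (Suc k)) - inverse (1 - z + of_nat k)))
      sums ((\<Sum>k. inverse (of_nat (Suc k)) - inverse (z + of_nat k)) -
            (\<Sum>k. inverse (of_nat (Suc k)) - inverse (1 - z + of_nat k)))"
    using z0 by (intro sums_diff summable_sums summable_Digamma)
  also have "((\<Sum>k. inverse (of_nat (Suc k)) - inverse (z + of_nat k)) -
            (\<Sum>k. inverse (of_nat (Suc k)) - inverse (1 - z + of_nat k)))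
        = Digamma z - Digamma (1 - z)"
    by (simp add: Digamma_def)
  also have "(\<lambda>k. (inverse (of_nat (Suc k)) - inverse (z + of_nat k)) -
             (inverse (of_nat (Suc k)) - inverse (1 - z + of_nat k)))
      = (\<lambda>k. 2 * y / ((of_nat k + 1/2)\<^sup>2 - y\<^sup>2))"
  proof
    fix k :: nat
    have ne: "of_nat k + 1/2 + y \<noteq> 0" "of_nat k + 1/2 - y \<noteq> 0"
      using y by (auto simp: complex_eq_iff)
    have "inverse (of_nat k + 1/2 - y) - inverse (of_nat k + 1/2 + y)
        = 2 * y / ((of_nat k + 1/2 - y) * (of_nat k + 1/2 + y))"
      using ne by (simp add: field_simps)
    also have "(of_nat k + 1/2 - y) * (of_nat k + 1/2 + y) = (of_nat k + 1/2)\<^sup>2 - y\<^sup>2"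
      by (simp add: algebra_simps power2_eq_square)
    finally have diff: "inverse (of_nat k + 1/2 - y) - inverse (of_nat k + 1/2 + y) = 2 * y / ((of_nat k + 1/2)\<^sup>2 - y\<^sup>2)" .
    have shifts: "z + of_nat k = of_nat k + 1/2 + y" "1 - z + of_nat k = of_nat k + 1/2 - y"
      by (simp_all add: z_def complex_eq_iff)
    show "(inverse (of_nat (Suc k)) - inverse (z + of_nat k)) -
             (inverse (of_nat (Suc k)) - inverse (1 - z + of_nat k))
         = 2 * y / ((of_nat k + 1/2)\<^sup>2 - y\<^sup>2)"
      unfolding shifts diff[symmetric] by simp
  qed
  finally have sums: "(\<lambda>k. 2 * y / ((of_nat k + 1/2)\<^sup>2 - y\<^sup>2)) sums (Digamma z - Digamma (1 - z))" .
  have "of_real pi * z = of_real pi * y + of_real pi / 2" by (simp add: z_def algebra_simps)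
  then have sc: "sin (of_real pi * z) = cos (of_real pi * y)" "cos (of_real pi * z) = - sin (of_real pi * y)"
    by (simp_all add: sin_add cos_add)
  have "cos (of_real pi * y) \<noteq> 0"
  proof
    assume "cos (of_real pi * y) = 0"
    then obtain n :: int where "of_real pi * y = of_real (real_of_int n * pi) + of_real pi / 2"
      by (auto simp: cos_eq_0)
    then have "Im (of_real pi * y) = 0" by simp
    then show False using y by simp
  qed
  with Digamma_reflection[OF zZ] sc
  have "Digamma z - Digamma (1 - z) = of_real pi * tan (of_real pi * y)"
    by (simp add: tan_def field_simps)
  with sums show ?thesis by simp
qed

text \<open>The exponential term of the quadrature formula is, up to the constant \<open>1/2\<close>, the midpoint
  sum of \<open>1 / (w\<^sup>2 + t\<^sup>2)\<close>, i.e. the quadrature sum without its Gaussian factors.\<close>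

lemma logistic_partial_fractions:
  fixes w :: complex and A :: real
  assumes A: "A > 0" and w: "Re w > 0"
  shows "(\<lambda>k. w / of_real A / (w\<^sup>2 + of_real (((real k + 1/2) * pi / A)\<^sup>2)))
     sums (1/2 - 1 / (exp (2 * of_real A * w) + 1))"
proof -
  define y where "y = \<i> * of_real A * w / of_real pi"
  have "Im y \<noteq> 0" using A w by (simp add: y_def)
  from sums_mult[OF tan_partial_fractions[OF this], of "1 / (2 * \<i> * of_real pi)"]
  have "(\<lambda>k. 1 / (2 * \<i> * of_real pi) * (2 * y / ((of_nat k + 1/2)\<^sup>2 - y\<^sup>2)))
    sums (1 / (2 * \<i> * of_real pi) * (of_real pi * tan (of_real pi * y)))" .
  also have "(\<lambda>k. 1 / (2 * \<i> * of_real pi) * (2 * y / ((of_nat k + 1/2)\<^sup>2 - y\<^sup>2)))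
    = (\<lambda>k. w / of_real A / (w\<^sup>2 + of_real (((real k + 1/2) * pi / A)\<^sup>2)))"
  proof
    fix k :: nat
    define D where "D = w\<^sup>2 + of_real (((real k + 1/2) * pi / A)\<^sup>2)"
    have A0: "complex_of_real A \<noteq> 0" using A by simp
    have "y\<^sup>2 = - ((of_real A)\<^sup>2 * w\<^sup>2 / (of_real pi)\<^sup>2)"
      by (simp add: y_def power_mult_distrib power_divide)
    moreover have "(of_real A)\<^sup>2 / (of_real pi)\<^sup>2 * of_real (((real k + 1/2) * pi / A)\<^sup>2)
        = (of_nat k + 1/2 :: complex)\<^sup>2"
      using A0 by (simp add: power_mult_distrib power_divide)
    ultimately have "(of_nat k + 1/2)\<^sup>2 - y\<^sup>2 = (of_real A)\<^sup>2 / (of_real pi)\<^sup>2 * D"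
      unfolding D_def by (simp add: distrib_left)
    moreover have "1 / (2 * i * P) * (2 * (i * a * w / P) / (a\<^sup>2 / P\<^sup>2 * D)) = w / a / D"
      if "i \<noteq> 0" "P \<noteq> 0" "a \<noteq> 0" for i P a :: complex
      using that by (cases "D = 0") (simp_all add: power2_eq_square divide_simps)
    from this[of \<i> "of_real pi" "of_real A"]
    have "1 / (2 * \<i> * of_real pi) * (2 * y / ((of_real A)\<^sup>2 / (of_real pi)\<^sup>2 * D)) = w / of_real A / D"
      using A0 by (simp add: y_def)
    ultimately show "1 / (2 * \<i> * of_real pi) * (2 * y / ((of_nat k + 1/2)\<^sup>2 - y\<^sup>2))
       = w / of_real A / (w\<^sup>2 + of_real (((real k + 1/2) * pi / A)\<^sup>2))"
      by (simp only: D_def)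
  qed
  also have "1 / (2 * \<i> * of_real pi) * (of_real pi * tan (of_real pi * y))
     = 1/2 - 1 / (exp (2 * of_real A * w) + 1)"
  proof -
    define E where "E = exp (of_real A * w)"
    have "norm (exp (2 * of_real A * w)) > 1" using A w by simp
    then have ne: "exp (2 * of_real A * w) + 1 \<noteq> 0"
      by (metis add.inverse_inverse add_eq_0_iff norm_minus_cancel norm_one order_less_irrefl)
    have E2: "exp (2 * of_real A * w) = E * E" unfolding E_def exp_add[symmetric] by (simp add: algebra_simps)
    have E0: "E \<noteq> 0" by (simp add: E_def)
    have y': "of_real pi * y = \<i> * (of_real A * w)" by (simp add: y_def)
    have "exp (\<i> * (of_real pi * y)) = inverse E" "exp (- (\<i> * (of_real pi * y))) = E"
      unfolding y' E_def by (simp_all add: exp_minus[symmetric] mult.assoc[symmetric])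
    then have "tan (of_real pi * y) = (inverse E - E) / (2 * \<i>) / ((inverse E + E) / 2)"
      unfolding tan_def sin_exp_eq cos_exp_eq by (simp only:)
    also have "\<dots> = \<i> * ((E * E - 1) / (E * E + 1))"
    proof -
      have "inverse E + E = (E * E + 1) / E" "inverse E - E = - (E * E - 1) / E"
        using E0 by (simp_all add: field_simps)
      then show ?thesis using E0 ne unfolding E2 by (simp add: divide_simps) (simp add: algebra_simps)
    qed
    finally have "tan (of_real pi * y) = \<i> * ((E * E - 1) / (E * E + 1))" .
    then have "1 / (2 * \<i> * of_real pi) * (of_real pi * tan (of_real pi * y)) = (E * E - 1) / (E * E + 1) / 2"
      by simp
    also have "\<dots> = 1/2 - 1 / (E * E + 1)"
    proof -
      have "(q - 1) / (q + 1) / 2 = 1/2 - 1 / (q + 1)" if "q + 1 \<noteq> 0" for q :: complex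
      proof -
        have "(q - 1) / (q + 1) = ((q + 1) - 2) / (q + 1)" by simp
        also have "\<dots> = 1 - 2 / (q + 1)" using that by (subst diff_divide_distrib) simp
        finally show ?thesis by simp
      qed
      then show ?thesis using ne unfolding E2 by blast
    qed
    finally show ?thesis by (simp only: E2)
  qed
  finally show ?thesis .
qed

section \<open>The Fresnel integral as a Gaussian tail\<close>

lemma integral_gaussian_half_line:
  "((\<lambda>S::real. integral {0..S} (\<lambda>s. exp (- s\<^sup>2))) \<longlongrightarrow> sqrt pi / 2) at_top"
proof -
  let ?f = "\<lambda>s::real. indicator {0..} s *\<^sub>R exp (- s\<^sup>2)"
  have int: "integrable lborel ?f" and val: "integral\<^sup>L lborel ?f = sqrt pi / 2"
    using gaussian_moment_0 by (auto simp: has_bochner_integral_iff)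
  have "((\<lambda>S. \<integral>s. indicator {..S} s *\<^sub>R ?f s \<partial>lborel) \<longlongrightarrow> sqrt pi / 2) at_top"
    by (rule tendsto_integral_at_top[OF _ int, unfolded val]) simp
  moreover have "(\<integral>s. indicator {..S} s *\<^sub>R ?f s \<partial>lborel) = integral {0..S} (\<lambda>s. exp (- s\<^sup>2))" for S
  proof -
    have "(\<integral>s. indicator {..S} s *\<^sub>R ?f s \<partial>lborel) = (LINT s:{0..S}|lborel. exp (- s\<^sup>2))"
      unfolding set_lebesgue_integral_def
      by (intro Bochner_Integration.integral_cong) (auto simp: indicator_def)
    also have "\<dots> = integral {0..S} (\<lambda>s. exp (- s\<^sup>2))"
      by (intro set_borel_integral_eq_integral borel_integrable_atLeastAtMost' continuous_intros)
    finally show ?thesis .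
  qed
  ultimately show ?thesis by simp
qed

text \<open>This is \<open>sqrt pi / 2\<close> times the complementary error function.  It vanishes along every
  horizontal ray: a change of the starting point alters the value far out on the ray by at most the length
  of the shift times the largest value of the integrand nearby, which decays.\<close>

lemma gaussian_tail_exists:
  obtains Q :: "complex \<Rightarrow> complex"
  where "\<And>z. (Q has_field_derivative - exp (- z\<^sup>2)) (at z)"
    and "\<And>z. ((\<lambda>S::real. Q (z + of_real S)) \<longlongrightarrow> 0) at_top"
    and "Q 0 = of_real (sqrt pi / 2)"
proof -
  have "(\<lambda>z::complex. exp (- z\<^sup>2)) holomorphic_on UNIV" by (intro holomorphic_intros)
  then obtain P :: "complex \<Rightarrow> complex"
    where P: "\<And>z. (P has_field_derivative exp (- z\<^sup>2)) (at z)"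
    using holomorphic_convex_primitive'[of UNIV "\<lambda>z. exp (- z\<^sup>2)"] by auto
  have real: "((\<lambda>S::real. P (of_real S)) \<longlongrightarrow> P 0 + of_real (sqrt pi / 2)) at_top"
  proof -
    have "P 0 + of_real (integral {0..S} (\<lambda>s. exp (- s\<^sup>2))) = P (of_real S)" if "S \<ge> 0" for S
    proof -
      have I1: "((\<lambda>s. complex_of_real (exp (- s\<^sup>2))) has_integral P (of_real S) - P (of_real 0)) {0..S}"
      proof (rule fundamental_theorem_of_calculus[OF that])
        show "((\<lambda>s. P (of_real s)) has_vector_derivative complex_of_real (exp (- s\<^sup>2))) (at s within {0..S})" for s
          using has_vector_derivative_real_field[OF P[of "of_real s"]]
          by (simp add: exp_of_real[symmetric] has_vector_derivative_at_within)
      qed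
      have I2: "((\<lambda>s. complex_of_real (exp (- s\<^sup>2))) has_integral
          of_real (integral {0..S} (\<lambda>s. exp (- s\<^sup>2)))) {0..S}"
        by (intro has_integral_of_real integrable_integral integrable_continuous_real continuous_intros)
      show ?thesis
        using has_integral_unique[OF I1 I2] by (simp add: algebra_simps)
    qed
    then have "\<forall>\<^sub>F S in at_top. P 0 + of_real (integral {0..S} (\<lambda>s. exp (- s\<^sup>2))) = P (of_real S)"
      by (intro eventually_at_top_linorderI[of 0])
    moreover have "((\<lambda>S. P 0 + of_real (integral {0..S} (\<lambda>s. exp (- s\<^sup>2)))) \<longlongrightarrow> P 0 + of_real (sqrt pi / 2)) at_top"
      by (intro tendsto_intros integral_gaussian_half_line)
    ultimately show ?thesis by (rule Lim_transform_eventually[rotated])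
  qed
  have shift: "((\<lambda>S::real. P (z + of_real S) - P (of_real S)) \<longlongrightarrow> 0) at_top" for z
  proof (rule Lim_null_comparison)
    define r where "r = norm z"
    show "((\<lambda>S. exp (r\<^sup>2 - (S - r)\<^sup>2) * r) \<longlongrightarrow> 0) at_top" by real_asymp
    show "\<forall>\<^sub>F S in at_top. norm (P (z + of_real S) - P (of_real S)) \<le> exp (r\<^sup>2 - (S - r)\<^sup>2) * r"
    proof (rule eventually_at_top_linorderI[of r])
      fix S assume S: "S \<ge> r"
      have "norm (P (z + of_real S) - P (of_real S)) \<le> exp (r\<^sup>2 - (S - r)\<^sup>2) * norm (z + of_real S - of_real S)"
      proof (rule field_differentiable_bound[of "cball (of_real S) r"])
        fix u assume u: "u \<in> cball (complex_of_real S) r"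
        then have "\<bar>S - Re u\<bar> \<le> r" "\<bar>Im u\<bar> \<le> r"
          using abs_Re_le_cmod[of "of_real S - u"] abs_Im_le_cmod[of "of_real S - u"]
          by (auto simp: dist_norm)
        then have "(S - r)\<^sup>2 \<le> (Re u)\<^sup>2" "(Im u)\<^sup>2 \<le> r\<^sup>2"
          using S by (auto intro!: power_mono simp: abs_le_square_iff[symmetric])
        then show "norm (exp (- u\<^sup>2)) \<le> exp (r\<^sup>2 - (S - r)\<^sup>2)" by (simp add: Re_power2)
      qed (auto simp: r_def dist_norm intro!: has_field_derivative_at_within P)
      then show "norm (P (z + of_real S) - P (of_real S)) \<le> exp (r\<^sup>2 - (S - r)\<^sup>2) * r"
        by (simp add: r_def)
    qed
  qed
  show thesis
  proof (rule that[of "\<lambda>z. P 0 + of_real (sqrt pi / 2) - P z"])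
    show "((\<lambda>z. P 0 + of_real (sqrt pi / 2) - P z) has_field_derivative - exp (- z\<^sup>2)) (at z)" for z
      using P by (auto intro!: derivative_eq_intros)
    fix z
    have "((\<lambda>S::real. P 0 + of_real (sqrt pi / 2) - (P (of_real S) + (P (z + of_real S) - P (of_real S))))
       \<longlongrightarrow> P 0 + of_real (sqrt pi / 2) - (P 0 + of_real (sqrt pi / 2) + 0)) at_top"
      by (intro tendsto_intros real shift)
    then show "((\<lambda>S::real. P 0 + of_real (sqrt pi / 2) - P (z + of_real S)) \<longlongrightarrow> 0) at_top" by simp
  qed simp
qed

definition gaussian_tail :: "complex \<Rightarrow> complex" where
  "gaussian_tail = (SOME Q. (\<forall>z. (Q has_field_derivative - exp (- z\<^sup>2)) (at z)) \<and>
     (\<forall>z. ((\<lambda>S::real. Q (z + of_real S)) \<longlongrightarrow> 0) at_top) \<and> Q 0 = of_real (sqrt pi / 2))"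

lemma
  shows has_field_derivative_gaussian_tail:
      "(gaussian_tail has_field_derivative - exp (- z\<^sup>2)) (at z)"
    and gaussian_tail_tendsto_0: "((\<lambda>S::real. gaussian_tail (z + of_real S)) \<longlongrightarrow> 0) at_top"
    and gaussian_tail_0: "gaussian_tail 0 = of_real (sqrt pi / 2)"
proof -
  have "\<exists>Q::complex \<Rightarrow> complex. (\<forall>z. (Q has_field_derivative - exp (- z\<^sup>2)) (at z)) \<and>
     (\<forall>z. ((\<lambda>S::real. Q (z + of_real S)) \<longlongrightarrow> 0) at_top) \<and> Q 0 = of_real (sqrt pi / 2)"
    by (rule gaussian_tail_exists) blast
  from someI_ex[OF this, folded gaussian_tail_def]
  show "(gaussian_tail has_field_derivative - exp (- z\<^sup>2)) (at z)"
    "((\<lambda>S::real. gaussian_tail (z + of_real S)) \<longlongrightarrow> 0) at_top"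
    "gaussian_tail 0 = of_real (sqrt pi / 2)" by auto
qed

lemma gaussian_tail_minus: "gaussian_tail (- z) = of_real (sqrt pi) - gaussian_tail z"
proof -
  have "((\<lambda>z. gaussian_tail (- z) + gaussian_tail z) has_field_derivative 0) (at z within UNIV)" for z
    by (auto intro!: derivative_eq_intros DERIV_chain'[OF _ has_field_derivative_gaussian_tail] has_field_derivative_gaussian_tail)
  then obtain c where "\<And>z. gaussian_tail (- z) + gaussian_tail z = c"
    using has_field_derivative_zero_constant[of UNIV "\<lambda>z. gaussian_tail (- z) + gaussian_tail z"] by auto
  from this[of z] this[of 0] show ?thesis
    by (simp add: gaussian_tail_0 algebra_simps flip: of_real_add)
qed

definition ray :: complex where "ray = exp (- (\<i> * of_real pi / 4))"

lemma ray_eq: "ray = Complex (1 / sqrt 2) (- 1 / sqrt 2)"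
proof -
  have "ray = cis (- (pi / 4))" by (simp add: ray_def cis_conv_exp)
  moreover have "sqrt 2 / 2 = 1 / sqrt 2" by (simp add: field_simps)
  ultimately show ?thesis by (simp add: cis.ctr cos_45 sin_45)
qed

lemma ray_squared: "ray\<^sup>2 = - \<i>"
  by (simp add: ray_eq complex_eq_iff power2_eq_square)

lemma norm_ray [simp]: "norm ray = 1" by (simp add: ray_def)

lemma ray_nonzero [simp]: "ray \<noteq> 0" by (simp add: ray_def)

lemma Re_ray: "Re ray = 1 / sqrt 2" by (simp add: ray_eq)

text \<open>On the horizontal ray starting at \<open>ray * x\<close> the oscillation disappears from the modulus,
  and linear exponential decay with rate \<open>sqrt 2 * x\<close> is gained.\<close>

lemma norm_exp_ray_shift:
  "norm (exp (- (ray * of_real x + of_real s)\<^sup>2)) = exp (- s\<^sup>2 - sqrt 2 * x * s)"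
proof -
  have "(ray * of_real x + of_real s)\<^sup>2 = - \<i> * of_real (x\<^sup>2) + of_real (s\<^sup>2) + 2 * ray * of_real (x * s)"
    by (simp add: power2_sum power_mult_distrib ray_squared)
  then have "Re ((ray * of_real x + of_real s)\<^sup>2) = s\<^sup>2 + 2 * Re ray * (x * s)"
    by (simp del: of_real_power of_real_mult)
  also have "2 * Re ray = sqrt 2" by (simp add: Re_ray real_div_sqrt)
  finally show ?thesis by (simp add: algebra_simps)
qed

lemma gaussian_tail_increment:
  assumes S: "S \<ge> 0"
  shows "((\<lambda>s. exp (- (z + of_real s)\<^sup>2)) has_integral gaussian_tail z - gaussian_tail (z + of_real S)) {0..S}"
proof -
  have "((\<lambda>s. exp (- (z + of_real s)\<^sup>2)) has_integral
      - gaussian_tail (z + of_real S) - - gaussian_tail (z + of_real 0)) {0..S}"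
  proof (rule fundamental_theorem_of_calculus[OF S])
    fix s :: real
    have "((\<lambda>u. - gaussian_tail (z + u)) has_field_derivative exp (- (z + of_real s)\<^sup>2)) (at (of_real s))"
      by (auto intro!: derivative_eq_intros DERIV_chain'[OF _ has_field_derivative_gaussian_tail])
    from has_vector_derivative_real_field[OF this]
    show "((\<lambda>s. - gaussian_tail (z + of_real s)) has_vector_derivative exp (- (z + of_real s)\<^sup>2)) (at s within {0..S})"
      by (rule has_vector_derivative_at_within)
  qed
  then show ?thesis by simp
qed

lemma norm_gaussian_tail_ray_increment_le:
  assumes "S \<ge> 0"
  shows "norm (gaussian_tail (ray * of_real x) - gaussian_tail (ray * of_real x + of_real S))
     \<le> integral {0..S} (\<lambda>s. exp (- s\<^sup>2 - sqrt 2 * x * s))"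
proof -
  note int = gaussian_tail_increment[OF assms, of "ray * of_real x"]
  show ?thesis
    unfolding integral_unique[OF int, symmetric]
    by (intro integral_norm_bound_integral has_integral_integrable[OF int] integrable_continuous_real
         continuous_intros) (rule eq_refl, rule norm_exp_ray_shift)
qed

lemma norm_gaussian_tail_ray_le:
  assumes B: "\<And>S. S \<ge> 0 \<Longrightarrow> integral {0..S} (\<lambda>s. exp (- s\<^sup>2 - sqrt 2 * x * s)) \<le> B"
  shows "norm (gaussian_tail (ray * of_real x)) \<le> B"
proof -
  have "((\<lambda>S. norm (gaussian_tail (ray * of_real x) - gaussian_tail (ray * of_real x + of_real S)))
     \<longlongrightarrow> norm (gaussian_tail (ray * of_real x) - 0)) at_top"
    by (intro tendsto_intros gaussian_tail_tendsto_0)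
  moreover have "\<forall>\<^sub>F S in at_top. norm (gaussian_tail (ray * of_real x) - gaussian_tail (ray * of_real x + of_real S)) \<le> B"
    using norm_gaussian_tail_ray_increment_le B
    by (intro eventually_at_top_linorderI[of 0]) (meson order.trans)
  ultimately have "norm (gaussian_tail (ray * of_real x) - 0) \<le> B"
    by (rule tendsto_upperbound) simp
  then show ?thesis by simp
qed

lemma integral_shifted_gaussian_le:
  assumes x: "x \<ge> 0" and S: "S \<ge> 0"
  shows "integral {0..S} (\<lambda>s. exp (- s\<^sup>2 - sqrt 2 * x * s)) \<le> sqrt pi / 2"
proof -
  have mono: "integral {0..S} (\<lambda>s. exp (- s\<^sup>2)) \<le> integral {0..S'} (\<lambda>s::real. exp (- s\<^sup>2))" if "S \<le> S'" for S'
    using that by (intro integral_subset_le integrable_continuous_real continuous_intros) auto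
  have "integral {0..S} (\<lambda>s. exp (- s\<^sup>2 - sqrt 2 * x * s)) \<le> integral {0..S} (\<lambda>s. exp (- s\<^sup>2))"
    using x by (intro integral_le integrable_continuous_real continuous_intros) auto
  also have "\<dots> \<le> sqrt pi / 2"
    using mono by (intro tendsto_lowerbound[OF integral_gaussian_half_line] eventually_at_top_linorderI[of S]) auto
  finally show ?thesis .
qed

lemma integral_shifted_gaussian_le':
  assumes x: "x > 0" and S: "S \<ge> 0"
  shows "integral {0..S} (\<lambda>s. exp (- s\<^sup>2 - sqrt 2 * x * s)) \<le> 1 / (sqrt 2 * x)"
proof -
  have "((\<lambda>s. exp (- sqrt 2 * x * s)) has_integral
     - exp (- sqrt 2 * x * S) / (sqrt 2 * x) - - exp (- sqrt 2 * x * 0) / (sqrt 2 * x)) {0..S}"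
    using x S by (intro fundamental_theorem_of_calculus)
       (auto intro!: derivative_eq_intros simp flip: has_real_derivative_iff_has_vector_derivative)
  then have "integral {0..S} (\<lambda>s. exp (- sqrt 2 * x * s)) \<le> 1 / (sqrt 2 * x)"
    using x by (simp add: integral_unique divide_simps)
  moreover have "integral {0..S} (\<lambda>s. exp (- s\<^sup>2 - sqrt 2 * x * s)) \<le> integral {0..S} (\<lambda>s. exp (- sqrt 2 * x * s))"
    by (intro integral_le integrable_continuous_real continuous_intros) auto
  ultimately show ?thesis by linarith
qed

lemma has_integral_fresnel_integrand:
  assumes "x \<le> R"
  shows "((\<lambda>t. exp (\<i> * of_real (t\<^sup>2))) has_integral
     (gaussian_tail (ray * of_real x) - gaussian_tail (ray * of_real R)) / ray) {x..R}"
proof -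
  have "((\<lambda>t. exp (\<i> * of_real (t\<^sup>2))) has_integral
      - gaussian_tail (ray * of_real R) / ray - - gaussian_tail (ray * of_real x) / ray) {x..R}"
  proof (rule fundamental_theorem_of_calculus[OF assms])
    fix t :: real
    have "((\<lambda>u. - gaussian_tail (ray * u) / ray) has_field_derivative exp (- (ray * of_real t)\<^sup>2)) (at (of_real t))"
      by (auto intro!: derivative_eq_intros DERIV_chain'[OF _ has_field_derivative_gaussian_tail])
    from has_vector_derivative_real_field[OF this]
    show "((\<lambda>t. - gaussian_tail (ray * of_real t) / ray) has_vector_derivative exp (\<i> * of_real (t\<^sup>2))) (at t within {x..R})"
      by (simp add: power_mult_distrib ray_squared has_vector_derivative_at_within)
  qed
  then show ?thesis by (simp add: diff_divide_distrib)
qed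

text \<open>Since \<open>ray\<^sup>2 = - \<i>\<close>, the Fresnel integrand is \<open>exp (- z\<^sup>2)\<close> along the ray.  The improper
  integral converges because the tail at \<open>ray * R\<close>, computed on a horizontal ray instead, is at
  most \<open>1 / (sqrt 2 * R)\<close>.\<close>

lemma fresnel_eq_gaussian_tail: "fresnel x = gaussian_tail (ray * of_real x) / of_real (sqrt pi)"
proof -
  have "((\<lambda>R. gaussian_tail (ray * of_real R)) \<longlongrightarrow> 0) at_top"
  proof (rule Lim_null_comparison)
    show "((\<lambda>R. 1 / (sqrt 2 * R)) \<longlongrightarrow> 0) at_top" by real_asymp
    show "\<forall>\<^sub>F R in at_top. norm (gaussian_tail (ray * of_real R)) \<le> 1 / (sqrt 2 * R)"
      using integral_shifted_gaussian_le' norm_gaussian_tail_ray_le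
      by (intro eventually_at_top_linorderI[of 1]) simp
  qed
  then have "((\<lambda>R. (gaussian_tail (ray * of_real x) - gaussian_tail (ray * of_real R)) / ray)
     \<longlongrightarrow> (gaussian_tail (ray * of_real x) - 0) / ray) at_top"
    by (intro tendsto_intros) auto
  moreover have "\<forall>\<^sub>F R in at_top. (gaussian_tail (ray * of_real x) - gaussian_tail (ray * of_real R)) / ray
      = integral {x..R} (\<lambda>t. exp (\<i> * of_real (t\<^sup>2)))"
    by (intro eventually_at_top_linorderI[of x] integral_unique[symmetric] has_integral_fresnel_integrand)
  ultimately have "((\<lambda>R. integral {x..R} (\<lambda>t. exp (\<i> * of_real (t\<^sup>2)))) \<longlongrightarrow> gaussian_tail (ray * of_real x) / ray) at_top"
    by (simp add: Lim_transform_eventually)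
  then have "Lim at_top (\<lambda>R. integral {x..R} (\<lambda>t. exp (\<i> * of_real (t\<^sup>2)))) = gaussian_tail (ray * of_real x) / ray"
    by (intro tendsto_Lim) auto
  then show ?thesis unfolding fresnel_def ray_def[symmetric] by simp
qed

lemma fresnel_minus: "fresnel (- x) = 1 - fresnel x"
proof -
  have "ray * of_real (- x) = - (ray * of_real x)" by simp
  then have "fresnel (- x) = (of_real (sqrt pi) - gaussian_tail (ray * of_real x)) / of_real (sqrt pi)"
    by (simp only: fresnel_eq_gaussian_tail gaussian_tail_minus)
  also have "\<dots> = 1 - fresnel x"
    by (simp only: fresnel_eq_gaussian_tail diff_divide_distrib) simp
  finally show ?thesis .
qed

lemma fresnel_0: "fresnel 0 = 1 / 2"
proof -
  have "fresnel 0 = of_real (sqrt pi / 2) / of_real (sqrt pi)"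
    by (simp only: fresnel_eq_gaussian_tail of_real_0 mult_zero_right gaussian_tail_0)
  also have "\<dots> = of_real (sqrt pi / 2 / sqrt pi)" by (simp only: of_real_divide)
  also have "sqrt pi / 2 / sqrt pi = 1 / 2" by (simp add: field_simps)
  finally show ?thesis by simp
qed

lemma norm_fresnel_le_half:
  assumes "x \<ge> 0"
  shows "norm (fresnel x) \<le> 1 / 2"
proof -
  have "norm (gaussian_tail (ray * of_real x)) / sqrt pi \<le> sqrt pi / 2 / sqrt pi"
    by (intro divide_right_mono norm_gaussian_tail_ray_le integral_shifted_gaussian_le assms) auto
  then show ?thesis by (simp add: fresnel_eq_gaussian_tail norm_divide)
qed

text \<open>By symmetry this is the upper bound \<open>1/2\<close> on the positive half-line, where the integrand on
  the horizontal ray is dominated by a Gaussian.\<close>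

lemma norm_fresnel_ge_half:
  assumes "x \<le> 0"
  shows "norm (fresnel x) \<ge> 1 / 2"
proof -
  have "norm (1 - fresnel x) \<le> 1 / 2"
    using norm_fresnel_le_half[of "- x"] assms unfolding fresnel_minus by simp
  then show ?thesis
    using norm_triangle_ineq2[of 1 "1 - fresnel x"] by simp
qed

text \<open>Birnbaum's lower bound for Mills' ratio, over a finite interval.  Writing
  \<open>r = sqrt (y\<^sup>2 + 8)\<close>, the weights \<open>(2 * s + y)\<close> and \<open>(1 - y * s - 2 * s\<^sup>2)\<close> have explicit integrals
  against the density; the multiplier \<open>2 / r\<close> of the second one is chosen so that the
  difference of the two sides becomes a perfect square.\<close>

lemma integral_shifted_gaussian_ge:
  fixes y S :: real
  assumes S: "S \<ge> 0"
  shows "integral {0..S} (\<lambda>s. exp (- s\<^sup>2 - y * s)) \<ge> 2 * (1 - exp (- S\<^sup>2 - y * S)) / (y + sqrt (y\<^sup>2 + 8))"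
proof -
  define r where "r = sqrt (y\<^sup>2 + 8)"
  have pos: "y\<^sup>2 + 8 > 0" by (simp add: add_nonneg_pos)
  then have r1: "r > 0" "r\<^sup>2 = y\<^sup>2 + 8" by (simp_all add: r_def)
  have "\<bar>y\<bar> < r" using real_sqrt_less_mono[of "y\<^sup>2" "y\<^sup>2 + 8"] by (simp add: r_def)
  with r1 have r: "r > 0" "r\<^sup>2 = y\<^sup>2 + 8" "r + y > 0" by linarith+
  define e where "e = (\<lambda>s::real. exp (- s\<^sup>2 - y * s))"
  have cont: "continuous_on X e" for X unfolding e_def by (intro continuous_intros)
  have I1: "((\<lambda>s. (2 * s + y) * e s) has_integral - e S - - e 0) {0..S}"
    unfolding e_def using S by (intro fundamental_theorem_of_calculus)
       (auto intro!: derivative_eq_intros simp: algebra_simps simp flip: has_real_derivative_iff_has_vector_derivative)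
  have I2: "((\<lambda>s. (1 - y * s - 2 * s\<^sup>2) * e s) has_integral S * e S - 0 * e 0) {0..S}"
    unfolding e_def using S by (intro fundamental_theorem_of_calculus)
       (auto intro!: derivative_eq_intros simp: algebra_simps power2_eq_square simp flip: has_real_derivative_iff_has_vector_derivative)
  have I3: "(e has_integral integral {0..S} e) {0..S}"
    by (intro integrable_integral integrable_continuous_real cont)
  have J1: "((\<lambda>s. (r + y) / 2 * e s - (2 * s + y) * e s) has_integral (r + y) / 2 * integral {0..S} e - (- e S - - e 0)) {0..S}"
    by (intro has_integral_diff has_integral_mult_right I1 I3)
  have J2: "((\<lambda>s. 2 / r * ((1 - y * s - 2 * s\<^sup>2) * e s)) has_integral 2 / r * (S * e S - 0 * e 0)) {0..S}"
    by (intro has_integral_mult_right I2)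
  have J3: "2 / r * ((1 - y * s - 2 * s\<^sup>2) * e s) \<le> (r + y) / 2 * e s - (2 * s + y) * e s" for s
  proof -
    have "4 * r * ((r + y) / 2 - (2 * s + y) - 2 / r * (1 - y * s - 2 * s\<^sup>2))
        = 2 * r\<^sup>2 + 2 * r * y - 4 * r * (2 * s + y) - 8 * (1 - y * s - 2 * s\<^sup>2)"
      using r(1) by (simp add: field_simps power2_eq_square)
    also have "\<dots> = (4 * s - (r - y))\<^sup>2"
      using r(2) by (simp add: power2_eq_square algebra_simps)
    finally have "4 * r * ((r + y) / 2 - (2 * s + y) - 2 / r * (1 - y * s - 2 * s\<^sup>2)) \<ge> 0" by simp
    then have "2 / r * (1 - y * s - 2 * s\<^sup>2) \<le> (r + y) / 2 - (2 * s + y)"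
      using r(1) by (simp add: zero_le_mult_iff)
    from mult_right_mono[OF this, of "e s"] show ?thesis by (simp add: e_def algebra_simps)
  qed
  have "2 / r * (S * e S - 0 * e 0) \<le> (r + y) / 2 * integral {0..S} e - (- e S - - e 0)"
    by (rule has_integral_le[OF J2 J1 J3])
  moreover have "0 \<le> 2 / r * (S * e S - 0 * e 0)" using r S by (simp add: e_def)
  ultimately have "1 - e S \<le> (r + y) / 2 * integral {0..S} e" by (simp add: e_def)
  then show ?thesis using r by (simp add: e_def r_def field_simps)
qed

text \<open>Multiplied by \<open>2 * ray * x\<close>, the tail is an explicit boundary term of modulus one minus
  the integral of \<open>2 * s\<close> against the integrand.  Estimating the latter by its modulus, a real
  integration by parts turns the difference back into \<open>y\<close> times a Mills ratio, with
  \<open>y = sqrt 2 * x\<close>.\<close>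

lemma norm_gaussian_tail_ray_ge:
  assumes x: "x > 0"
  shows "norm (gaussian_tail (ray * of_real x)) \<ge> 1 / (x + sqrt (x\<^sup>2 + 4))"
proof -
  define y where "y = sqrt 2 * x"
  define e where "e = (\<lambda>s::real. exp (- s\<^sup>2 - y * s))"
  define z where "z = ray * of_real x"
  have y: "y > 0" using x by (simp add: y_def)
  have bound: "2 * x * norm (gaussian_tail z - gaussian_tail (z + of_real S)) \<ge> y * (2 * (1 - e S) / (y + sqrt (y\<^sup>2 + 8)))"
    if S: "S \<ge> 0" for S
  proof -
    define E where "E = (\<lambda>s::real. exp (- (z + of_real s)\<^sup>2))"
    have normE: "norm (E s) = e s" for s
      unfolding E_def e_def z_def y_def by (rule norm_exp_ray_shift)
    have contE: "continuous_on X E" for X unfolding E_def by (intro continuous_intros)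
    have conte: "continuous_on X e" for X unfolding e_def by (intro continuous_intros)
    have I1: "((\<lambda>s. 2 * (z + of_real s) * E s) has_integral - E S - - E 0) {0..S}"
    proof (rule fundamental_theorem_of_calculus[OF S])
      fix s :: real
      have "((\<lambda>u. - exp (- (z + u)\<^sup>2)) has_field_derivative 2 * (z + of_real s) * exp (- (z + of_real s)\<^sup>2)) (at (of_real s))"
        by (auto intro!: derivative_eq_intros simp: algebra_simps)
      from has_vector_derivative_real_field[OF this]
      show "((\<lambda>s. - E s) has_vector_derivative 2 * (z + of_real s) * E s) (at s within {0..S})"
        unfolding E_def by (rule has_vector_derivative_at_within)
    qed
    have I2: "(E has_integral gaussian_tail z - gaussian_tail (z + of_real S)) {0..S}"
      unfolding E_def by (rule gaussian_tail_increment[OF S])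
    have i3: "(\<lambda>s. of_real (2 * s) * E s) integrable_on {0..S}"
      by (intro integrable_continuous_real continuous_intros contE)
    have "((\<lambda>s. 2 * (z + of_real s) * E s - of_real (2 * s) * E s) has_integral
        (- E S - - E 0) - integral {0..S} (\<lambda>s. of_real (2 * s) * E s)) {0..S}"
      by (intro has_integral_diff I1 integrable_integral i3)
    also have "(\<lambda>s. 2 * (z + of_real s) * E s - of_real (2 * s) * E s) = (\<lambda>s. 2 * z * E s)"
      by (auto simp: algebra_simps)
    finally have "2 * z * (gaussian_tail z - gaussian_tail (z + of_real S))
        = E 0 - E S - integral {0..S} (\<lambda>s. of_real (2 * s) * E s)"
      using has_integral_unique[OF has_integral_mult_right[OF I2, of "2 * z"]] by auto
    from arg_cong[OF this, of norm]
    have "2 * x * norm (gaussian_tail z - gaussian_tail (z + of_real S))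
        = norm (E 0 - E S - integral {0..S} (\<lambda>s. of_real (2 * s) * E s))"
      using x by (simp add: norm_mult z_def)
    also have "\<dots> \<ge> norm (E 0) - norm (E S) - norm (integral {0..S} (\<lambda>s. of_real (2 * s) * E s))"
      by norm
    finally have 1: "2 * x * norm (gaussian_tail z - gaussian_tail (z + of_real S))
        \<ge> 1 - e S - norm (integral {0..S} (\<lambda>s. of_real (2 * s) * E s))"
      by (simp add: normE e_def)
    have 2: "norm (integral {0..S} (\<lambda>s. of_real (2 * s) * E s)) \<le> integral {0..S} (\<lambda>s. 2 * s * e s)"
      by (intro integral_norm_bound_integral i3 integrable_continuous_real continuous_intros conte)
         (simp add: norm_mult normE)
    have "((\<lambda>s. (2 * s + y) * e s) has_integral - e S - - e 0) {0..S}"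
      unfolding e_def using S by (intro fundamental_theorem_of_calculus)
         (auto intro!: derivative_eq_intros simp: algebra_simps simp flip: has_real_derivative_iff_has_vector_derivative)
    moreover have "((\<lambda>s. 2 * s * e s + y * e s) has_integral
        integral {0..S} (\<lambda>s. 2 * s * e s) + y * integral {0..S} e) {0..S}"
      by (intro has_integral_add has_integral_mult_right integrable_integral
           integrable_continuous_real continuous_intros conte)
    ultimately have 3: "integral {0..S} (\<lambda>s. 2 * s * e s) + y * integral {0..S} e = 1 - e S"
      by (simp add: distrib_right has_integral_unique e_def)
    have "y * (2 * (1 - e S) / (y + sqrt (y\<^sup>2 + 8))) \<le> y * integral {0..S} e"
      unfolding e_def using y by (intro mult_left_mono integral_shifted_gaussian_ge S) auto
    with 1 2 3 show ?thesis by linarith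
  qed
  have "((\<lambda>S. 2 * x * norm (gaussian_tail z - gaussian_tail (z + of_real S))) \<longlongrightarrow> 2 * x * norm (gaussian_tail z - 0)) at_top"
    by (intro tendsto_intros gaussian_tail_tendsto_0)
  moreover have "(e \<longlongrightarrow> 0) at_top" unfolding e_def using y by real_asymp
  then have "((\<lambda>S. y * (2 * (1 - e S) / (y + sqrt (y\<^sup>2 + 8)))) \<longlongrightarrow> y * (2 * (1 - 0) / (y + sqrt (y\<^sup>2 + 8)))) at_top"
    using y by (intro tendsto_intros) (auto simp: add_pos_nonneg add_nonneg_eq_0_iff)
  ultimately have "y * (2 * (1 - 0) / (y + sqrt (y\<^sup>2 + 8))) \<le> 2 * x * norm (gaussian_tail z - 0)"
    using bound by (intro tendsto_le[of at_top _ _ _ _]) (auto intro: eventually_at_top_linorderI[of 0])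
  moreover have "y + sqrt (y\<^sup>2 + 8) = sqrt 2 * (x + sqrt (x\<^sup>2 + 4))"
    by (simp add: y_def power_mult_distrib distrib_left flip: real_sqrt_mult)
  then have "y * (2 * (1 - 0) / (y + sqrt (y\<^sup>2 + 8))) = 2 * x * (1 / (x + sqrt (x\<^sup>2 + 4)))"
    by (simp add: y_def)
  ultimately have "2 * x * (1 / (x + sqrt (x\<^sup>2 + 4))) \<le> 2 * x * norm (gaussian_tail (ray * of_real x))"
    by (simp only: z_def diff_zero)
  then show ?thesis using x by (simp only: mult_le_cancel_left_pos)
qed

lemma norm_fresnel_ge:
  assumes "x \<ge> 0"
  shows "norm (fresnel x) \<ge> 1 / (sqrt pi * (x + sqrt (x\<^sup>2 + 4)))"
proof (cases "x = 0")
  case True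
  have "1 \<le> sqrt pi" using pi_ge_two by simp
  then show ?thesis using True by (simp add: fresnel_0 divide_simps)
next
  case False
  then have "1 / (x + sqrt (x\<^sup>2 + 4)) / sqrt pi \<le> norm (gaussian_tail (ray * of_real x)) / sqrt pi"
    using assms by (intro divide_right_mono norm_gaussian_tail_ray_ge) auto
  then show ?thesis by (simp add: fresnel_eq_gaussian_tail norm_divide mult.commute)
qed

section \<open>Oscillatory integrals with a flat factor\<close>

text \<open>The value at zero is the limit there; the quotient alone would give \<open>exp 0 = 1\<close>.\<close>

definition inverse_gaussian :: "real \<Rightarrow> real \<Rightarrow> real" where
  "inverse_gaussian a v = (if v = 0 then 0 else exp (- (a / v)\<^sup>2))"

lemma isCont_inverse_gaussian_quotient:
  assumes a: "a > 0"
  shows "isCont (inverse_gaussian a) v" and "isCont (\<lambda>v. inverse_gaussian a v / v) v"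
proof -
  have "isCont (inverse_gaussian a) v \<and> isCont (\<lambda>v. inverse_gaussian a v / v) v"
  proof (cases "v = 0")
    case True
    have "((\<lambda>v. exp (- (a / v)\<^sup>2)) \<longlongrightarrow> 0) (at_left 0)" "((\<lambda>v. exp (- (a / v)\<^sup>2)) \<longlongrightarrow> 0) (at_right 0)"
      "((\<lambda>v. exp (- (a / v)\<^sup>2) / v) \<longlongrightarrow> 0) (at_left 0)" "((\<lambda>v. exp (- (a / v)\<^sup>2) / v) \<longlongrightarrow> 0) (at_right 0)"
      using a by real_asymp+
    then have "((\<lambda>v. exp (- (a / v)\<^sup>2)) \<longlongrightarrow> 0) (at 0)" "((\<lambda>v. exp (- (a / v)\<^sup>2) / v) \<longlongrightarrow> 0) (at 0)"
      by (auto intro: filterlim_split_at)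
    moreover have "\<forall>\<^sub>F v in at 0. exp (- (a / v)\<^sup>2) = inverse_gaussian a v"
      "\<forall>\<^sub>F v in at 0. exp (- (a / v)\<^sup>2) / v = inverse_gaussian a v / v"
      by (auto simp: inverse_gaussian_def eventually_at intro!: exI[of _ 1])
    ultimately have "((inverse_gaussian a) \<longlongrightarrow> 0) (at 0)" "((\<lambda>v. inverse_gaussian a v / v) \<longlongrightarrow> 0) (at 0)"
      by (auto intro: Lim_transform_eventually)
    then show ?thesis using True by (simp add: isCont_def inverse_gaussian_def)
  next
    case False
    have "isCont (\<lambda>v. exp (- (a / v)\<^sup>2)) v" "isCont (\<lambda>v. exp (- (a / v)\<^sup>2) / v) v"
      using False by (auto intro!: continuous_intros)
    moreover have ev: "\<forall>\<^sub>F u in nhds v. u \<noteq> 0"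
      using False by (intro t1_space_nhds)
    have "\<forall>\<^sub>F u in nhds v. exp (- (a / u)\<^sup>2) = inverse_gaussian a u"
      "\<forall>\<^sub>F u in nhds v. exp (- (a / u)\<^sup>2) / u = inverse_gaussian a u / u"
      by (use ev in \<open>eventually_elim, simp add: inverse_gaussian_def\<close>)+
    ultimately show ?thesis by (simp add: isCont_cong)
  qed
  then show "isCont (inverse_gaussian a) v" "isCont (\<lambda>v. inverse_gaussian a v / v) v" by auto
qed

lemma continuous_on_inverse_gaussian:
  assumes "a > 0"
  shows "continuous_on S (inverse_gaussian a)" "continuous_on S (\<lambda>v. inverse_gaussian a v / v)"
  using isCont_inverse_gaussian_quotient[OF assms] by (auto intro: continuous_at_imp_continuous_on)

lemma has_real_derivative_inverse_gaussian:
  assumes "v > 0"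
  shows "(inverse_gaussian a has_real_derivative (2 * a\<^sup>2 / v ^ 3) * inverse_gaussian a v) (at v)"
proof -
  have "((\<lambda>v. exp (- (a / v)\<^sup>2)) has_real_derivative (2 * a\<^sup>2 / v ^ 3) * exp (- (a / v)\<^sup>2)) (at v)"
    using assms by (auto intro!: derivative_eq_intros simp: power2_eq_square power3_eq_cube divide_simps)
  moreover have "\<forall>\<^sub>F u in nhds v. u \<noteq> 0"
    using assms by (intro t1_space_nhds) auto
  then have "\<forall>\<^sub>F u in nhds v. inverse_gaussian a u = exp (- (a / u)\<^sup>2)"
    by eventually_elim (simp add: inverse_gaussian_def)
  ultimately show ?thesis
    using assms by (subst DERIV_cong_ev[OF refl]) (auto simp: inverse_gaussian_def)
qed

lemma inverse_gaussian_nonneg: "inverse_gaussian a v \<ge> 0"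
  by (simp add: inverse_gaussian_def)

lemma inverse_gaussian_le:
  assumes "0 \<le> v" "v \<le> 1"
  shows "inverse_gaussian a v \<le> exp (- a\<^sup>2)"
proof (cases "v = 0")
  case False
  then have "v\<^sup>2 \<le> 1" "v\<^sup>2 > 0" using assms by (auto simp: power_le_one)
  then have "a\<^sup>2 \<le> (a / v)\<^sup>2"
    by (simp add: power_divide le_divide_eq mult_left_le)
  then show ?thesis using False by (simp add: inverse_gaussian_def)
qed (simp add: inverse_gaussian_def)

text \<open>The derivative of \<open>v\<^sup>3 * inverse_gaussian a v / a\<^sup>2\<close> dominates the integrand.\<close>

lemma integral_inverse_gaussian_le:
  assumes a: "a > 0"
  shows "integral {0..1} (\<lambda>v. 2 * inverse_gaussian a v) \<le> exp (- a\<^sup>2) / a\<^sup>2"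
proof -
  have "((\<lambda>v. 3 * v\<^sup>2 * inverse_gaussian a v / a\<^sup>2 + 2 * inverse_gaussian a v) has_integral
     (1 ^ 3 * inverse_gaussian a 1 / a\<^sup>2 - 0 ^ 3 * inverse_gaussian a 0 / a\<^sup>2)) {0..1}"
  proof (rule fundamental_theorem_of_calculus_interior)
    show "continuous_on {0..1} (\<lambda>v. v ^ 3 * inverse_gaussian a v / a\<^sup>2)"
      using a by (intro continuous_intros continuous_on_inverse_gaussian) auto
    fix v :: real assume v: "v \<in> {0<..<1}"
    have "((\<lambda>v. v ^ 3 * inverse_gaussian a v / a\<^sup>2) has_real_derivative
       3 * v\<^sup>2 * inverse_gaussian a v / a\<^sup>2 + 2 * inverse_gaussian a v) (at v)"
      using v a by (auto intro!: derivative_eq_intros has_real_derivative_inverse_gaussian simp: field_simps)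
    then show "((\<lambda>v. v ^ 3 * inverse_gaussian a v / a\<^sup>2) has_vector_derivative
       3 * v\<^sup>2 * inverse_gaussian a v / a\<^sup>2 + 2 * inverse_gaussian a v) (at v)"
      by (simp add: has_real_derivative_iff_has_vector_derivative)
  qed auto
  have "((\<lambda>v. 2 * inverse_gaussian a v) has_integral integral {0..1} (\<lambda>v. 2 * inverse_gaussian a v)) {0..1}"
    using a by (intro integrable_integral integrable_continuous_real continuous_intros continuous_on_inverse_gaussian)
  from has_integral_le[OF this \<open>(_ has_integral (1 ^ 3 * _ / _ - _)) _\<close>]
  have "integral {0..1} (\<lambda>v. 2 * inverse_gaussian a v)
     \<le> 1 ^ 3 * inverse_gaussian a 1 / a\<^sup>2 - 0 ^ 3 * inverse_gaussian a 0 / a\<^sup>2"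
    by (simp add: inverse_gaussian_nonneg)
  then show ?thesis by (simp add: inverse_gaussian_def)
qed

lemma norm_oscillatory_inverse_gaussian_le:
  assumes a: "a > 0"
  shows "norm (integral {0..1} (\<lambda>v. exp (of_real (v\<^sup>2) * (\<i> * of_real c)) * of_real (2 * inverse_gaussian a v)))
     \<le> exp (- a\<^sup>2) / a\<^sup>2"
proof -
  have "norm (integral {0..1} (\<lambda>v. exp (of_real (v\<^sup>2) * (\<i> * of_real c)) * of_real (2 * inverse_gaussian a v)))
     \<le> integral {0..1} (\<lambda>v. 2 * inverse_gaussian a v)"
    using a by (intro integral_norm_bound_integral integrable_continuous_real continuous_intros
        continuous_on_inverse_gaussian) (simp_all add: norm_mult inverse_gaussian_nonneg)
  with integral_inverse_gaussian_le[OF a] show ?thesis by linarith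
qed

text \<open>For large \<open>c\<close> the oscillation helps.  Integrating by parts, with
  \<open>inverse_gaussian a v / v\<close> as the smooth factor, costs its value at one plus its total variation.
  The factor increases on \<open>[0, 1]\<close> because \<open>a \<ge> 1\<close>, so both are \<open>exp (- a\<^sup>2)\<close>.\<close>

lemma norm_oscillatory_inverse_gaussian_le':
  assumes a: "a \<ge> 1" and c: "c > 0"
  shows "norm (integral {0..1} (\<lambda>v. exp (of_real (v\<^sup>2) * (\<i> * of_real c)) * of_real (2 * inverse_gaussian a v)))
     \<le> 2 * exp (- a\<^sup>2) / c"
proof -
  define E where "E = (\<lambda>v::real. exp (of_real (v\<^sup>2) * (\<i> * complex_of_real c)))"
  define q where "q = (\<lambda>v. inverse_gaussian a v / v)"
  define q' where "q' = (\<lambda>v. if v = 0 then 0 else (2 * a\<^sup>2 / v ^ 4 - 1 / v\<^sup>2) * inverse_gaussian a v)"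
  have a0: "a > 0" using a by simp
  have normE: "norm (E v) = 1" for v by (simp add: E_def)
  have contE: "continuous_on S E" for S unfolding E_def by (intro continuous_intros)
  have contq: "continuous_on S q" for S unfolding q_def by (rule continuous_on_inverse_gaussian[OF a0])
  have derq: "(q has_real_derivative q' v) (at v)" if "v > 0" for v
    unfolding q_def q'_def using that
    by (auto intro!: derivative_eq_intros has_real_derivative_inverse_gaussian
        simp: field_simps power2_eq_square power3_eq_cube power4_eq_xxxx)
  have derE: "(E has_vector_derivative E v * (2 * of_real v * (\<i> * of_real c))) (at v)" for v
  proof -
    have "((\<lambda>u. exp (u\<^sup>2 * (\<i> * of_real c))) has_field_derivative
        exp ((of_real v)\<^sup>2 * (\<i> * of_real c)) * (2 * of_real v * (\<i> * of_real c))) (at (of_real v))"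
      by (auto intro!: derivative_eq_intros)
    from has_vector_derivative_real_field[OF this] show ?thesis by (simp add: E_def)
  qed
  \<comment> \<open>Monotonicity of \<open>q\<close>; this is where \<open>a \<ge> 1\<close> enters.\<close>
  have q'nonneg: "q' v \<ge> 0" if "v \<in> {0..1}" for v
  proof (cases "v = 0")
    case False
    then have v: "0 < v" "v\<^sup>2 \<le> 1" using that by (auto simp: power_le_one)
    have "1 \<le> a\<^sup>2" using a by (simp add: one_le_power)
    then have "v\<^sup>2 \<le> 2 * a\<^sup>2" using v by linarith
    then have "1 / v\<^sup>2 \<le> 2 * a\<^sup>2 / v ^ 4" using v by (simp add: divide_simps power2_eq_square power4_eq_xxxx)
    then show ?thesis by (simp add: q'_def inverse_gaussian_nonneg)
  qed (simp add: q'_def)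
  have q'int: "(q' has_integral q 1 - q 0) {0..1}"
    by (rule fundamental_theorem_of_calculus_interior)
       (use derq contq in \<open>auto simp flip: has_real_derivative_iff_has_vector_derivative\<close>)
  have "((\<lambda>v. E v * of_real (q' v) + E v * (2 * of_real v * (\<i> * of_real c)) * of_real (q v))
      has_integral E 1 * of_real (q 1) - E 0 * of_real (q 0)) {0..1}"
  proof (rule fundamental_theorem_of_calculus_interior)
    show "continuous_on {0..1} (\<lambda>v. E v * of_real (q v))" by (intro continuous_intros contE contq)
    fix v :: real assume "v \<in> {0<..<1}"
    then have "((\<lambda>v. complex_of_real (q v)) has_vector_derivative of_real (q' v)) (at v)"
      using derq[of v] by (auto intro!: has_vector_derivative_of_real simp: has_real_derivative_iff_has_vector_derivative)
    from has_vector_derivative_mult[OF derE this]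
    show "((\<lambda>v. E v * of_real (q v)) has_vector_derivative
        E v * of_real (q' v) + E v * (2 * of_real v * (\<i> * of_real c)) * of_real (q v)) (at v)" .
  qed auto
  also have "(\<lambda>v. E v * of_real (q' v) + E v * (2 * of_real v * (\<i> * of_real c)) * of_real (q v))
     = (\<lambda>v. E v * of_real (q' v) + \<i> * of_real c * (E v * of_real (2 * inverse_gaussian a v)))"
    by (auto simp: q_def inverse_gaussian_def)
  finally have I1: "((\<lambda>v. E v * of_real (q' v) + \<i> * of_real c * (E v * of_real (2 * inverse_gaussian a v)))
      has_integral E 1 * of_real (q 1) - E 0 * of_real (q 0)) {0..1}" .
  define J where "J = integral {0..1} (\<lambda>v. E v * of_real (2 * inverse_gaussian a v))"
  have I2: "((\<lambda>v. \<i> * of_real c * (E v * of_real (2 * inverse_gaussian a v))) has_integral \<i> * of_real c * J) {0..1}"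
    unfolding J_def
    by (intro has_integral_mult_right integrable_integral integrable_continuous_real continuous_intros
        contE continuous_on_inverse_gaussian a0)
  from has_integral_diff[OF I1 I2]
  have I3: "((\<lambda>v. E v * of_real (q' v)) has_integral E 1 * of_real (q 1) - E 0 * of_real (q 0) - \<i> * of_real c * J) {0..1}"
    by simp
  have "norm (integral {0..1} (\<lambda>v. E v * of_real (q' v))) \<le> integral {0..1} q'"
    using q'nonneg by (intro integral_norm_bound_integral has_integral_integrable[OF I3] has_integral_integrable[OF q'int])
      (simp add: norm_mult normE)
  then have "norm (E 1 * of_real (q 1) - E 0 * of_real (q 0) - \<i> * of_real c * J) \<le> q 1 - q 0"
    using I3 q'int by (simp add: integral_unique)
  moreover have "q 0 = 0" "q 1 = exp (- a\<^sup>2)" by (simp_all add: q_def inverse_gaussian_def)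
  ultimately have "norm (E 1 * of_real (exp (- a\<^sup>2)) - \<i> * of_real c * J) \<le> exp (- a\<^sup>2)" by simp
  moreover have "norm (\<i> * of_real c * J) \<le> norm (E 1 * of_real (exp (- a\<^sup>2))) + norm (E 1 * of_real (exp (- a\<^sup>2)) - \<i> * of_real c * J)"
    by norm
  ultimately have "c * norm J \<le> 2 * exp (- a\<^sup>2)"
    using c by (simp add: norm_mult normE)
  then show ?thesis using c by (simp add: J_def E_def field_simps)
qed

text \<open>The expression of the error function as an integral over the segment from the origin, scaled
  to \<open>[0, 1]\<close> so that it can be compared with the quadrature sum under one integral sign.\<close>

lemma fresnel_eq_integral_unit_interval:
  "fresnel x = 1 / 2 - ray * of_real x / of_real (sqrt pi)
      * integral {0..1} (\<lambda>v. exp (of_real (v\<^sup>2) * (\<i> * of_real (x\<^sup>2))))"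
proof -
  define w where "w = ray * of_real x"
  have I1: "((\<lambda>v. w * exp (of_real (v\<^sup>2) * (\<i> * of_real (x\<^sup>2)))) has_integral
      - gaussian_tail (w * of_real 1) - - gaussian_tail (w * of_real 0)) {0..1}"
  proof (rule fundamental_theorem_of_calculus)
    fix v :: real
    have "((\<lambda>u. - gaussian_tail (w * u)) has_field_derivative w * exp (- (w * of_real v)\<^sup>2)) (at (of_real v))"
      by (auto intro!: derivative_eq_intros DERIV_chain'[OF _ has_field_derivative_gaussian_tail])
    from has_vector_derivative_real_field[OF this]
    show "((\<lambda>v. - gaussian_tail (w * of_real v)) has_vector_derivative
        w * exp (of_real (v\<^sup>2) * (\<i> * of_real (x\<^sup>2)))) (at v within {0..1})"
      by (simp add: w_def power_mult_distrib ray_squared has_vector_derivative_at_within mult_ac)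
  qed simp
  have I2: "((\<lambda>v. w * exp (of_real (v\<^sup>2) * (\<i> * of_real (x\<^sup>2)))) has_integral
      w * integral {0..1} (\<lambda>v. exp (of_real (v\<^sup>2) * (\<i> * of_real (x\<^sup>2))))) {0..1}"
    by (intro has_integral_mult_right integrable_integral integrable_continuous_real continuous_intros)
  from has_integral_unique[OF I2 I1]
  have "w * integral {0..1} (\<lambda>v. exp (of_real (v\<^sup>2) * (\<i> * of_real (x\<^sup>2))))
      = of_real (sqrt pi) / 2 - gaussian_tail w"
    by (simp add: gaussian_tail_0)
  then have "gaussian_tail w = of_real (sqrt pi) / 2 - w * integral {0..1} (\<lambda>v. exp (of_real (v\<^sup>2) * (\<i> * of_real (x\<^sup>2))))"
    by simp
  then show ?thesis
    unfolding fresnel_eq_gaussian_tail w_def[symmetric] by (simp add: diff_divide_distrib)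
qed

section \<open>The error of the untruncated midpoint rule\<close>

lemma
  assumes A: "A > (0::real)"
  shows summable_gaussian_integers: "summable (\<lambda>n. exp (- (A * real (Suc n))\<^sup>2))"
    and suminf_gaussian_integers_le: "(\<Sum>n. exp (- (A * real (Suc n))\<^sup>2)) \<le> exp (- A\<^sup>2) / (1 - exp (- 2 * A\<^sup>2))"
proof -
  have le: "exp (- (A * real (Suc n))\<^sup>2) \<le> exp (- A\<^sup>2) * exp (- 2 * A\<^sup>2) ^ n" for n
  proof -
    have "1 + 2 * real n \<le> (real (Suc n))\<^sup>2" by (simp add: power2_eq_square algebra_simps)
    from mult_left_mono[OF this zero_le_power2[of A]]
    have "A\<^sup>2 * (1 + 2 * real n) \<le> (A * real (Suc n))\<^sup>2" by (simp only: power_mult_distrib)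
    then show ?thesis
      by (simp add: exp_of_nat_mult[symmetric] exp_add[symmetric] algebra_simps del: of_nat_Suc)
  qed
  have geo: "(\<lambda>n. exp (- A\<^sup>2) * exp (- 2 * A\<^sup>2) ^ n) sums (exp (- A\<^sup>2) * (1 / (1 - exp (- 2 * A\<^sup>2))))"
    using A by (intro sums_mult geometric_sums) simp
  show s: "summable (\<lambda>n. exp (- (A * real (Suc n))\<^sup>2))"
    by (rule summable_comparison_test'[OF sums_summable[OF geo], of 0]) (use le in auto)
  show "(\<Sum>n. exp (- (A * real (Suc n))\<^sup>2)) \<le> exp (- A\<^sup>2) / (1 - exp (- 2 * A\<^sup>2))"
    using suminf_le[OF le s sums_summable[OF geo]] sums_unique[OF geo] by simp
qed

text \<open>The theta identity with parameter \<open>(v * pi / A)\<^sup>2\<close>: the rescaled nodes appear on one side, and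
  on the other a constant plus corrections that are all at most \<open>exp (- A\<^sup>2)\<close> for \<open>v \<le> 1\<close>.\<close>

lemma midpoint_theta_inverse_gaussian:
  assumes A: "A > 0" and v: "v > 0"
  shows "(\<lambda>k. 2 * v * exp (- v\<^sup>2 * ((real k + 1/2) * pi / A)\<^sup>2)) sums
      (A / sqrt pi * (1 + 2 * (\<Sum>n. (-1) ^ Suc n * inverse_gaussian (A * real (Suc n)) v)))"
    and "summable (\<lambda>n. (-1) ^ Suc n * inverse_gaussian (A * real (Suc n)) v)"
proof -
  define a where "a = (v * pi / A)\<^sup>2"
  have a: "a > 0" using A v by (simp add: a_def)
  have 1: "- a * (real k + 1/2)\<^sup>2 = - v\<^sup>2 * ((real k + 1/2) * pi / A)\<^sup>2" for k
    by (simp add: a_def power_mult_distrib power_divide)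
  have 2: "exp (- (pi * real (Suc n))\<^sup>2 / a) = inverse_gaussian (A * real (Suc n)) v" for n
  proof -
    have "(pi * real (Suc n))\<^sup>2 / a = (A * real (Suc n) / v)\<^sup>2"
      using A v by (simp add: a_def power_mult_distrib power_divide)
    then show ?thesis using v by (simp add: inverse_gaussian_def)
  qed
  have 3: "v * sqrt (pi / a) = A / sqrt pi"
    using A v by (simp add: a_def real_sqrt_divide real_sqrt_mult field_simps)
  note th = gaussian_midpoint_theta[OF a, unfolded 1 2]
  show "summable (\<lambda>n. (-1) ^ Suc n * inverse_gaussian (A * real (Suc n)) v)" by (rule th(2))
  have "(\<lambda>k. 2 * v * exp (- v\<^sup>2 * ((real k + 1/2) * pi / A)\<^sup>2)) sums
     (2 * v * (\<Sum>k. exp (- v\<^sup>2 * ((real k + 1/2) * pi / A)\<^sup>2)))"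
    by (intro sums_mult summable_sums th(1))
  also have "2 * v * (\<Sum>k. exp (- v\<^sup>2 * ((real k + 1/2) * pi / A)\<^sup>2))
     = v * (2 * (\<Sum>k. exp (- v\<^sup>2 * ((real k + 1/2) * pi / A)\<^sup>2)))" by simp
  also have "\<dots> = v * sqrt (pi / a) * (1 + 2 * (\<Sum>n. (-1) ^ Suc n * inverse_gaussian (A * real (Suc n)) v))"
    by (simp only: th(3) mult.assoc)
  finally show "(\<lambda>k. 2 * v * exp (- v\<^sup>2 * ((real k + 1/2) * pi / A)\<^sup>2)) sums
      (A / sqrt pi * (1 + 2 * (\<Sum>n. (-1) ^ Suc n * inverse_gaussian (A * real (Suc n)) v)))"
    by (simp only: 3)
qed

lemma integral_exp_square:
  fixes p :: complex
  assumes p: "p \<noteq> 0"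
  shows "((\<lambda>v. 2 * of_real v * exp (- of_real (v\<^sup>2) * p)) has_integral (1 - exp (- p)) / p) {0..1}"
proof -
  have "((\<lambda>v. 2 * of_real v * exp (- of_real (v\<^sup>2) * p)) has_integral
     (- exp (- (of_real 1)\<^sup>2 * p) / p) - (- exp (- (of_real 0)\<^sup>2 * p) / p)) {0..1}"
  proof (rule fundamental_theorem_of_calculus)
    fix v :: real
    have "((\<lambda>u. - exp (- u\<^sup>2 * p) / p) has_field_derivative 2 * of_real v * exp (- (of_real v)\<^sup>2 * p)) (at (of_real v))"
      using p by (auto intro!: derivative_eq_intros)
    from has_vector_derivative_real_field[OF this]
    show "((\<lambda>v. - exp (- (of_real v)\<^sup>2 * p) / p) has_vector_derivative 2 * of_real v * exp (- of_real (v\<^sup>2) * p)) (at v within {0..1})"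
      by (simp add: has_vector_derivative_at_within)
  qed simp
  then show ?thesis by (simp add: diff_divide_distrib)
qed

text \<open>Both sides of the theta identity are integrated against the oscillating factor over \<open>[0, 1]\<close>.
  On the node side each term is elementary.  Dominated convergence applies to both sides with a
  constant bound, because the node sums have nonnegative terms and bounded total.\<close>

lemma integral_midpoint_sums:
  assumes A: "A > 0" and x: "x > 0"
  defines "E \<equiv> (\<lambda>v::real. exp (of_real (v\<^sup>2) * (\<i> * complex_of_real (x\<^sup>2))))"
  shows "\<exists>I. (\<lambda>k. (1 - exp (- (of_real (((real k + 1/2) * pi / A)\<^sup>2) - \<i> * of_real (x\<^sup>2))))
              / (of_real (((real k + 1/2) * pi / A)\<^sup>2) - \<i> * of_real (x\<^sup>2))) sums I \<and>
       (\<lambda>N. of_real (A / sqrt pi) * (integral {0..1} E +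
           (\<Sum>n<N. (-1) ^ Suc n * integral {0..1} (\<lambda>v. E v * of_real (2 * inverse_gaussian (A * real (Suc n)) v)))))
          \<longlonglongrightarrow> I"
proof -
  define \<tau> where "\<tau> = (\<lambda>k. (real k + 1/2) * pi / A)"
  define h where "h = (\<lambda>n v. (-1) ^ Suc n * inverse_gaussian (A * real (Suc n)) v)"
  define C where "C = (\<Sum>n. exp (- (A * real (Suc n))\<^sup>2))"
  define G where "G = (\<lambda>v. if v = 0 then 0 else A / sqrt pi * (1 + 2 * (\<Sum>n. h n v)))"
  define B where "B = A / sqrt pi * (1 + 2 * C)"
  define f where "f = (\<lambda>K v. E v * of_real (\<Sum>k<K. 2 * v * exp (- v\<^sup>2 * (\<tau> k)\<^sup>2)))"
  define g where "g = (\<lambda>N v. E v * of_real (if v = 0 then 0 else A / sqrt pi * (1 + 2 * (\<Sum>n<N. h n v))))"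
  have normE: "norm (E v) = 1" for v by (simp add: E_def)
  have contE: "continuous_on S E" for S unfolding E_def by (intro continuous_intros)
  have conth: "continuous_on S (h n)" for S n
    unfolding h_def using A by (intro continuous_intros continuous_on_inverse_gaussian) auto
  have habs: "\<bar>h n v\<bar> \<le> exp (- (A * real (Suc n))\<^sup>2)" if "v \<in> {0..1}" for n v
    using inverse_gaussian_le[of v "A * real (Suc n)"] that
    by (simp add: h_def abs_mult inverse_gaussian_nonneg)
  have C0: "C \<ge> 0" unfolding C_def by (intro suminf_nonneg summable_gaussian_integers A) auto
  have hsum: "\<bar>\<Sum>n<N. h n v\<bar> \<le> C" if "v \<in> {0..1}" for N v
  proof -
    have "\<bar>\<Sum>n<N. h n v\<bar> \<le> (\<Sum>n<N. exp (- (A * real (Suc n))\<^sup>2))"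
      using habs[OF that] by (intro order.trans[OF sum_abs] sum_mono)
    also have "\<dots> \<le> C" unfolding C_def
      by (intro sum_le_suminf summable_gaussian_integers A) auto
    finally show ?thesis .
  qed
  have B0: "B \<ge> 0" using A C0 by (simp add: B_def)
  have gbound: "\<bar>A / sqrt pi * (1 + 2 * (\<Sum>n<N. h n v))\<bar> \<le> B" if "v \<in> {0..1}" for N v
  proof -
    have "\<bar>1 + 2 * (\<Sum>n<N. h n v)\<bar> \<le> 1 + 2 * C" using hsum[OF that, of N] by linarith
    then have "A / sqrt pi * \<bar>1 + 2 * (\<Sum>n<N. h n v)\<bar> \<le> B"
      unfolding B_def using A by (intro mult_left_mono) auto
    then show ?thesis using A by (simp add: abs_mult)
  qed
  have sumh: "summable (\<lambda>n. h n v)" and theta: "(\<lambda>k. 2 * v * exp (- v\<^sup>2 * (\<tau> k)\<^sup>2)) sums (G v)"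
    if "v > 0" for v
    using midpoint_theta_inverse_gaussian[OF A that] that by (simp_all add: h_def G_def \<tau>_def)
  have glim: "(\<lambda>N. if v = 0 then 0 else A / sqrt pi * (1 + 2 * (\<Sum>n<N. h n v))) \<longlonglongrightarrow> G v"
    if "v \<in> {0..1}" for v
  proof (cases "v = 0")
    case False
    then have "(\<lambda>N. A / sqrt pi * (1 + 2 * (\<Sum>n<N. h n v))) \<longlonglongrightarrow> A / sqrt pi * (1 + 2 * (\<Sum>n. h n v))"
      using that by (intro tendsto_intros summable_LIMSEQ sumh) auto
    then show ?thesis using False by (simp add: G_def)
  qed (simp add: G_def)
  have GB: "\<bar>G v\<bar> \<le> B" if "v \<in> {0..1}" for v
  proof -
    have "(\<lambda>N. \<bar>if v = 0 then 0 else A / sqrt pi * (1 + 2 * (\<Sum>n<N. h n v))\<bar>) \<longlonglongrightarrow> \<bar>G v\<bar>"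
      by (intro tendsto_intros glim that)
    then show ?thesis
      by (rule LIMSEQ_le_const2) (use gbound[OF that] B0 in auto)
  qed
  \<comment> \<open>At \<open>v = 0\<close> the theta identity fails, so the integrands are set to zero there.\<close>
  have spike: "(F has_integral I) {0..1} \<longleftrightarrow> ((\<lambda>v. if v = 0 then 0 else F v) has_integral I) {0..1}"
    for F :: "real \<Rightarrow> complex" and I
    by (rule has_integral_spike_eq[of "{0}"]) auto
  have gint: "(g N has_integral of_real (A / sqrt pi) * (integral {0..1} E +
      (\<Sum>n<N. (-1) ^ Suc n * integral {0..1} (\<lambda>v. E v * of_real (2 * inverse_gaussian (A * real (Suc n)) v))))) {0..1}" for N
  proof -
    have 1: "((\<lambda>v. of_real (A / sqrt pi) * (E v +
       (\<Sum>n<N. (-1) ^ Suc n * (E v * of_real (2 * inverse_gaussian (A * real (Suc n)) v))))) has_integral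
       of_real (A / sqrt pi) * (integral {0..1} E +
       (\<Sum>n<N. (-1) ^ Suc n * integral {0..1} (\<lambda>v. E v * of_real (2 * inverse_gaussian (A * real (Suc n)) v))))) {0..1}"
      using A by (intro has_integral_mult_right has_integral_add has_integral_sum integrable_integral
          integrable_continuous_real continuous_intros contE continuous_on_inverse_gaussian) auto
    have 2: "g N = (\<lambda>v. if v = 0 then 0 else of_real (A / sqrt pi) * (E v +
       (\<Sum>n<N. (-1) ^ Suc n * (E v * of_real (2 * inverse_gaussian (A * real (Suc n)) v)))))"
      by (auto simp: g_def h_def sum_distrib_left algebra_simps)
    from 1 show ?thesis unfolding 2 by (subst (asm) spike)
  qed
  have fint: "(f K has_integral (\<Sum>k<K. (1 - exp (- (of_real ((\<tau> k)\<^sup>2) - \<i> * of_real (x\<^sup>2))))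
       / (of_real ((\<tau> k)\<^sup>2) - \<i> * of_real (x\<^sup>2)))) {0..1}" for K
  proof -
    have ne: "of_real ((\<tau> k)\<^sup>2) - \<i> * of_real (x\<^sup>2) \<noteq> 0" for k
      using x by (simp add: complex_eq_iff)
    have "f K = (\<lambda>v. \<Sum>k<K. 2 * of_real v * exp (- of_real (v\<^sup>2) * (of_real ((\<tau> k)\<^sup>2) - \<i> * of_real (x\<^sup>2))))"
    proof
      fix v
      have summand: "E v * of_real (2 * v * exp (- v\<^sup>2 * (\<tau> k)\<^sup>2))
         = 2 * of_real v * exp (- of_real (v\<^sup>2) * (of_real ((\<tau> k)\<^sup>2) - \<i> * of_real (x\<^sup>2)))" for k
      proof -
        have "E v * of_real (exp (- v\<^sup>2 * (\<tau> k)\<^sup>2)) = exp (- of_real (v\<^sup>2) * (of_real ((\<tau> k)\<^sup>2) - \<i> * of_real (x\<^sup>2)))"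
          unfolding E_def exp_of_real[symmetric] exp_add[symmetric] by (simp add: algebra_simps)
        then show ?thesis by (simp add: mult_ac)
      qed
      then show "f K v = (\<Sum>k<K. 2 * of_real v * exp (- of_real (v\<^sup>2) * (of_real ((\<tau> k)\<^sup>2) - \<i> * of_real (x\<^sup>2))))"
        unfolding f_def of_real_sum sum_distrib_left by (simp only: summand)
    qed
    then show ?thesis using ne by (simp only:) (intro has_integral_sum integral_exp_square; simp)
  qed
  have conv: "(\<lambda>v. E v * of_real (G v)) integrable_on {0..1}"
       "(\<lambda>N. integral {0..1} (g N)) \<longlonglongrightarrow> integral {0..1} (\<lambda>v. E v * of_real (G v))"
  proof -
    have "norm (g N v) \<le> B" if "v \<in> {0..1}" for N v
      using gbound[OF that, of N] B0 unfolding g_def by (simp only: norm_mult normE norm_of_real) auto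
    moreover have "(\<lambda>N. g N v) \<longlonglongrightarrow> E v * of_real (G v)" if "v \<in> {0..1}" for v
      unfolding g_def by (intro tendsto_intros glim that)
    ultimately show "(\<lambda>v. E v * of_real (G v)) integrable_on {0..1}"
       "(\<lambda>N. integral {0..1} (g N)) \<longlonglongrightarrow> integral {0..1} (\<lambda>v. E v * of_real (G v))"
      using dominated_convergence[of g "{0..1}" "\<lambda>_. B" "\<lambda>v. E v * of_real (G v)"]
        has_integral_integrable[OF gint] integrable_const_ivl by blast+
  qed
  have conv2: "(\<lambda>K. integral {0..1} (f K)) \<longlonglongrightarrow> integral {0..1} (\<lambda>v. E v * of_real (G v))"
  proof (rule dominated_convergence(2)[of f _ "\<lambda>_. B"])
    show "f K integrable_on {0..1}" for K by (rule has_integral_integrable[OF fint])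
    show "norm (f K v) \<le> B" if v: "v \<in> {0..1}" for K v
    proof (cases "v = 0")
      case False
      then have "v > 0" using v by simp
      note th = theta[OF this]
      have "(\<Sum>k<K. 2 * v * exp (- v\<^sup>2 * (\<tau> k)\<^sup>2)) \<le> G v"
        using v unfolding sums_unique[OF th] by (intro sum_le_suminf sums_summable[OF th]) auto
      moreover have "0 \<le> (\<Sum>k<K. 2 * v * exp (- v\<^sup>2 * (\<tau> k)\<^sup>2))"
        using v by (intro sum_nonneg) auto
      ultimately have "\<bar>\<Sum>k<K. 2 * v * exp (- v\<^sup>2 * (\<tau> k)\<^sup>2)\<bar> \<le> B" using GB[OF v] by linarith
      then show ?thesis unfolding f_def by (simp only: norm_mult normE norm_of_real mult_1)
    qed (simp add: f_def B0)
    show "(\<lambda>K. f K v) \<longlonglongrightarrow> E v * of_real (G v)" if v: "v \<in> {0..1}" for v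
    proof (cases "v = 0")
      case False
      then have "v > 0" using v by simp
      from theta[OF this] show ?thesis
        unfolding f_def sums_def by (intro tendsto_intros)
    qed (simp add: f_def G_def)
  qed (rule integrable_const_ivl)
  show ?thesis
  proof (intro exI conjI)
    show "(\<lambda>k. (1 - exp (- (of_real (((real k + 1/2) * pi / A)\<^sup>2) - \<i> * of_real (x\<^sup>2))))
              / (of_real (((real k + 1/2) * pi / A)\<^sup>2) - \<i> * of_real (x\<^sup>2))) sums integral {0..1} (\<lambda>v. E v * of_real (G v))"
      using conv2 unfolding sums_def integral_unique[OF fint] \<tau>_def by simp
    show "(\<lambda>N. of_real (A / sqrt pi) * (integral {0..1} E +
           (\<Sum>n<N. (-1) ^ Suc n * integral {0..1} (\<lambda>v. E v * of_real (2 * inverse_gaussian (A * real (Suc n)) v)))))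
          \<longlonglongrightarrow> integral {0..1} (\<lambda>v. E v * of_real (G v))"
      using conv(2) unfolding integral_unique[OF gint] by simp
  qed
qed


text \<open>The untruncated quadrature sum.  Adding the partial fractions of the exponential term turns
  the summands into integrals over \<open>[0, 1]\<close>; the constant of the theta identity reproduces the
  Fresnel integral, and the remaining corrections are the error.  The two estimates of the
  oscillatory integrals give the two members of the minimum.\<close>

theorem midpoint_rule_error:
  assumes A: "A \<ge> 1" and x: "x > 0"
  defines "p \<equiv> (\<lambda>k. of_real (((real k + 1/2) * pi / A)\<^sup>2) - \<i> * complex_of_real (x\<^sup>2))"
  shows "\<exists>R. (\<lambda>k. ray * of_real (x / A) * (exp (- p k) / p k)) sums
             (fresnel x - 1 / (exp (2 * of_real A * (ray * of_real x)) + 1) - R) \<and>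
           norm R \<le> x / sqrt pi * min (1 / A\<^sup>2) (2 / x\<^sup>2) * (exp (- A\<^sup>2) / (1 - exp (- 2 * A\<^sup>2)))"
proof -
  define w where "w = ray * of_real x"
  define E where "E = (\<lambda>v::real. exp (of_real (v\<^sup>2) * (\<i> * complex_of_real (x\<^sup>2))))"
  define J where "J = (\<lambda>n. integral {0..1} (\<lambda>v. E v * of_real (2 * inverse_gaussian (A * real (Suc n)) v)))"
  define \<mu> where "\<mu> = min (1 / A\<^sup>2) (2 / x\<^sup>2)"
  define R where "R = w / of_real (sqrt pi) * (\<Sum>n. (-1) ^ Suc n * J n)"
  have A0: "A > 0" using A by simp
  have a1: "A * real (Suc n) \<ge> 1" "A\<^sup>2 \<le> (A * real (Suc n))\<^sup>2" for n
    using A mult_mono[of 1 A 1 "real (Suc n)"] by (auto intro!: power_mono simp: mult_le_cancel_left1)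
  have Jle: "norm (J n) \<le> \<mu> * exp (- (A * real (Suc n))\<^sup>2)" for n
  proof -
    let ?e = "exp (- (A * real (Suc n))\<^sup>2)"
    have "norm (J n) \<le> ?e / (A * real (Suc n))\<^sup>2"
      unfolding J_def E_def using a1[of n] by (intro norm_oscillatory_inverse_gaussian_le) linarith
    also have "\<dots> \<le> ?e / A\<^sup>2"
      using a1[of n] A0 by (intro divide_left_mono) auto
    finally have 1: "norm (J n) \<le> 1 / A\<^sup>2 * ?e" by simp
    have 2: "norm (J n) \<le> 2 / x\<^sup>2 * ?e"
      using norm_oscillatory_inverse_gaussian_le'[OF a1(1), of "x\<^sup>2" n] x unfolding J_def E_def by simp
    show ?thesis unfolding \<mu>_def min_def using 1 2 by simp
  qed
  have sumb: "summable (\<lambda>n. \<mu> * exp (- (A * real (Suc n))\<^sup>2))"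
    by (intro summable_mult summable_gaussian_integers A0)
  have nJ: "norm ((-1) ^ Suc n * J n) = norm (J n)" for n by (simp add: norm_mult norm_power)
  have sumnJ: "summable (\<lambda>n. norm ((-1) ^ Suc n * J n))"
    unfolding nJ by (rule summable_comparison_test'[OF sumb, of 0]) (use Jle in auto)
  then have sumJ: "summable (\<lambda>n. (-1) ^ Suc n * J n)" by (rule summable_norm_cancel)
  have "norm (\<Sum>n. (-1) ^ Suc n * J n) \<le> (\<Sum>n. \<mu> * exp (- (A * real (Suc n))\<^sup>2))"
    by (rule order.trans[OF summable_norm[OF sumnJ]])
       (intro suminf_le sumnJ sumb, simp only: nJ Jle)
  also have "\<dots> = \<mu> * (\<Sum>n. exp (- (A * real (Suc n))\<^sup>2))"
    by (intro suminf_mult summable_gaussian_integers A0)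
  also have "\<dots> \<le> \<mu> * (exp (- A\<^sup>2) / (1 - exp (- 2 * A\<^sup>2)))"
    by (intro mult_left_mono suminf_gaussian_integers_le A0) (simp add: \<mu>_def)
  finally have "norm R \<le> x / sqrt pi * (\<mu> * (exp (- A\<^sup>2) / (1 - exp (- 2 * A\<^sup>2))))"
    unfolding R_def norm_mult w_def norm_divide using x by (intro mult_mono) (auto simp: \<mu>_def)
  then have normR: "norm R \<le> x / sqrt pi * \<mu> * (exp (- A\<^sup>2) / (1 - exp (- 2 * A\<^sup>2)))"
    by (simp only: mult.assoc)
  obtain I where I: "(\<lambda>k. (1 - exp (- p k)) / p k) sums I"
    and I': "(\<lambda>N. of_real (A / sqrt pi) * (integral {0..1} E + (\<Sum>n<N. (-1) ^ Suc n * J n))) \<longlonglongrightarrow> I"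
    using integral_midpoint_sums[OF A0 x] unfolding p_def E_def J_def by blast
  have "(\<lambda>N. of_real (A / sqrt pi) * (integral {0..1} E + (\<Sum>n<N. (-1) ^ Suc n * J n)))
     \<longlonglongrightarrow> of_real (A / sqrt pi) * (integral {0..1} E + (\<Sum>n. (-1) ^ Suc n * J n))"
    by (intro tendsto_intros summable_LIMSEQ sumJ)
  with I' have "I = of_real (A / sqrt pi) * (integral {0..1} E + (\<Sum>n. (-1) ^ Suc n * J n))"
    by (rule LIMSEQ_unique)
  then have wI: "w / of_real A * I = w / of_real (sqrt pi) * integral {0..1} E + R"
  proof -
    have "w / of_real A * (of_real (A / sqrt pi) * (integral {0..1} E + S)) = w / of_real (sqrt pi) * (integral {0..1} E + S)" for S
      using A0 by simp
    then show ?thesis unfolding R_def \<open>I = _\<close> by (simp only: distrib_left)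
  qed
  have wE: "w / of_real (sqrt pi) * integral {0..1} E = 1 / 2 - fresnel x"
    unfolding fresnel_eq_integral_unit_interval w_def E_def by simp
  have "Re w > 0" using x by (simp add: w_def Re_ray)
  from logistic_partial_fractions[OF A0 this]
  have L: "(\<lambda>k. w / of_real A / p k) sums (1 / 2 - 1 / (exp (2 * of_real A * w) + 1))"
    by (simp add: p_def w_def power_mult_distrib ray_squared add.commute)
  have "(\<lambda>k. w / of_real A / p k - w / of_real A * ((1 - exp (- p k)) / p k)) sums
     (1 / 2 - 1 / (exp (2 * of_real A * w) + 1) - w / of_real A * I)"
    by (intro sums_diff L sums_mult I)
  also have "(\<lambda>k. w / of_real A / p k - w / of_real A * ((1 - exp (- p k)) / p k))
     = (\<lambda>k. ray * of_real (x / A) * (exp (- p k) / p k))"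
    by (auto simp: w_def diff_divide_distrib algebra_simps)
  also have "1 / 2 - 1 / (exp (2 * of_real A * w) + 1) - w / of_real A * I
     = fresnel x - 1 / (exp (2 * of_real A * (ray * of_real x)) + 1) - R"
    unfolding wI wE by (simp add: w_def)
  finally show ?thesis using normR unfolding \<mu>_def by blast
qed

section \<open>Truncation and the absolute error\<close>

lemma A_N_pos: "A_N N > 0"
  by (simp add: A_N_def add_nonneg_pos)

lemma A_N_squared: "(A_N N)\<^sup>2 = (real N + 1/2) * pi"
  by (simp add: A_N_def)

lemma A_N_ge_2:
  assumes "N \<ge> 1"
  shows "A_N N \<ge> 2"
proof -
  have "pi > 3" using pi_approx by simp
  moreover have "1 * pi + pi / 2 \<le> real N * pi + pi / 2"
    using assms by (intro add_right_mono mult_right_mono) auto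
  moreover have "(real N + 1/2) * pi = real N * pi + pi / 2" by (simp add: algebra_simps)
  ultimately have "4 \<le> (A_N N)\<^sup>2" unfolding A_N_squared by linarith
  then have "2\<^sup>2 \<le> (A_N N)\<^sup>2" by simp
  then show ?thesis by (rule power2_le_imp_le) (use A_N_pos[of N] in simp)
qed

lemma node_Suc: "node N (Suc j) = (real j + 1/2) * pi / A_N N"
  by (simp add: node_def A_N_def)

lemma ray_mult_i: "ray * \<i> = exp (\<i> * of_real (pi / 4))"
proof -
  have "cis (pi / 2) = exp (\<i> * of_real (pi / 2))" by (simp only: cis_conv_exp)
  then have "\<i> = exp (\<i> * of_real (pi / 2))" by (simp only: cis_pi_half)
  then have "ray * \<i> = exp (- (\<i> * of_real pi / 4) + \<i> * of_real (pi / 2))"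
    unfolding ray_def exp_add by simp
  also have "- (\<i> * of_real pi / 4) + \<i> * of_real (pi / 2) = \<i> * of_real (pi / 4)"
    by (simp add: complex_eq_iff)
  finally show ?thesis .
qed

text \<open>The summands rewritten with \<open>p = t\<^sup>2 - \<i> * x\<^sup>2\<close>, so that numerator and denominator depend on the same quantity.\<close>

lemma fresnel_approx_eq:
  fixes N :: nat and x :: real
  defines "p \<equiv> (\<lambda>k. of_real (((real k + 1/2) * pi / A_N N)\<^sup>2) - \<i> * complex_of_real (x\<^sup>2))"
  shows "fresnel_approx N x = 1 / (exp (2 * of_real (A_N N) * (ray * of_real x)) + 1)
           + (\<Sum>k<N. ray * of_real (x / A_N N) * (exp (- p k) / p k))"
proof -
  have summand: "of_real (x / A_N N) * exp (\<i> * of_real (x\<^sup>2 + pi / 4)) *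
      (of_real (exp (- (node N (Suc j))\<^sup>2)) / (of_real (x\<^sup>2) + \<i> * of_real ((node N (Suc j))\<^sup>2)))
     = ray * of_real (x / A_N N) * (exp (- p j) / p j)" for j
  proof -
    define t where "t = node N (Suc j)"
    define d where "d = of_real (x\<^sup>2) + \<i> * complex_of_real (t\<^sup>2)"
    have p: "p j = - \<i> * d"
      by (simp add: p_def d_def t_def node_Suc algebra_simps)
    have "exp (- p j) = exp (\<i> * of_real (x\<^sup>2)) * of_real (exp (- t\<^sup>2))"
      unfolding exp_of_real[symmetric] exp_add[symmetric] by (simp add: p d_def algebra_simps)
    then have "ray * of_real (x / A_N N) * (exp (- p j) / p j)
       = of_real (x / A_N N) * (exp (\<i> * of_real (x\<^sup>2)) * (ray * \<i>)) * (of_real (exp (- t\<^sup>2)) / d)"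
      unfolding p by (simp add: divide_simps)
    also have "exp (\<i> * of_real (x\<^sup>2)) * (ray * \<i>) = exp (\<i> * of_real (x\<^sup>2 + pi / 4))"
      unfolding ray_mult_i exp_add[symmetric] by (simp add: algebra_simps)
    finally show ?thesis by (simp add: t_def d_def)
  qed
  have "{1..N} = Suc ` {..<N}" using atLeast1_atMost_eq_remove0 by (auto simp: image_Suc_lessThan)
  then have "(\<Sum>k=1..N. of_real (exp (- (node N k)\<^sup>2)) / (of_real (x\<^sup>2) + \<i> * of_real ((node N k)\<^sup>2)))
     = (\<Sum>j<N. of_real (exp (- (node N (Suc j))\<^sup>2)) / (of_real (x\<^sup>2) + \<i> * complex_of_real ((node N (Suc j))\<^sup>2)))"
    by (simp add: sum.reindex)
  then show ?thesis
    unfolding fresnel_approx_def ray_def[symmetric] by (simp only: sum_distrib_left summand) (simp add: mult_ac)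
qed

lemma exp_ray_nonzero:
  assumes "A > 0"
  shows "exp (2 * of_real A * (ray * of_real x)) + 1 \<noteq> 0"
proof (cases "x = 0")
  case False
  have "norm (exp (2 * of_real A * (ray * of_real x))) \<noteq> 1"
    using assms False by (simp add: Re_ray)
  then show ?thesis
    by (metis add_eq_0_iff2 norm_minus_cancel norm_one)
qed auto

lemma fresnel_approx_minus:
  assumes "N \<ge> 1"
  shows "fresnel_approx N (- x) = 1 - fresnel_approx N x"
proof -
  define e where "e = exp (2 * of_real (A_N N) * (ray * of_real x))"
  have e: "e \<noteq> 0" "e + 1 \<noteq> 0" using exp_ray_nonzero[OF A_N_pos, of N x] by (auto simp: e_def)
  have "exp (2 * of_real (A_N N) * (ray * of_real (- x))) = inverse e"
    by (simp add: e_def exp_minus)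
  moreover have "1 / (inverse e + 1) = 1 - 1 / (e + 1)"
  proof -
    have "inverse e + 1 = (e + 1) / e" using e by (simp add: field_simps)
    then have "1 / (inverse e + 1) = ((e + 1) - 1) / (e + 1)" by simp
    also have "\<dots> = 1 - 1 / (e + 1)" using e by (simp only: diff_divide_distrib divide_self_if if_False)
    finally show ?thesis .
  qed
  ultimately show ?thesis
    unfolding fresnel_approx_eq e_def[symmetric] by (simp add: sum_negf)
qed

text \<open>The first omitted node is \<open>A_N N\<close> itself and the spacing is \<open>pi / A_N N\<close>, so successive omitted
  squares grow by at least \<open>2 * pi\<close> and the tail is dominated by a geometric series.\<close>

lemma norm_fresnel_tail_term:
  assumes x: "x > 0" and N: "N \<ge> 1"
  defines "A \<equiv> A_N N"
  defines "p \<equiv> (\<lambda>k. of_real (((real k + 1/2) * pi / A)\<^sup>2) - \<i> * complex_of_real (x\<^sup>2))"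
  shows "norm (ray * of_real (x / A) * (exp (- p (k + N)) / p (k + N)))
     \<le> x / (A * sqrt (x ^ 4 + A ^ 4)) * exp (- A\<^sup>2) * exp (- 2 * pi) ^ k"
proof -
  have A: "A > 0" "A\<^sup>2 = (real N + 1/2) * pi" by (simp_all add: A_def A_N_pos A_N_squared)
  define t where "t = (real (k + N) + 1/2) * pi / A"
  have t: "t = A + real k * pi / A"
    using A by (simp add: t_def field_simps power2_eq_square)
  have t2: "A\<^sup>2 + 2 * pi * real k \<le> t\<^sup>2"
    using A(1) unfolding t power2_sum by simp
  then have tA: "A\<^sup>2 \<le> t\<^sup>2" by (smt (verit) mult_nonneg_nonneg of_nat_0_le_iff pi_ge_zero)
  have pe: "p (k + N) = of_real (t\<^sup>2) - \<i> * complex_of_real (x\<^sup>2)" by (simp add: p_def t_def)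
  have "norm (p (k + N)) = sqrt ((t\<^sup>2)\<^sup>2 + (x\<^sup>2)\<^sup>2)"
    unfolding pe by (simp add: cmod_def)
  also have "\<dots> \<ge> sqrt (x ^ 4 + A ^ 4)"
    using power_mono[OF tA, of 2] by (simp add: power_mult[symmetric])
  finally have np: "norm (p (k + N)) \<ge> sqrt (x ^ 4 + A ^ 4)" .
  have sq: "sqrt (x ^ 4 + A ^ 4) > 0" using x A by (simp add: add_pos_pos)
  have "norm (exp (- p (k + N))) = exp (- t\<^sup>2)" unfolding pe by simp
  also have "\<dots> \<le> exp (- A\<^sup>2) * exp (- 2 * pi) ^ k"
    unfolding exp_of_nat_mult[symmetric] exp_add[symmetric] using t2 by (simp add: algebra_simps)
  finally have ne: "norm (exp (- p (k + N))) \<le> exp (- A\<^sup>2) * exp (- 2 * pi) ^ k" .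
  have "norm (ray * of_real (x / A) * (exp (- p (k + N)) / p (k + N)))
     = x / A * (norm (exp (- p (k + N))) / norm (p (k + N)))"
    unfolding norm_mult norm_divide norm_of_real norm_ray using x A by simp
  also have "\<dots> \<le> x / A * ((exp (- A\<^sup>2) * exp (- 2 * pi) ^ k) / sqrt (x ^ 4 + A ^ 4))"
    using x A sq by (intro mult_left_mono frac_le ne np) auto
  also have "\<dots> = x / (A * sqrt (x ^ 4 + A ^ 4)) * exp (- A\<^sup>2) * exp (- 2 * pi) ^ k" by simp
  finally show ?thesis .
qed

lemma inverse_one_minus_exp_le: "1 / (1 - exp (- 2 * pi)) \<le> (2 * pi + 1) / (2 * pi)"
proof -
  have "1 + 2 * pi \<le> exp (2 * pi)" by (rule exp_ge_add_one_self)
  then have "exp (- 2 * pi) * (1 + 2 * pi) \<le> 1"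
    by (simp add: exp_minus field_simps)
  moreover have "exp (- 2 * pi) < 1" by simp
  ultimately show ?thesis by (simp add: divide_simps algebra_simps)
qed

text \<open>The error bound just obtained has no singularity at \<open>x = sqrt 2 * A_N N\<close>, so it lies below each
  of the three expressions: the member \<open>1 / A\<^sup>2\<close> of the minimum serves the first two ranges and
  \<open>2 / x\<^sup>2\<close> the last one.\<close>

lemma Delta_ge:
  assumes x: "x > 0" and N: "N \<ge> 1"
  defines "A \<equiv> A_N N"
  shows "x / sqrt pi * min (1 / A\<^sup>2) (2 / x\<^sup>2) * (exp (- A\<^sup>2) / (1 - exp (- 2 * A\<^sup>2))) \<le> Delta N x"
proof -
  define y where "y = x / sqrt 2"
  define c where "c = x * exp (- A\<^sup>2) / (sqrt pi * (1 - exp (- 2 * A\<^sup>2)))"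
  have A: "A > 0" by (simp add: A_def A_N_pos)
  have y: "y > 0" "x\<^sup>2 / 2 = y\<^sup>2" using x by (simp_all add: y_def power_divide)
  have q: "1 - exp (- 2 * A\<^sup>2) > 0" using A by simp
  have c: "c > 0" using x q by (simp add: c_def)
  have lhs: "x / sqrt pi * m * (exp (- A\<^sup>2) / (1 - exp (- 2 * A\<^sup>2))) = c * m" for m
    by (simp add: c_def)
  have d1: "x * exp (- A\<^sup>2) / (sqrt pi * D * (1 - exp (- 2 * A\<^sup>2))) = c * (1 / D)" for D
    by (simp add: c_def)
  consider "y \<le> 3/4 * A" | "y > 3/4 * A" "y < 5/4 * A" | "y > 3/4 * A" "y \<ge> 5/4 * A" by linarith
  then show ?thesis
  proof cases
    case 1
    have "y\<^sup>2 \<le> (3/4 * A)\<^sup>2" using 1 y by (intro power_mono) auto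
    also have "\<dots> < A\<^sup>2" using A by (simp add: power_mult_distrib power2_eq_square)
    finally have "1 / A\<^sup>2 \<le> 1 / (A\<^sup>2 - y\<^sup>2)"
      using A by (intro divide_left_mono mult_pos_pos) auto
    then have "c * min (1 / A\<^sup>2) (2 / x\<^sup>2) \<le> c * (1 / (A\<^sup>2 - y\<^sup>2))"
      using c by (intro mult_left_mono) auto
    then show ?thesis
      unfolding Delta_def A_def[symmetric] y_def[symmetric] y(2) lhs d1 using 1 by simp
  next
    case 2
    define P where "P = 1 + 2 * sqrt pi * exp (- beta * A\<^sup>2)"
    have P: "P \<ge> 1" by (simp add: P_def)
    have "4 * x * exp (- A\<^sup>2) * P / (sqrt pi * A * (A + y) * (1 - exp (- 2 * A\<^sup>2))) = c * (4 * P / (A * (A + y)))"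
      by (simp add: c_def mult_ac)
    moreover have "1 / A\<^sup>2 \<le> 4 * P / (A * (A + y))"
    proof -
      have "A + y \<le> 4 * P * A" using 2 P A mult_right_mono[of 1 P A] by linarith
      then have "A * (A + y) \<le> A * (4 * P * A)" using A by (intro mult_left_mono) auto
      then show ?thesis using A y by (simp add: divide_simps power2_eq_square mult_ac)
    qed
    then have "c * min (1 / A\<^sup>2) (2 / x\<^sup>2) \<le> c * (4 * P / (A * (A + y)))"
      using c by (intro mult_left_mono) auto
    ultimately show ?thesis
      unfolding Delta_def A_def[symmetric] y_def[symmetric] lhs P_def[symmetric] using 2 by simp
  next
    case 3
    have "A\<^sup>2 < y\<^sup>2" using 3 A by (intro power_strict_mono) auto
    then have "2 / x\<^sup>2 \<le> 1 / (y\<^sup>2 - A\<^sup>2)"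
      using x by (simp add: y(2)[symmetric] divide_simps)
    then have "c * min (1 / A\<^sup>2) (2 / x\<^sup>2) \<le> c * (1 / (y\<^sup>2 - A\<^sup>2))"
      using c by (intro mult_left_mono) auto
    moreover have "0 \<le> exp (- sqrt 2 * A * x) / (1 - exp (- sqrt 2 * A * x))"
      using x A by simp
    ultimately show ?thesis
      unfolding Delta_def A_def[symmetric] y_def[symmetric] y(2) lhs d1 using 3 by simp
  qed
qed

lemma fresnel_approx_error_pos:
  assumes x: "x > 0" and N: "N \<ge> 1"
  shows "norm (fresnel x - fresnel_approx N x) \<le> eta N x"
proof -
  define A where "A = A_N N"
  define p where "p = (\<lambda>k. of_real (((real k + 1/2) * pi / A)\<^sup>2) - \<i> * complex_of_real (x\<^sup>2))"
  define T where "T = (\<lambda>k. ray * of_real (x / A) * (exp (- p k) / p k))"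
  define b where "b = (\<lambda>k::nat. x / (A * sqrt (x ^ 4 + A ^ 4)) * exp (- A\<^sup>2) * exp (- 2 * pi) ^ k)"
  have A: "A \<ge> 1" using A_N_ge_2[OF N] by (simp add: A_def)
  obtain R where R: "T sums (fresnel x - 1 / (exp (2 * of_real A * (ray * of_real x)) + 1) - R)"
    and normR: "norm R \<le> x / sqrt pi * min (1 / A\<^sup>2) (2 / x\<^sup>2) * (exp (- A\<^sup>2) / (1 - exp (- 2 * A\<^sup>2)))"
    using midpoint_rule_error[OF A x] unfolding T_def p_def by blast
  have b: "b sums (x / (A * sqrt (x ^ 4 + A ^ 4)) * exp (- A\<^sup>2) * (1 / (1 - exp (- 2 * pi))))"
    unfolding b_def by (intro sums_mult geometric_sums) simp
  have Tb: "norm (T (k + N)) \<le> b k" for k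
    unfolding T_def p_def b_def A_def by (rule norm_fresnel_tail_term[OF x N])
  have tail: "(\<lambda>k. T (k + N)) sums (fresnel x - 1 / (exp (2 * of_real A * (ray * of_real x)) + 1) - R - (\<Sum>k<N. T k))"
    using R by (subst sums_iff_shift) simp
  have "norm (\<Sum>k. T (k + N)) \<le> suminf b"
    using Tb by (intro norm_suminf_le sums_summable[OF b])
  also have "\<dots> = x / (A * sqrt (x ^ 4 + A ^ 4)) * exp (- A\<^sup>2) * (1 / (1 - exp (- 2 * pi)))"
    by (rule sums_unique[OF b, symmetric])
  also have "\<dots> \<le> x / (A * sqrt (x ^ 4 + A ^ 4)) * exp (- A\<^sup>2) * ((2 * pi + 1) / (2 * pi))"
    using x A by (intro mult_left_mono inverse_one_minus_exp_le) auto
  also have "\<dots> = (2 * pi + 1) * \<bar>x\<bar> / (2 * pi * A * sqrt (x ^ 4 + A ^ 4)) * exp (- A\<^sup>2)"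
    using x by (simp add: divide_simps)
  finally have tail_le: "norm (\<Sum>k. T (k + N)) \<le> (2 * pi + 1) * \<bar>x\<bar> / (2 * pi * A * sqrt (x ^ 4 + A ^ 4)) * exp (- A\<^sup>2)" .
  have "fresnel_approx N x = 1 / (exp (2 * of_real A * (ray * of_real x)) + 1) + (\<Sum>k<N. T k)"
    unfolding T_def p_def A_def by (rule fresnel_approx_eq)
  then have "fresnel x - fresnel_approx N x = R + (\<Sum>k. T (k + N))"
    unfolding sums_unique[OF tail, symmetric] by simp
  then have "norm (fresnel x - fresnel_approx N x) \<le> norm R + norm (\<Sum>k. T (k + N))"
    by (simp only: norm_triangle_ineq)
  also have "\<dots> \<le> eta N x"
    unfolding eta_def A_def[symmetric]
    using normR Delta_ge[OF x N] tail_le x by (intro add_mono) (auto simp: A_def)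
  finally show ?thesis .
qed

theorem fresnel_approx_error:
  assumes N: "N \<ge> 1"
  shows "norm (fresnel x - fresnel_approx N x) \<le> eta N x"
proof -
  consider "x > 0" | "x = 0" | "x < 0" by linarith
  then show ?thesis
  proof cases
    case 2
    then show ?thesis
      using A_N_pos[of N] by (simp add: fresnel_0 fresnel_approx_def eta_def Delta_def)
  next
    case 3
    have "norm (fresnel (- x) - fresnel_approx N (- x)) \<le> eta N (- x)"
      using 3 by (intro fresnel_approx_error_pos N) auto
    moreover have "fresnel (- x) - fresnel_approx N (- x) = - (fresnel x - fresnel_approx N x)"
      by (simp add: fresnel_minus fresnel_approx_minus[OF N])
    moreover have "eta N (- x) = eta N x" by (simp add: eta_def)
    ultimately show ?thesis by (simp only: norm_minus_cancel)
  qed (rule fresnel_approx_error_pos[OF _ N])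
qed

section \<open>The size of the absolute error bound\<close>

lemma sqrt_2_bounds: "14/10 < sqrt 2" "sqrt 2 < 15/10"
  by (rule real_less_rsqrt, simp add: power2_eq_square) (rule real_less_lsqrt, simp_all add: power2_eq_square)

lemma beta_eq: "beta = 15/16 - 5/8 * sqrt 2"
  by (simp add: beta_def field_simps)

lemma beta_bounds: "0 < beta" "beta < 1/2"
proof -
  show "0 < beta" unfolding beta_eq using sqrt_2_bounds by linarith
  show "beta < 1/2" unfolding beta_eq using sqrt_2_bounds by linarith
qed

lemma sqrt_pi_bounds: "17/10 < sqrt pi" "sqrt pi < 18/10"
proof -
  have "(17/10)\<^sup>2 < pi" "pi < (18/10)\<^sup>2" using pi_approx by (simp_all add: power2_eq_square)
  then show "17/10 < sqrt pi" by (intro real_less_rsqrt)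
  show "sqrt pi < 18/10" by (intro real_less_lsqrt \<open>pi < _\<close>) simp
qed

text \<open>The supremum of the middle branch, approached as \<open>x\<close> tends to \<open>5 * sqrt 2 / 4 * A_N N\<close>.\<close>

definition Delta_max :: "nat \<Rightarrow> real" where
  "Delta_max N = 20 * sqrt 2 / 9 * exp (- (A_N N)\<^sup>2) * (1 + 2 * sqrt pi * exp (- beta * (A_N N)\<^sup>2))
      / (sqrt pi * A_N N * (1 - exp (- 2 * (A_N N)\<^sup>2)))"

text \<open>The factor \<open>27/35\<close> is the ratio of the two branches at their respective right ends
  \<open>3/4 * A_N N\<close> and \<open>5/4 * A_N N\<close>, in the variable \<open>x / sqrt 2\<close>, when the term in \<open>beta\<close> is left out of the middle one.\<close>

lemma Delta_le_small:
  assumes N: "N \<ge> 1" and x: "x \<ge> 0" "x / sqrt 2 \<le> 3/4 * A_N N"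
  shows "Delta N x \<le> Delta_max N * (27/35)"
proof -
  define A where "A = A_N N"
  define y where "y = x / sqrt 2"
  define c where "c = exp (- A\<^sup>2) / (sqrt pi * (1 - exp (- 2 * A\<^sup>2)))"
  have A: "A \<ge> 2" using A_N_ge_2[OF N] by (simp add: A_def)
  have y: "0 \<le> y" "y \<le> 3/4 * A" "x = sqrt 2 * y" using x by (simp_all add: y_def A_def)
  have c: "c > 0" using A by (simp add: c_def)
  have "y\<^sup>2 \<le> (3/4 * A)\<^sup>2" using y by (intro power_mono) auto
  then have D: "7/16 * A\<^sup>2 \<le> A\<^sup>2 - y\<^sup>2" by (simp add: power_mult_distrib power2_eq_square)
  have "Delta N x = c * (sqrt 2 * y / (A\<^sup>2 - y\<^sup>2))"
    using y unfolding Delta_def A_def[symmetric] by (simp add: c_def power_mult_distrib mult_ac)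
  also have "\<dots> \<le> c * (sqrt 2 * (3/4 * A) / (7/16 * A\<^sup>2))"
    using c y A D by (intro mult_left_mono frac_le) auto
  also have "\<dots> = c * (20 * sqrt 2 / 9 / A) * (27/35)"
    using A by (simp add: power2_eq_square)
  also have "\<dots> \<le> c * (20 * sqrt 2 / 9 / A) * (1 + 2 * sqrt pi * exp (- beta * A\<^sup>2)) * (27/35)"
  proof -
    have "c * (20 * sqrt 2 / 9 / A) * 1 \<le> c * (20 * sqrt 2 / 9 / A) * (1 + 2 * sqrt pi * exp (- beta * A\<^sup>2))"
      using c A by (intro mult_left_mono) auto
    then show ?thesis by simp
  qed
  also have "c * (20 * sqrt 2 / 9 / A) * (1 + 2 * sqrt pi * exp (- beta * A\<^sup>2)) = Delta_max N"
    unfolding Delta_max_def A_def[symmetric] by (simp add: c_def mult_ac)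
  finally show ?thesis .
qed

lemma Delta_le_middle:
  assumes N: "N \<ge> 1" and x: "3/4 * A_N N < x / sqrt 2" "x / sqrt 2 < 5/4 * A_N N"
  shows "Delta N x \<le> Delta_max N"
proof -
  define A where "A = A_N N"
  define y where "y = x / sqrt 2"
  define P where "P = 1 + 2 * sqrt pi * exp (- beta * A\<^sup>2)"
  define c where "c = exp (- A\<^sup>2) * P / (sqrt pi * A * (1 - exp (- 2 * A\<^sup>2)))"
  have A: "A \<ge> 2" using A_N_ge_2[OF N] by (simp add: A_def)
  have y: "3/4 * A < y" "y < 5/4 * A" "x = sqrt 2 * y" using x by (simp_all add: y_def A_def)
  have c: "c > 0" using A by (simp add: c_def P_def add_pos_pos)
  have "Delta N x = c * (4 * sqrt 2 * y / (A + y))"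
    using y unfolding Delta_def A_def[symmetric] P_def[symmetric] by (simp add: c_def mult_ac)
  also have "\<dots> \<le> c * (20 * sqrt 2 / 9)"
  proof (rule mult_left_mono)
    have "sqrt 2 * (36 * y) \<le> sqrt 2 * (20 * (A + y))" using y by (intro mult_left_mono) auto
    then show "4 * sqrt 2 * y / (A + y) \<le> 20 * sqrt 2 / 9" using y A by (simp add: divide_simps)
  qed (use c in simp)
  also have "\<dots> = Delta_max N"
    unfolding Delta_max_def A_def[symmetric] P_def[symmetric] by (simp add: c_def mult_ac)
  finally show ?thesis .
qed

text \<open>The decay in \<open>\<xi>\<close> compensates the linear growth of the reciprocal of the Fresnel integral.  At
  \<open>\<xi> = 1\<close> the rational part of the last branch equals \<open>Delta_max\<close> without its term in \<open>beta\<close>; that term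
  leaves room for the exponential part, since \<open>A * exp (- A\<^sup>2) \<le> 1\<close> and \<open>beta < 1/2\<close>.\<close>

lemma Delta_le_large:
  assumes N: "N \<ge> 1" and \<xi>: "\<xi> \<ge> 1"
  shows "Delta N (\<xi> * (5 * sqrt 2 / 4 * A_N N)) \<le> Delta_max N / \<xi>"
proof -
  define A where "A = A_N N"
  define y where "y = 5/4 * A * \<xi>"
  define x where "x = \<xi> * (5 * sqrt 2 / 4 * A)"
  define q where "q = 1 - exp (- 2 * A\<^sup>2)"
  define c where "c = exp (- A\<^sup>2) / (sqrt pi * q)"
  have A: "A \<ge> 2" using A_N_ge_2[OF N] by (simp add: A_def)
  have q: "q > 0" using A by (simp add: q_def)
  have c: "c > 0" using q by (simp add: c_def)
  have y: "y \<ge> 5/4 * A" using A \<xi> by (simp add: y_def)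
  have xy: "x / sqrt 2 = y" "x = sqrt 2 * y" by (simp_all add: x_def y_def)
  have \<xi>2: "1 \<le> \<xi>\<^sup>2" using \<xi> by (simp add: one_le_power)
  have y2: "9/16 * (A * \<xi>)\<^sup>2 \<le> y\<^sup>2 - A\<^sup>2"
    using mult_left_mono[OF \<xi>2 zero_le_power2[of A]] by (simp add: y_def power_mult_distrib power2_eq_square)
  have sqrtAx: "- sqrt 2 * A * x = - (5/2 * A\<^sup>2 * \<xi>)"
    by (simp add: x_def power2_eq_square)
  have "Delta N x = c * (sqrt 2 * y / (y\<^sup>2 - A\<^sup>2)) + exp (- (5/2 * A\<^sup>2 * \<xi>)) / (1 - exp (- (5/2 * A\<^sup>2 * \<xi>)))"
    using y A unfolding Delta_def A_def[symmetric] xy(1) sqrtAx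
    by (simp add: c_def q_def xy(2) power_mult_distrib mult_ac)
  moreover have "c * (sqrt 2 * y / (y\<^sup>2 - A\<^sup>2)) \<le> c * (sqrt 2 * y / (9/16 * (A * \<xi>)\<^sup>2))"
  proof -
    have "0 < 9/16 * (A * \<xi>)\<^sup>2" using A \<xi> by simp
    moreover from this have "0 < y\<^sup>2 - A\<^sup>2" using y2 by linarith
    ultimately show ?thesis
      using c y y2 A by (intro mult_left_mono divide_left_mono mult_pos_pos) auto
  qed
  moreover have "c * (sqrt 2 * y / (9/16 * (A * \<xi>)\<^sup>2)) = c * (20 * sqrt 2 / 9 / A) / \<xi>"
    using A \<xi> by (simp add: y_def power2_eq_square)
  moreover have "exp (- (5/2 * A\<^sup>2 * \<xi>)) / (1 - exp (- (5/2 * A\<^sup>2 * \<xi>)))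
      \<le> c * (20 * sqrt 2 / 9 / A) * (2 * sqrt pi * exp (- beta * A\<^sup>2)) / \<xi>"
  proof -
    have "\<xi> \<le> exp (\<xi> - 1)" using exp_ge_add_one_self[of "\<xi> - 1"] by simp
    also have "\<dots> \<le> exp (5/2 * A\<^sup>2 * (\<xi> - 1))"
    proof -
      have "1 \<le> 5/2 * A\<^sup>2" using power_mono[OF A, of 2] by simp
      then have "1 * (\<xi> - 1) \<le> 5/2 * A\<^sup>2 * (\<xi> - 1)" using \<xi> by (intro mult_right_mono) auto
      then show ?thesis by simp
    qed
    finally have "exp (- (5/2 * A\<^sup>2 * \<xi>)) * \<xi> \<le> exp (- (5/2 * A\<^sup>2 * \<xi>)) * exp (5/2 * A\<^sup>2 * (\<xi> - 1))"
      by (intro mult_left_mono) auto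
    also have "\<dots> = exp (- (5/2 * A\<^sup>2))" unfolding exp_add[symmetric] by (rule arg_cong[of _ _ exp]) (simp add: field_simps)
    finally have num: "exp (- (5/2 * A\<^sup>2 * \<xi>)) \<le> exp (- (5/2 * A\<^sup>2)) / \<xi>"
      using \<xi> by (simp add: le_divide_eq)
    have den: "q \<le> 1 - exp (- (5/2 * A\<^sup>2 * \<xi>))"
    proof -
      have "2 * A\<^sup>2 * 1 \<le> 5/2 * A\<^sup>2 * \<xi>" using \<xi> by (intro mult_mono) auto
      then show ?thesis by (simp add: q_def)
    qed
    have "exp (- (5/2 * A\<^sup>2 * \<xi>)) / (1 - exp (- (5/2 * A\<^sup>2 * \<xi>))) \<le> exp (- (5/2 * A\<^sup>2)) / \<xi> / q"
      using q \<xi> by (intro frac_le num den) auto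
    also have "exp (- (5/2 * A\<^sup>2)) \<le> exp (- A\<^sup>2) * (40 * sqrt 2 / 9 / A) * exp (- beta * A\<^sup>2)"
    proof -
      have "A \<le> A * A" using A by simp
      also have "A * A < exp (A\<^sup>2)" using exp_ge_add_one_self[of "A * A"] unfolding power2_eq_square by linarith
      finally have "A * exp (- A\<^sup>2) \<le> 1" by (simp add: exp_minus divide_simps)
      moreover have "1 \<le> 40 * sqrt 2 / 9" using sqrt_2_bounds by simp
      ultimately have "A * exp (- A\<^sup>2) \<le> 40 * sqrt 2 / 9" by linarith
      then have "exp (- A\<^sup>2) \<le> 40 * sqrt 2 / 9 / A" using A by (simp add: field_simps)
      moreover have "exp (- (5/2 * A\<^sup>2)) \<le> exp (- A\<^sup>2) * exp (- A\<^sup>2) * exp (- beta * A\<^sup>2)"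
      proof -
        have "beta * A\<^sup>2 \<le> 1/2 * A\<^sup>2" using beta_bounds by (intro mult_right_mono) auto
        then show ?thesis by (simp add: mult_exp_exp)
      qed
      ultimately show ?thesis
        by (meson exp_ge_zero mult_left_mono mult_right_mono order_trans)
    qed
    then have "exp (- (5/2 * A\<^sup>2)) / \<xi> / q \<le> exp (- A\<^sup>2) * (40 * sqrt 2 / 9 / A) * exp (- beta * A\<^sup>2) / \<xi> / q"
      using q \<xi> by (intro divide_right_mono) auto
    also have "\<dots> = c * (20 * sqrt 2 / 9 / A) * (2 * sqrt pi * exp (- beta * A\<^sup>2)) / \<xi>"
      by (simp add: c_def mult_ac)
    finally show ?thesis .
  qed
  ultimately have "Delta N x \<le> c * (20 * sqrt 2 / 9 / A) / \<xi>
      + c * (20 * sqrt 2 / 9 / A) * (2 * sqrt pi * exp (- beta * A\<^sup>2)) / \<xi>" by linarith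
  also have "\<dots> = c * (20 * sqrt 2 / 9 / A) * (1 + 2 * sqrt pi * exp (- beta * A\<^sup>2)) / \<xi>"
    by (simp only: distrib_left add_divide_distrib mult_1_right)
  also have "\<dots> = Delta_max N / \<xi>"
    unfolding Delta_max_def A_def[symmetric] q_def[symmetric] by (simp add: c_def mult_ac)
  finally show ?thesis by (simp add: x_def A_def)
qed

lemma Delta_max_pos: "Delta_max N > 0"
  using A_N_pos[of N] unfolding Delta_max_def
  by (intro divide_pos_pos mult_pos_pos add_pos_pos) auto

text \<open>The modulus of \<open>x\<^sup>2 + \<i> * (A_N N)\<^sup>2\<close>, a lower bound for the denominators of all omitted summands.\<close>

definition quartic_modulus :: "nat \<Rightarrow> real \<Rightarrow> real" where
  "quartic_modulus N x = sqrt (x ^ 4 + (A_N N) ^ 4)"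

lemma quartic_modulus_bounds:
  assumes x: "x \<ge> 0"
  shows "quartic_modulus N x > 0" and "x / quartic_modulus N x \<le> 1 / (sqrt 2 * A_N N)"
    and "x\<^sup>2 / quartic_modulus N x \<le> 1"
    and "x / sqrt 2 \<le> 3/4 * A_N N \<Longrightarrow> x\<^sup>2 / quartic_modulus N x \<le> 3 / 4"
proof -
  define A where "A = A_N N"
  define s where "s = quartic_modulus N x"
  have A: "A > 0" by (simp add: A_def A_N_pos)
  have s2: "s\<^sup>2 = (x\<^sup>2)\<^sup>2 + (A\<^sup>2)\<^sup>2" using A by (simp add: s_def quartic_modulus_def A_def[symmetric])
  show s: "s > 0" using A by (simp add: s_def quartic_modulus_def A_def[symmetric] add_nonneg_pos)
  have "0 \<le> (x\<^sup>2 - A\<^sup>2)\<^sup>2" by simp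
  then have "(sqrt 2 * x * A)\<^sup>2 \<le> s\<^sup>2"
    unfolding s2 by (simp add: power_mult_distrib power2_diff)
  then have "sqrt 2 * x * A \<le> s" by (rule power2_le_imp_le) (use s in simp)
  then show "x / s \<le> 1 / (sqrt 2 * A)" using s A by (simp add: divide_simps mult_ac)
  have "(x\<^sup>2)\<^sup>2 \<le> s\<^sup>2" unfolding s2 by simp
  then have "x\<^sup>2 \<le> s" by (rule power2_le_imp_le) (use s in simp)
  then show "x\<^sup>2 / s \<le> 1" using s by simp
  assume "x / sqrt 2 \<le> 3/4 * A"
  then have "(x / sqrt 2)\<^sup>2 \<le> (3/4 * A)\<^sup>2" using x by (intro power_mono) auto
  then have "x\<^sup>2 \<le> 9/8 * A\<^sup>2" by (simp add: power_divide power_mult_distrib)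
  then have "(x\<^sup>2)\<^sup>2 \<le> (9/8 * A\<^sup>2)\<^sup>2" by (intro power_mono) auto
  then have "(x\<^sup>2)\<^sup>2 \<le> 81/64 * (A\<^sup>2)\<^sup>2" by (simp add: power_mult_distrib power_divide)
  moreover have "0 \<le> (A\<^sup>2)\<^sup>2" by simp
  ultimately have "16/9 * (x\<^sup>2)\<^sup>2 \<le> (x\<^sup>2)\<^sup>2 + (A\<^sup>2)\<^sup>2" by linarith
  moreover have "(4/3 * x\<^sup>2)\<^sup>2 = 16/9 * (x\<^sup>2)\<^sup>2" by (simp add: power_mult_distrib power_divide)
  ultimately have "(4/3 * x\<^sup>2)\<^sup>2 \<le> s\<^sup>2" unfolding s2 by linarith
  then have "4/3 * x\<^sup>2 \<le> s" by (rule power2_le_imp_le) (use s in simp)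
  then show "x\<^sup>2 / s \<le> 3 / 4" using s by (simp add: divide_simps)
qed

definition tail_factor :: "nat \<Rightarrow> real" where
  "tail_factor N = (2 * pi + 1) / (pi * A_N N) * exp (- (A_N N)\<^sup>2)"

lemma tail_factor_pos: "tail_factor N > 0"
  using A_N_pos[of N] by (simp add: tail_factor_def add_pos_pos)

lemma eta_eq: "eta N x = Delta N \<bar>x\<bar> + tail_factor N / 2 * (\<bar>x\<bar> / quartic_modulus N x)"
  by (simp add: eta_def tail_factor_def quartic_modulus_def mult_ac)

lemma exp_A_N_squared: "exp (- (A_N N)\<^sup>2) = exp (- pi * real N) * exp (- pi / 2)"
  unfolding A_N_squared by (simp add: exp_add[symmetric] algebra_simps)

text \<open>The first summand is \<open>Delta_max\<close> times the bound \<open>2 + 2 * sqrt pi * x\<close> for the reciprocal of the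
  Fresnel integral at the end \<open>x = 5 * sqrt 2 / 4 * A_N N\<close> of the middle range; the second one is the
  truncation error times the same bound, maximised separately in \<open>x\<close> and \<open>x\<^sup>2\<close>.\<close>

lemma c_star_eq:
  "c_star N * exp (- pi * real N)
     = Delta_max N * (2 + 2 * sqrt pi * (5 * sqrt 2 / 4 * A_N N))
       + tail_factor N * (1 / (sqrt 2 * A_N N) + sqrt pi)"
proof -
  have A: "A_N N > 0" by (rule A_N_pos)
  have "exp (- pi / 2) = 1 / exp (pi / 2)" by (simp add: exp_minus field_simps)
  then have e: "exp (- (A_N N)\<^sup>2) = exp (- pi * real N) / exp (pi / 2)"
    unfolding exp_A_N_squared by simp
  have x0: "2 + 2 * sqrt pi * (5 * sqrt 2 / 4 * A) = (4 + 5 * (sqrt 2 * sqrt pi) * A) / 2" for A :: real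
    by (simp add: field_simps)
  show ?thesis
    unfolding c_star_def Delta_max_def tail_factor_def real_sqrt_mult distrib_right[of _ _ "exp (- pi * real N)"] e x0
    by (intro arg_cong2[of _ _ _ _ "(+)"]) (simp_all add: mult_ac)
qed

lemma c_N_eq:
  "2 * c_N N * (exp (- pi * real N) / sqrt (real N + 1/2))
     = 2 * (Delta_max N + tail_factor N / 2 * (1 / (sqrt 2 * A_N N)))"
proof -
  have "A_N N = sqrt (real N + 1/2) * sqrt pi" by (simp add: A_N_def real_sqrt_mult)
  then have s: "1 / sqrt (real N + 1/2) = sqrt pi / A_N N"
    by (simp add: field_simps)
  have powr: "pi powr (3/2) = pi * sqrt pi"
  proof -
    have "pi powr (1 + 1/2) = pi powr 1 * pi powr (1/2)" by (simp only: powr_add)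
    then show ?thesis by (simp add: powr_half_sqrt)
  qed
  have "exp (- pi * real N) / sqrt (real N + 1/2) = exp (- pi * real N) * (sqrt pi / A_N N)"
    by (simp only: s[symmetric]) simp
  moreover have "20 * sqrt 2 * exp (- pi / 2) / (9 * pi * q) * P * (E * (sqrt pi / A))
     = 20 * sqrt 2 / 9 * (E * exp (- pi / 2)) * P / (sqrt pi * A * q)" for P q E A :: real
  proof -
    have "20 * sqrt 2 * exp (- pi / 2) / (9 * pi * q) * P * (E * (sqrt pi / A))
     = 20 * sqrt 2 / 9 * (E * exp (- pi / 2)) * P / (A * q) * (sqrt pi / pi)" by (simp add: mult_ac)
    also have "sqrt pi / pi = 1 / sqrt pi" by (simp add: field_simps)
    finally show ?thesis by (simp add: mult_ac)
  qed
  moreover have "(2 * pi + 1) * exp (- pi / 2) / (2 * sqrt 2 * (pi * sqrt pi) * A) * (E * (sqrt pi / A))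
     = (2 * pi + 1) / (pi * A) * (E * exp (- pi / 2)) / 2 * (1 / (sqrt 2 * A))" for E A :: real
    by (simp add: mult_ac)
  ultimately show ?thesis
    unfolding c_N_def Delta_max_def tail_factor_def exp_A_N_squared powr
    by (simp only: distrib_right mult.assoc[of 2])
qed

section \<open>The relative error\<close>

lemma Delta_le_Delta_max:
  assumes N: "N \<ge> 1" and x: "x \<ge> 0"
  shows "Delta N x \<le> Delta_max N"
proof -
  define A where "A = A_N N"
  have A: "A > 0" by (simp add: A_def A_N_pos)
  note D0 = Delta_max_pos[of N]
  consider "x / sqrt 2 \<le> 3/4 * A" | "3/4 * A < x / sqrt 2" "x / sqrt 2 < 5/4 * A" | "5/4 * A \<le> x / sqrt 2" by linarith
  then show ?thesis
  proof cases
    case 1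
    have "Delta N x \<le> Delta_max N * (27/35)"
      by (rule Delta_le_small[OF N x]) (use 1 in \<open>simp add: A_def\<close>)
    with D0 show ?thesis by linarith
  next
    case 2
    then show ?thesis unfolding A_def by (intro Delta_le_middle[OF N])
  next
    case 3
    define \<xi> where "\<xi> = x / (5 * sqrt 2 / 4 * A)"
    have "\<xi> \<ge> 1" "\<xi> * (5 * sqrt 2 / 4 * A_N N) = x"
      using 3 A by (simp_all add: \<xi>_def field_simps flip: A_def)
    with Delta_le_large[OF N, of \<xi>] have "Delta N x \<le> Delta_max N / \<xi>" by simp
    also have "\<dots> \<le> Delta_max N / 1" using D0 \<open>\<xi> \<ge> 1\<close> by (intro divide_left_mono) auto
    finally show ?thesis by simp
  qed
qed

lemma Delta_weighted_le:
  assumes N: "N \<ge> 1" and x: "3/4 * A_N N < x / sqrt 2"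
  shows "Delta N x * (2 + 2 * sqrt pi * x) \<le> Delta_max N * (2 + 2 * sqrt pi * (5 * sqrt 2 / 4 * A_N N))"
proof -
  define A where "A = A_N N"
  define x0 where "x0 = 5 * sqrt 2 / 4 * A"
  have A: "A > 0" by (simp add: A_def A_N_pos)
  have "0 < 3/4 * A_N N" using A by (simp add: A_def)
  also note x
  finally have x': "x > 0" by (simp add: zero_less_divide_iff)
  have x0: "x0 > 0" using A by (simp add: x0_def)
  note D0 = Delta_max_pos[of N]
  show ?thesis
  proof (cases "x / sqrt 2 < 5/4 * A")
    case True
    then have "x \<le> x0" by (simp add: x0_def field_simps)
    then have "2 + 2 * sqrt pi * x \<le> 2 + 2 * sqrt pi * x0" by simp
    moreover have "Delta N x \<le> Delta_max N" by (rule Delta_le_Delta_max[OF N]) (use x' in simp)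
    ultimately show ?thesis unfolding A_def[symmetric] x0_def[symmetric]
      using D0 x' by (intro mult_mono) (auto intro!: add_nonneg_nonneg)
  next
    case False
    define \<xi> where "\<xi> = x / x0"
    have \<xi>: "\<xi> \<ge> 1" "x = \<xi> * x0"
      using False x0 A by (simp_all add: \<xi>_def x0_def field_simps)
    have "Delta N x \<le> Delta_max N / \<xi>"
      using Delta_le_large[OF N \<xi>(1)] by (simp add: \<xi>(2) x0_def A_def)
    moreover have "2 + 2 * sqrt pi * x \<le> \<xi> * (2 + 2 * sqrt pi * x0)"
      using \<xi> by (simp add: algebra_simps)
    ultimately have "Delta N x * (2 + 2 * sqrt pi * x) \<le> Delta_max N / \<xi> * (\<xi> * (2 + 2 * sqrt pi * x0))"
      using D0 x' \<xi> by (intro mult_mono) (auto intro!: add_nonneg_nonneg)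
    then show ?thesis using \<xi> unfolding A_def[symmetric] x0_def[symmetric] by simp
  qed
qed

lemma eta_le_neg:
  assumes N: "N \<ge> 1"
  shows "eta N x \<le> Delta_max N + tail_factor N / 2 * (1 / (sqrt 2 * A_N N))"
proof -
  have q: "quartic_modulus N x = quartic_modulus N \<bar>x\<bar>" by (simp add: quartic_modulus_def)
  show ?thesis
    unfolding eta_eq q
    using tail_factor_pos[of N]
    by (intro add_mono mult_left_mono Delta_le_Delta_max N quartic_modulus_bounds) auto
qed

text \<open>The sharper bound \<open>2 + 2 * sqrt pi * x\<close>, on which the constant is built, follows from
  \<open>norm_fresnel_ge\<close> only away from the origin; the cruder one covers the first range of \<open>x\<close>, where
  \<open>Delta\<close> leaves a margin.\<close>

lemma inverse_norm_fresnel_le: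
  assumes x: "x \<ge> 0"
  shows "fresnel x \<noteq> 0" and "1 / norm (fresnel x) \<le> 2 * sqrt pi * (1 + x)"
    and "x \<ge> 2 \<Longrightarrow> 1 / norm (fresnel x) \<le> 2 + 2 * sqrt pi * x"
proof -
  define r where "r = sqrt (x\<^sup>2 + 4)"
  define p where "p = sqrt pi"
  have p: "17/10 < p" "p < 18/10" "p\<^sup>2 = pi" using sqrt_pi_bounds by (simp_all add: p_def)
  have r: "r > 0" "r\<^sup>2 = x\<^sup>2 + 4" by (simp_all add: r_def add_nonneg_pos)
  have D: "p * (x + r) > 0" using p r x by (intro mult_pos_pos) auto
  have ge: "norm (fresnel x) \<ge> 1 / (p * (x + r))"
    using norm_fresnel_ge[OF x] by (simp add: p_def r_def)
  moreover have "1 / (p * (x + r)) > 0" using D by simp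
  ultimately have pos: "norm (fresnel x) > 0" by linarith
  then show "fresnel x \<noteq> 0" by simp
  have le: "1 / norm (fresnel x) \<le> p * (x + r)"
    using ge pos D by (simp add: field_simps)
  have "r\<^sup>2 \<le> (x + 2)\<^sup>2" unfolding r(2) using x by (simp add: power2_sum)
  then have "r \<le> x + 2" by (rule power2_le_imp_le) (use x in simp)
  then have "p * (x + r) \<le> p * (2 * (1 + x))" using p by (intro mult_left_mono) auto
  moreover have "p * (2 * (1 + x)) = 2 * sqrt pi * (1 + x)" by (simp add: p_def)
  ultimately show "1 / norm (fresnel x) \<le> 2 * sqrt pi * (1 + x)" using le by linarith
  assume x2: "x \<ge> 2"
  have "p * p \<le> p * x" using p x2 by (intro mult_left_mono) auto
  then have "(p * r)\<^sup>2 \<le> (2 + p * x)\<^sup>2"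
    unfolding power_mult_distrib r(2) power2_sum by (simp add: power2_eq_square algebra_simps)
  then have "p * r \<le> 2 + p * x" by (rule power2_le_imp_le) (use p x in simp)
  with le show "1 / norm (fresnel x) \<le> 2 + 2 * sqrt pi * x"
    by (simp add: p_def algebra_simps)
qed

text \<open>In the first range the margin \<open>27/35\<close> in \<open>Delta\<close> and the margin \<open>3/4\<close> in the truncation error pay
  for the cruder bound on the Fresnel integral.  Beyond it \<open>x \<ge> 2\<close>, and the sharper bound applies.\<close>

lemma eta_le_pos:
  assumes N: "N \<ge> 1" and x: "x \<ge> 0"
  shows "eta N x * (1 / norm (fresnel x))
     \<le> Delta_max N * (2 + 2 * sqrt pi * (5 * sqrt 2 / 4 * A_N N))
       + tail_factor N * (1 / (sqrt 2 * A_N N) + sqrt pi)"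
proof -
  define A where "A = A_N N"
  define s where "s = quartic_modulus N x"
  define T where "T = tail_factor N"
  define p where "p = sqrt pi"
  have p: "17/10 < p" "p < 18/10" using sqrt_pi_bounds by (simp_all add: p_def)
  have A: "A \<ge> 2" using A_N_ge_2[OF N] by (simp add: A_def)
  have T: "T > 0" by (simp add: T_def tail_factor_pos)
  note s = quartic_modulus_bounds[OF x, of N, folded s_def A_def]
  note D0 = Delta_max_pos[of N]
  have eta: "eta N x = Delta N x + T / 2 * (x / s)"
    using x by (simp add: eta_eq T_def s_def)
  have eta0: "eta N x \<ge> 0"
    using fresnel_approx_error[OF N, of x] norm_ge_zero order_trans by blast
  show ?thesis
  proof (cases "x / sqrt 2 \<le> 3/4 * A")
    case True
    have "eta N x * (1 / norm (fresnel x)) \<le> eta N x * (2 * p * (1 + x))"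
      unfolding p_def using eta0 by (intro mult_left_mono inverse_norm_fresnel_le x)
    also have "\<dots> = Delta N x * (2 * p * (1 + x)) + T * (p * (x / s + x\<^sup>2 / s))"
      unfolding eta using s(1) by (simp add: field_simps power2_eq_square)
    also have "\<dots> \<le> Delta_max N * (2 + 2 * p * (5 * sqrt 2 / 4 * A)) + T * (1 / (sqrt 2 * A) + p)"
    proof (rule add_mono)
      have "Delta N x * (2 * p * (1 + x)) \<le> Delta_max N * (27/35) * (2 * p * (1 + x))"
        using Delta_le_small[OF N x] True p x unfolding A_def by (intro mult_right_mono) auto
      also have "\<dots> = Delta_max N * (2 * p * (27/35 * (1 + x)))" by simp
      also have "\<dots> \<le> Delta_max N * (2 * p * (5 * sqrt 2 / 4 * A))"
      proof -
        have "x \<le> 3/4 * (sqrt 2 * A)" using True by (simp add: field_simps)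
        moreover have "14/10 * 2 \<le> sqrt 2 * A" using sqrt_2_bounds A by (intro mult_mono) auto
        moreover have "27/35 * (1 + x) \<le> 5/4 * B" if "x \<le> 3/4 * B" "14/10 * 2 \<le> B" for B
          using that by (simp add: field_simps)
        ultimately have "27/35 * (1 + x) \<le> 5/4 * (sqrt 2 * A)" by blast
        then have "27/35 * (1 + x) \<le> 5 * sqrt 2 / 4 * A" by simp
        then show ?thesis using D0 p by (intro mult_left_mono) auto
      qed
      also have "\<dots> \<le> Delta_max N * (2 + 2 * p * (5 * sqrt 2 / 4 * A))"
        using D0 by (intro mult_left_mono) auto
      finally show "Delta N x * (2 * p * (1 + x)) \<le> Delta_max N * (2 + 2 * p * (5 * sqrt 2 / 4 * A))" .
      have "p * (x / s + x\<^sup>2 / s) \<le> p * (1 / (sqrt 2 * A) + 3/4)"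
        using s(2,4) True p by (intro mult_left_mono add_mono) auto
      also have "\<dots> \<le> 1 / (sqrt 2 * A) + p"
      proof -
        have "14/10 * 2 \<le> sqrt 2 * A" using sqrt_2_bounds A by (intro mult_mono) auto
        then have u: "1 / (sqrt 2 * A) \<le> 10/28" "1 / (sqrt 2 * A) > 0" using A by (simp_all add: divide_simps)
        \<comment> \<open>What is needed is \<open>(p - 1) / (sqrt 2 * A) \<le> p / 4\<close>.\<close>
        have "(p - 1) * (1 / (sqrt 2 * A)) \<le> (p - 1) * (10/28)"
          using p u by (intro mult_left_mono) auto
        moreover have "p * (u + 3/4) \<le> u + p" if "(p - 1) * u \<le> (p - 1) * (10/28)" for u
          using that p by (simp add: algebra_simps)
        ultimately show ?thesis by blast
      qed
      finally show "T * (p * (x / s + x\<^sup>2 / s)) \<le> T * (1 / (sqrt 2 * A) + p)"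
        using T by (intro mult_left_mono) auto
    qed
    finally show ?thesis by (simp add: p_def A_def T_def)
  next
    case False
    then have xA: "3/4 * A < x / sqrt 2" by simp
    have "x \<ge> 2"
    proof -
      have "3/4 * A * sqrt 2 < x" using xA by (simp add: field_simps)
      moreover have "3/4 * 2 * (14/10) \<le> 3/4 * A * sqrt 2"
        using A sqrt_2_bounds by (intro mult_mono) auto
      ultimately show ?thesis by linarith
    qed
    have "eta N x * (1 / norm (fresnel x)) \<le> eta N x * (2 + 2 * p * x)"
      unfolding p_def using eta0 \<open>x \<ge> 2\<close> by (intro mult_left_mono inverse_norm_fresnel_le x)
    also have "\<dots> = Delta N x * (2 + 2 * p * x) + T * (x / s + p * (x\<^sup>2 / s))"
      unfolding eta using s(1) by (simp add: field_simps power2_eq_square)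
    also have "\<dots> \<le> Delta_max N * (2 + 2 * p * (5 * sqrt 2 / 4 * A)) + T * (1 / (sqrt 2 * A) + p * 1)"
      using Delta_weighted_le[OF N, of x] xA s(2,3) T p unfolding A_def p_def
      by (intro add_mono mult_left_mono) (auto simp: A_def)
    finally show ?thesis by (simp add: p_def A_def T_def)
  qed
qed

section \<open>The constant in the relative error\<close>

text \<open>The constant as a function of a real variable in place of \<open>A_N N\<close>, arranged as products of
  decreasing factors.\<close>

definition c_star_profile :: "real \<Rightarrow> real" where
  "c_star_profile A = 10 * sqrt 2 / (9 * sqrt pi * exp (pi / 2))
       * ((4 / A + 5 * sqrt (2 * pi)) * (1 + 2 * sqrt pi * exp (- beta * A\<^sup>2)) * (1 / (1 - exp (- 2 * A\<^sup>2))))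
     + (2 * pi + 1) / (pi * exp (pi / 2)) * (1 / (sqrt 2 * A\<^sup>2) + sqrt pi / A)"

lemma c_star_eq_profile: "c_star N = c_star_profile (A_N N)"
proof -
  have A: "A_N N > 0" by (rule A_N_pos)
  have 1: "4 + 5 * sqrt (2 * pi) * A_N N = (4 / A_N N + 5 * sqrt (2 * pi)) * A_N N"
    using A by (simp add: field_simps)
  have 2: "1 / (sqrt 2 * (A_N N)\<^sup>2) + sqrt pi / A_N N = 1 / A_N N * (1 / (sqrt 2 * A_N N) + sqrt pi)"
    using A by (simp add: field_simps power2_eq_square)
  show ?thesis
    unfolding c_star_def c_star_profile_def 1 2 using A
    by (intro arg_cong2[of _ _ _ _ "(+)"]) simp_all
qed

lemma c_star_profile_strict_antimono:
  assumes beta: "beta > 0" and A: "0 < A" "A < B"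
  shows "c_star_profile B < c_star_profile A"
proof -
  have sq: "A\<^sup>2 < B\<^sup>2" "0 < A\<^sup>2" using A by (auto intro!: power_strict_mono)
  have "4 / B < 4 / A" using A by (simp add: divide_strict_left_mono)
  then have f1: "0 < 4 / B + 5 * sqrt (2 * pi)" "4 / B + 5 * sqrt (2 * pi) < 4 / A + 5 * sqrt (2 * pi)"
    using A by (auto intro!: add_pos_pos)
  have f2: "0 < 1 + 2 * sqrt pi * exp (- beta * B\<^sup>2)"
    "1 + 2 * sqrt pi * exp (- beta * B\<^sup>2) < 1 + 2 * sqrt pi * exp (- beta * A\<^sup>2)"
    using sq beta by (auto intro!: add_pos_pos)
  have "0 < 1 - exp (- 2 * A\<^sup>2)" "1 - exp (- 2 * A\<^sup>2) < 1 - exp (- 2 * B\<^sup>2)"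
    using sq by auto
  then have f3: "0 < 1 / (1 - exp (- 2 * B\<^sup>2))" "1 / (1 - exp (- 2 * B\<^sup>2)) < 1 / (1 - exp (- 2 * A\<^sup>2))"
    by (auto intro!: divide_strict_left_mono mult_pos_pos)
  have "(4 / B + 5 * sqrt (2 * pi)) * (1 + 2 * sqrt pi * exp (- beta * B\<^sup>2)) * (1 / (1 - exp (- 2 * B\<^sup>2)))
     < (4 / A + 5 * sqrt (2 * pi)) * (1 + 2 * sqrt pi * exp (- beta * A\<^sup>2)) * (1 / (1 - exp (- 2 * A\<^sup>2)))"
    by (intro mult_strict_mono[OF mult_strict_mono[OF f1(2) f2(2)] f3(2)] mult_pos_pos less_imp_le
          less_trans[OF f1] less_trans[OF f2] f2(1) f3(1))
  then have "10 * sqrt 2 / (9 * sqrt pi * exp (pi / 2)) *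
       ((4 / B + 5 * sqrt (2 * pi)) * (1 + 2 * sqrt pi * exp (- beta * B\<^sup>2)) * (1 / (1 - exp (- 2 * B\<^sup>2))))
     < 10 * sqrt 2 / (9 * sqrt pi * exp (pi / 2)) *
       ((4 / A + 5 * sqrt (2 * pi)) * (1 + 2 * sqrt pi * exp (- beta * A\<^sup>2)) * (1 / (1 - exp (- 2 * A\<^sup>2))))"
    by (rule mult_strict_left_mono) simp
  moreover have "1 / (sqrt 2 * B\<^sup>2) + sqrt pi / B \<le> 1 / (sqrt 2 * A\<^sup>2) + sqrt pi / A"
    using sq A by (intro add_mono divide_left_mono mult_pos_pos mult_left_mono) auto
  then have "(2 * pi + 1) / (pi * exp (pi / 2)) * (1 / (sqrt 2 * B\<^sup>2) + sqrt pi / B)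
     \<le> (2 * pi + 1) / (pi * exp (pi / 2)) * (1 / (sqrt 2 * A\<^sup>2) + sqrt pi / A)"
    by (rule mult_left_mono) (simp add: add_nonneg_nonneg)
  ultimately show ?thesis unfolding c_star_profile_def by linarith
qed

lemma A_N_strict_mono: "M < N \<Longrightarrow> A_N M < A_N N"
  unfolding A_N_def by (intro real_sqrt_less_mono mult_strict_right_mono) auto

lemma filterlim_A_N: "filterlim A_N at_top sequentially"
  unfolding A_N_def[abs_def] by real_asymp

lemma c_star_profile_tendsto:
  assumes beta: "beta > 0"
  shows "(c_star_profile \<longlongrightarrow> 100 * exp (- pi / 2) / 9) at_top"
proof -
  have lim: "((\<lambda>A::real. 4 / A) \<longlongrightarrow> 0) at_top" "((\<lambda>A. exp (- beta * A\<^sup>2)) \<longlongrightarrow> 0) at_top"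
      "((\<lambda>A::real. exp (- 2 * A\<^sup>2)) \<longlongrightarrow> 0) at_top" "((\<lambda>A::real. 1 / (sqrt 2 * A\<^sup>2)) \<longlongrightarrow> 0) at_top"
      "((\<lambda>A::real. sqrt pi / A) \<longlongrightarrow> 0) at_top"
    using beta by real_asymp+
  have "((\<lambda>A. c_star_profile A) \<longlongrightarrow> 10 * sqrt 2 / (9 * sqrt pi * exp (pi / 2))
       * ((0 + 5 * sqrt (2 * pi)) * (1 + 2 * sqrt pi * 0) * (1 / (1 - 0)))
     + (2 * pi + 1) / (pi * exp (pi / 2)) * (0 + 0)) at_top"
    unfolding c_star_profile_def by (intro tendsto_intros lim) auto
  also have "10 * sqrt 2 / (9 * sqrt pi * exp (pi / 2))
       * ((0 + 5 * sqrt (2 * pi)) * (1 + 2 * sqrt pi * 0) * (1 / (1 - 0)))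
     + (2 * pi + 1) / (pi * exp (pi / 2)) * (0 + 0) = 100 * exp (- pi / 2) / 9"
    by (simp add: real_sqrt_mult exp_minus field_simps)
  finally show ?thesis .
qed

text \<open>The factor \<open>1/60\<close> is \<open>exp (1/2) / fact 5\<close> with \<open>exp (1/2)\<close> rounded up to two.\<close>

lemma exp_quartic_bounds:
  fixes x :: real
  assumes x: "0 \<le> x" "x \<le> 1/2"
  shows "1 + x + x^2 / 2 + x^3 / 6 + x^4 / 24 \<le> exp x"
    and "exp x \<le> 1 + x + x^2 / 2 + x^3 / 6 + x^4 / 24 + x^5 / 60"
proof -
  obtain t where t: "\<bar>t\<bar> \<le> \<bar>x\<bar>" "exp x = (\<Sum>m<5. x ^ m / fact m) + exp t / fact 5 * x ^ 5"
    using Maclaurin_exp_le[of x 5] by blast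
  have "exp t \<le> exp (1/2)" using t(1) x by simp
  also have "\<dots> \<le> 2" by (rule exp_half_le2)
  finally have "exp t * x ^ 5 \<le> 2 * x ^ 5" using x by (intro mult_right_mono) auto
  moreover have "0 \<le> exp t * x ^ 5" using x by simp
  moreover have "exp x = 1 + x + x^2 / 2 + x^3 / 6 + x^4 / 24 + exp t * x ^ 5 / 120"
    unfolding t(2) by (simp add: eval_nat_numeral)
  ultimately show "1 + x + x^2 / 2 + x^3 / 6 + x^4 / 24 \<le> exp x"
    "exp x \<le> 1 + x + x^2 / 2 + x^3 / 6 + x^4 / 24 + x^5 / 60" by linarith+
qed

text \<open>The argument is divided by eight to make the quartic bounds accurate enough.\<close>

lemma exp_half_pi_bounds: "4.81 < exp (pi / 2)" "exp (pi / 2) < 4.811"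
proof -
  have E: "exp (pi / 2) = exp (pi / 16) ^ 8" by (simp flip: exp_of_nat_mult)
  have "pi / 16 \<ge> 0.196349" "pi / 16 \<le> 0.19635" using pi_approx by simp_all
  then have "exp 0.196349 \<le> exp (pi / 16)" "exp (pi / 16) \<le> exp (0.19635::real)" by simp_all
  moreover have "1.216948 \<le> exp (0.196349::real)"
    using exp_quartic_bounds(1)[of "0.196349"] by (simp add: power_divide)
  moreover have "exp (0.19635::real) \<le> 1.216956"
    using exp_quartic_bounds(2)[of "0.19635"] by (simp add: power_divide)
  ultimately have "1.216948 \<le> exp (pi / 16)" "exp (pi / 16) \<le> 1.216956" by linarith+
  then have "1.216948 ^ 8 \<le> exp (pi / 16) ^ 8" "exp (pi / 16) ^ 8 \<le> 1.216956 ^ 8"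
    by (auto intro!: power_mono)
  then show "4.81 < exp (pi / 2)" "exp (pi / 2) < 4.811"
    unfolding E by (simp_all add: power_divide)
qed


lemma sqrt_2_bounds_fine: "1.41421 < sqrt 2" "sqrt 2 < 1.41422"
  by (rule real_less_rsqrt, simp add: power2_eq_square)
     (rule real_less_lsqrt, simp_all add: power2_eq_square)

lemma sqrt_pi_bounds_fine: "1.77245 < sqrt pi" "sqrt pi < 1.77246"
proof -
  have "1.77245\<^sup>2 < pi" "pi < 1.77246\<^sup>2" using pi_approx by (simp_all add: power2_eq_square)
  then show "1.77245 < sqrt pi" by (intro real_less_rsqrt)
  show "sqrt pi < 1.77246" by (intro real_less_lsqrt \<open>pi < _\<close>) simp
qed

lemma exp_beta_A_1_bounds:
  "0.7766 < exp (- beta * (3 / 2 * pi))" "exp (- beta * (3 / 2 * pi)) < 0.7768"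
proof -
  have b: "0.05361 \<le> beta" "beta \<le> 0.05362"
    using sqrt_2_bounds_fine unfolding beta_eq by simp_all
  have p: "4.7123 \<le> 3 / 2 * pi" "3 / 2 * pi \<le> 4.7124" using pi_approx by simp_all
  have "0.05361 * 4.7123 \<le> beta * (3 / 2 * pi)" "beta * (3 / 2 * pi) \<le> 0.05362 * 4.7124"
    using b p by (intro mult_mono; simp)+
  then have z: "0.2526 \<le> beta * (3 / 2 * pi)" "beta * (3 / 2 * pi) \<le> 0.2527" by simp_all
  have "1.28735 \<le> exp (0.2526::real)"
    using exp_quartic_bounds(1)[of "0.2526"] by (simp add: power_divide)
  also have "\<dots> \<le> exp (beta * (3 / 2 * pi))" using z by simp
  finally have l: "1.28735 \<le> exp (beta * (3 / 2 * pi))" .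
  have "exp (beta * (3 / 2 * pi)) \<le> exp (0.2527::real)" using z by simp
  also have "\<dots> \<le> 1.28751"
    using exp_quartic_bounds(2)[of "0.2527"] by (simp add: power_divide)
  finally have u: "exp (beta * (3 / 2 * pi)) \<le> 1.28751" .
  have e: "exp (- beta * (3 / 2 * pi)) = 1 / exp (beta * (3 / 2 * pi))"
    by (simp add: exp_minus inverse_eq_divide)
  have "1 / 1.28751 \<le> 1 / exp (beta * (3 / 2 * pi))" using u by (intro divide_left_mono) auto
  then show "0.7766 < exp (- beta * (3 / 2 * pi))" unfolding e by simp
  have "1 / exp (beta * (3 / 2 * pi)) \<le> 1 / 1.28735" using l by (intro divide_left_mono) auto
  then show "exp (- beta * (3 / 2 * pi)) < 0.7768" unfolding e by simp
qed

lemma quotient_mono3: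
  fixes a b c d e x y z :: real
  assumes "0 \<le> a" "a \<le> x" "0 \<le> b" "b \<le> y" "0 \<le> c" "c \<le> z" "0 < e" "e \<le> d"
  shows "a * b * c / d \<le> x * y * z / e"
  using assms by (intro frac_le mult_mono mult_nonneg_nonneg) auto

text \<open>With \<open>(A_N 1)\<^sup>2 = 3 / 2 * pi\<close> the roots combine into \<open>sqrt 3\<close> and \<open>sqrt 6\<close>.  The true value is about
  \<open>10.411\<close>, so each factor needs a relative accuracy of about one part in a thousand.\<close>

lemma c_star_1_approx: "\<bar>c_star 1 - 10.4\<bar> < 0.05"
proof -
  define A where "A = A_N 1"
  define E where "E = exp (pi / 2)"
  define P where "P = 1 + 2 * sqrt pi * exp (- beta * A\<^sup>2)"
  define K where "K = 1 / (1 - exp (- 2 * A\<^sup>2))"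
  have A0: "A > 0" by (simp add: A_def A_N_pos)
  have A2: "A\<^sup>2 = 3 / 2 * pi" unfolding A_def A_N_squared by simp
  have A: "A = sqrt 3 / sqrt 2 * sqrt pi" by (simp add: A_def A_N_def real_sqrt_mult real_sqrt_divide)
  have r3: "1.73205 < sqrt 3" "sqrt 3 < 1.73206"
    by (rule real_less_rsqrt, simp add: power2_eq_square)
       (rule real_less_lsqrt, simp_all add: power2_eq_square)
  have r6: "2.44948 < sqrt 6" "sqrt 6 < 2.4495"
    by (rule real_less_rsqrt, simp add: power2_eq_square)
       (rule real_less_lsqrt, simp_all add: power2_eq_square)
  note r2 = sqrt_2_bounds_fine
  have pi': "3.14159 \<le> pi" "pi \<le> 3.1416" using pi_approx by simp_all
  have E: "4.81 \<le> E" "E \<le> 4.811" using exp_half_pi_bounds by (simp_all add: E_def)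
  have "2 * 1.77245 * 0.7766 \<le> 2 * sqrt pi * exp (- beta * A\<^sup>2)"
    unfolding A2 using sqrt_pi_bounds_fine exp_beta_A_1_bounds by (intro mult_mono) auto
  moreover have "2 * sqrt pi * exp (- beta * A\<^sup>2) \<le> 2 * 1.77246 * 0.7768"
    unfolding A2 using sqrt_pi_bounds_fine exp_beta_A_1_bounds by (intro mult_mono) auto
  ultimately have P: "3.7529 \<le> P" "P \<le> 3.754" by (simp_all add: P_def)
  have "exp (2 * A\<^sup>2) = E ^ 6"
    unfolding A2 E_def by (simp flip: exp_of_nat_mult)
  moreover have "4 ^ 6 \<le> E ^ 6" using E by (intro power_mono) auto
  ultimately have "1 / exp (2 * A\<^sup>2) \<le> 1 / 4096" by (intro divide_left_mono) auto
  then have "exp (- 2 * A\<^sup>2) \<le> 1 / 4096" by (simp add: exp_minus inverse_eq_divide)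
  then have K: "1 \<le> K" "K \<le> 1.0003" using A0 by (simp_all add: K_def divide_simps)
  have T1: "10 * sqrt 2 / (9 * sqrt pi * exp (pi / 2)) * ((4 / A + 5 * sqrt (2 * pi)) * P * K)
      = 10 / 9 * ((8 / (sqrt 3 * pi) + 10) * P * K / E)"
  proof -
    have "sqrt 2 / sqrt pi * (4 / A) = 8 / (sqrt 3 * pi)"
      using A0 by (simp add: A field_simps)
    moreover have "sqrt 2 / sqrt pi * (5 * sqrt (2 * pi)) = 10"
      by (simp add: real_sqrt_mult)
    ultimately have "sqrt 2 / sqrt pi * (4 / A + 5 * sqrt (2 * pi)) = 8 / (sqrt 3 * pi) + 10"
      by (simp only: distrib_left)
    then have "10 / 9 * ((sqrt 2 / sqrt pi * (4 / A + 5 * sqrt (2 * pi))) * P * K / E)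
       = 10 / 9 * ((8 / (sqrt 3 * pi) + 10) * P * K / E)" by (simp only:)
    then show ?thesis by (simp add: E_def mult_ac)
  qed
  have "1.73205 * 3.14159 \<le> sqrt 3 * pi" "sqrt 3 * pi \<le> 1.73206 * 3.1416"
    using r3 pi' by (intro mult_mono; simp)+
  then have "8 / (1.73206 * 3.1416) \<le> 8 / (sqrt 3 * pi)" "8 / (sqrt 3 * pi) \<le> 8 / (1.73205 * 3.14159)"
    by (intro divide_left_mono mult_pos_pos; simp)+
  then have S: "11.47 \<le> 8 / (sqrt 3 * pi) + 10" "8 / (sqrt 3 * pi) + 10 \<le> 11.4704" by simp_all
  have "11.47 * 3.7529 * 1 / 4.811 \<le> (8 / (sqrt 3 * pi) + 10) * P * K / E"
    by (rule quotient_mono3) (use S P K E in simp_all)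
  moreover have "9.94 \<le> 10 / 9 * Q" if "11.47 * 3.7529 * 1 / 4.811 \<le> Q" for Q :: real
    using that by simp
  ultimately have L1: "9.94 \<le> 10 / 9 * ((8 / (sqrt 3 * pi) + 10) * P * K / E)" by blast
  have "(8 / (sqrt 3 * pi) + 10) * P * K / E \<le> 11.4704 * 3.754 * 1.0003 / 4.81"
    by (rule quotient_mono3) (use S P K E in simp_all)
  moreover have "10 / 9 * Q \<le> 9.955" if "Q \<le> 11.4704 * 3.754 * 1.0003 / 4.81" for Q :: real
    using that by simp
  ultimately have U1: "10 / 9 * ((8 / (sqrt 3 * pi) + 10) * P * K / E) \<le> 9.955" by blast
  have T2: "(2 * pi + 1) / (pi * exp (pi / 2)) * (1 / (sqrt 2 * A\<^sup>2) + sqrt pi / A)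
      = (2 * pi + 1) / (pi * E) * (sqrt 2 / (3 * pi) + sqrt 6 / 3)"
  proof -
    have "1 / (sqrt 2 * A\<^sup>2) = sqrt 2 / (3 * pi)" unfolding A2 by (simp add: field_simps)
    moreover have "sqrt pi / A = sqrt 6 / 3"
    proof -
      have "sqrt 6 = sqrt 2 * sqrt 3" by (simp flip: real_sqrt_mult)
      then show ?thesis by (simp add: A field_simps)
    qed
    ultimately show ?thesis by (simp add: E_def)
  qed
  have piE: "3.14159 * 4.81 \<le> pi * E" "pi * E \<le> 3.1416 * 4.811"
    using pi' E by (intro mult_mono; simp)+
  have F1: "(2 * 3.14159 + 1) / (3.1416 * 4.811) \<le> (2 * pi + 1) / (pi * E)"
    by (rule frac_le) (use pi' E piE in simp_all)
  have F2: "(2 * pi + 1) / (pi * E) \<le> (2 * 3.1416 + 1) / (3.14159 * 4.81)"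
    by (rule frac_le) (use pi' E piE in simp_all)
  have F: "0.4818 \<le> (2 * pi + 1) / (pi * E)" by (rule order_trans[OF _ F1]) simp
  have F': "(2 * pi + 1) / (pi * E) \<le> 0.4821" by (rule order_trans[OF F2]) simp
  have "1.41421 / (3 * 3.1416) \<le> sqrt 2 / (3 * pi)" "sqrt 2 / (3 * pi) \<le> 1.41422 / (3 * 3.14159)"
    using r2 pi' by (intro frac_le; simp)+
  then have G: "0.966 \<le> sqrt 2 / (3 * pi) + sqrt 6 / 3" "sqrt 2 / (3 * pi) + sqrt 6 / 3 \<le> 0.967"
    using r6 by simp_all
  have "0.4818 * 0.966 \<le> (2 * pi + 1) / (pi * E) * (sqrt 2 / (3 * pi) + sqrt 6 / 3)"
    by (rule mult_mono'[OF F G(1)]) simp_all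
  moreover have "(2 * pi + 1) / (pi * E) * (sqrt 2 / (3 * pi) + sqrt 6 / 3) \<le> 0.4821 * 0.967"
    by (rule mult_mono'[OF F' G(2)]) (use E in simp_all)
  moreover have "c_star 1 = 10 / 9 * ((8 / (sqrt 3 * pi) + 10) * P * K / E)
      + (2 * pi + 1) / (pi * E) * (sqrt 2 / (3 * pi) + sqrt 6 / 3)"
    unfolding c_star_eq_profile c_star_profile_def A_def[symmetric] P_def[symmetric] K_def[symmetric] T1 T2 ..
  ultimately show ?thesis using L1 U1 by (simp add: abs_less_iff)
qed

lemma c_star_limit_approx: "\<bar>100 * exp (- pi / 2) / 9 - 2.3\<bar> < (0.05::real)"
proof -
  have e: "exp (- pi / 2) = 1 / exp (pi / 2)" by (simp add: exp_minus inverse_eq_divide)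
  have "1 / 4.811 \<le> 1 / exp (pi / 2)" "1 / exp (pi / 2) \<le> 1 / 4.81"
    using exp_half_pi_bounds by (intro divide_left_mono; simp)+
  then show ?thesis unfolding e by (simp add: abs_less_iff)
qed


theorem theorem5:
  shows "(\<forall>N::nat. N \<ge> 1 \<longrightarrow> (\<forall>x::real.
            fresnel x \<noteq> 0 \<and>
            cmod (fresnel x - fresnel_approx N x) / cmod (fresnel x)
              \<le> eta N x / cmod (fresnel x) \<and>
            (x \<ge> 0 \<longrightarrow>
              eta N x / cmod (fresnel x) \<le> c_star N * exp (- pi * real N)) \<and>
            (x \<le> 0 \<longrightarrow>
              eta N x / cmod (fresnel x)
                \<le> 2 * c_N N * (exp (- pi * real N) / sqrt (real N + 1/2))))) \<and>
         (\<forall>M N::nat. 1 \<le> M \<and> M < N \<longrightarrow> c_star N < c_star M) \<and>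
         \<bar>c_star 1 - 10.4\<bar> < 0.05 \<and>
         c_star \<longlonglongrightarrow> 100 * exp (- pi / 2) / 9 \<and>
         \<bar>100 * exp (- pi / 2) / 9 - 2.3\<bar> < (0.05::real)"
proof (intro conjI allI impI)
  fix N :: nat and x :: real
  assume N: "N \<ge> 1"
  show "fresnel x \<noteq> 0"
    using inverse_norm_fresnel_le(1)[of x] norm_fresnel_ge_half[of x] by (cases "x \<ge> 0") auto
  show "cmod (fresnel x - fresnel_approx N x) / cmod (fresnel x) \<le> eta N x / cmod (fresnel x)"
    by (intro divide_right_mono fresnel_approx_error N) simp
  show "eta N x / cmod (fresnel x) \<le> c_star N * exp (- pi * real N)" if "x \<ge> 0"
    using eta_le_pos[OF N that] unfolding c_star_eq by simp
  show "eta N x / cmod (fresnel x) \<le> 2 * c_N N * (exp (- pi * real N) / sqrt (real N + 1/2))" if "x \<le> 0"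
  proof -
    have "eta N x / cmod (fresnel x) \<le> eta N x / (1 / 2)"
      using norm_fresnel_ge_half[OF that] order_trans[OF norm_ge_zero fresnel_approx_error[OF N, of x]]
      by (intro divide_left_mono) auto
    also have "\<dots> \<le> 2 * (Delta_max N + tail_factor N / 2 * (1 / (sqrt 2 * A_N N)))"
      using eta_le_neg[OF N, of x] by simp
    finally show ?thesis unfolding c_N_eq .
  qed
next
  fix M N :: nat
  assume "1 \<le> M \<and> M < N"
  then show "c_star N < c_star M"
    unfolding c_star_eq_profile
    by (intro c_star_profile_strict_antimono beta_bounds A_N_pos A_N_strict_mono) simp
next
  show "\<bar>c_star 1 - 10.4\<bar> < 0.05" by (rule c_star_1_approx)
  show "c_star \<longlonglongrightarrow> 100 * exp (- pi / 2) / 9"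
    unfolding c_star_eq_profile[abs_def]
    by (rule filterlim_compose[OF c_star_profile_tendsto filterlim_A_N]) (rule beta_bounds)
  show "\<bar>100 * exp (- pi / 2) / 9 - 2.3\<bar> < (0.05::real)" by (rule c_star_limit_approx)
qed

end
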